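(* Let the standing assumptions (A1)–(A5) of the context hold, let $q$ be the Hölder conjugate of $p$ ($\frac1p+\frac1q=1$), and fix $\omega_0\in(0,\infty)$ and $\varepsilon$. Let the source $\phi$ be $$\phi(t,\mu,\omega)=\frac{1}{\theta_\mu\theta_\omega\theta_t}\,\phi_t\!\left(\frac{t}{\theta_t}\right)\phi_\mu\!\left(\frac{\mu-\mu_0}{\theta_\mu}\right)\phi_\omega\!\left(\frac{\omega-\omega_0}{\theta_\omega}\right)$$ with $\theta=\theta_\omega=\theta_\mu=\theta_t\le\varepsilon^{\alpha}$ and $\alpha>\frac{q+1}{q-3}$, let the test function be $$\psi(t)=\psi_t\!\left(\frac{t-t_1}{\theta}\right),\qquad t_1=\frac{2\varepsilon}{\mu_0\nu(\omega_0)},$$ and assume $t_{\max}>\frac{2\varepsilon}{\nu(\omega_0)}+\theta$. Then there exist constants $c_0,c_1>0$ independent of $\varepsilon$ such that, for $\eta_1,\eta_2\in\Omega$, the measurements satisfy $$|\mathcal M^\varepsilon(\eta_1)-\mathcal M^\varepsilon(\eta_2)|\le c_1\,|\eta_1(\omega_0)-\eta_2(\omega_0)|\,e^{-c_0/\varepsilon}\quad\text{as }\theta\to0,$$ i.e. $\limsup_{\theta\to0}|\mathcal M^\varepsilon(\eta_1)-\mathcal M^\varepsilon(\eta_2)|\le c_1|\eta_1(\omega_0)-\eta_2(\omega_0)|e^{-c_0/\varepsilon}$.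
   Context: Notation. Variables: time $t\ge0$, position $x$, direction cosine $\mu\in[-1,1]$, frequency $\omega\in(0,\infty)$; $\langle h\rangle:=\int_{-1}^1\int_0^\infty h\,d\omega\,d\mu$. With $\hbar,k_B,T_0>0$ constants and $D(\omega)>0$ the phonon density of states, set $F_0^*(\omega)=\frac{\hbar\omega D(\omega)}{e^{\hbar\omega/(k_BT_0)}-1}$ and $C_\omega=\frac{(F_0^* )^2e^{\hbar\omega/(k_BT_0)}}{D(\omega)k_BT_0^2}$. For a relaxation time $\tau(\omega)$, $C_\tau:=\langle C_\omega/\tau\rangle$ and $\mathcal Lh:=\frac{C_\omega}{C_\tau}\langle h/\tau\rangle$ (in each equation $\mathcal L$ uses the relaxation time of the corresponding material). Coupled system. Let $0<\varepsilon\ll1$, $L_{\rm s}>0$. Write $\nu,\tau$ for the group velocity and relaxation time of the transducer and $\nu_{\rm s},\tau_{\rm s}$ for those of the substrate. Let $\eta(\omega)$ be the reflection coefficient of the transducer; the other interface coefficients are $\zeta=1-\eta$, $\zeta_{\rm s}=\frac{\nu}{\nu_{\rm s}}(1-\eta)$, $\eta_{\rm s}=1-\frac{\nu}{\nu_{\rm s}}(1-\eta)$; all coefficients take values in $[0,1]$. The pair $(f^\varepsilon,g^\varepsilon)$ solves (i) for $x\in[0,1]$: $\varepsilon\partial_tf^\varepsilon+\mu\nu(\omega)\partial_xf^\varepsilon=\frac1{\varepsilon\tau(\omega)}(\mathcal Lf^\varepsilon-f^\varepsilon)$; $f^\varepsilon(t,0,\mu,\omega)=\phi(t,\mu,\omega)$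 for $\mu>0$; $f^\varepsilon(t,1,\mu,\omega)=\eta(\omega)f^\varepsilon(t,1,-\mu,\omega)+\zeta(\omega)g^\varepsilon(t,1,\mu,\omega)$ for $\mu<0$; $f^\varepsilon|_{t=0}=0$; (ii) for $x\in[1,1+L_{\rm s}]$: $\varepsilon\partial_tg^\varepsilon+\mu\nu_{\rm s}(\omega)\partial_xg^\varepsilon=\frac1{\varepsilon\tau_{\rm s}(\omega)}(\mathcal Lg^\varepsilon-g^\varepsilon)$; $g^\varepsilon(t,1,\mu,\omega)=\eta_{\rm s}(\omega)g^\varepsilon(t,1,-\mu,\omega)+\zeta_{\rm s}(\omega)f^\varepsilon(t,1,\mu,\omega)$ for $\mu>0$; $g^\varepsilon(t,1+L_{\rm s},\mu,\omega)=0$ for $\mu<0$; $g^\varepsilon|_{t=0}=0$. Measurement. With final time $t_{\max}$, source $\phi$ and test function $\psi$, $$\mathcal M^\varepsilon(\eta)=\int_0^{t_{\max}}\Delta T(t,x=0)\psi(t)\,dt,\qquad \Delta T(t,x)=\frac{\langle f^\varepsilon/\tau\rangle(t,x)}{C_\tau},$$ where $f^\varepsilon$ is the solution with reflection coefficient $\eta$ and source $\phi$. Standing assumptions (those on $\tau$, $\nu$ and (A4) hold for both transducer and substrate). (A1) $\tau$ is continuous and $\tau(\omega)\ge\tau_{\min}>0$ for all $\omega$. (A2) $\nu$ is differentiable and $0<\nu_{\min}\le\nu(\omega)\le\nu_{\max}<\infty$. (A3) $\eta\in\Omega:=C^0((0,\infty)\to[0,1])$. (A4) There exist $p\in(1,3/2)$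 and $0<c_p<\infty$ with $\int_0^\infty\frac{C_\omega}{\tau^2(\omega)\nu(\omega)^{1/p}}d\omega\le c_p$. (A5) $\phi\in L^1(dt\,d\mu\,d\omega)\cap L^p(0,t;L^p(C_\omega d\mu\,d\omega))$ with the $p$ of (A4), and there is $c_m>0$ with $0\le\phi\le c_mC_\omega$. Profiles. $\phi_t,\phi_\mu,\phi_\omega$ are fixed smooth functions supported in $[-1,1]$ (usually smooth cutoffs), $\psi_t$ is a fixed function supported on $(-1,1)$, and $\mu_0>0$ is a fixed direction cosine. *)

theory Defs
  imports "HOL-Analysis.Analysis"
begin

text \<open>
  Phase-space functions are curried, with arguments in the order time, position, direction
  cosine, frequency. Functions of the frequency only matter on \<open>{0<..}\<close>.
\<close>

type_synonym phase_fun = "real \<Rightarrow> real \<Rightarrow> real \<Rightarrow> real \<Rightarrow> real"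

definition phonon_avg :: "(real \<Rightarrow> real \<Rightarrow> real) \<Rightarrow> real" where
  "phonon_avg h = (LBINT \<mu>:{-1..1}. (LBINT \<omega>:{0<..}. h \<mu> \<omega>))"

definition F0_star :: "real \<Rightarrow> real \<Rightarrow> real \<Rightarrow> (real \<Rightarrow> real) \<Rightarrow> real \<Rightarrow> real" where
  "F0_star hbar kB T0 D \<omega> = hbar * \<omega> * D \<omega> / (exp (hbar * \<omega> / (kB * T0)) - 1)"

definition C_omega :: "real \<Rightarrow> real \<Rightarrow> real \<Rightarrow> (real \<Rightarrow> real) \<Rightarrow> real \<Rightarrow> real" where
  "C_omega hbar kB T0 D \<omega> =
     (F0_star hbar kB T0 D \<omega>)\<^sup>2 * exp (hbar * \<omega> / (kB * T0)) / (D \<omega> * kB * T0\<^sup>2)"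

text \<open>In the following, \<open>C\<close> stands for the weight \<open>\<omega> \<mapsto> C\<^sub>\<omega>\<close>.\<close>

definition C_tau :: "(real \<Rightarrow> real) \<Rightarrow> (real \<Rightarrow> real) \<Rightarrow> real" where
  "C_tau C \<tau> = phonon_avg (\<lambda>\<mu> \<omega>. C \<omega> / \<tau> \<omega>)"

definition L_op ::
  "(real \<Rightarrow> real) \<Rightarrow> (real \<Rightarrow> real) \<Rightarrow> (real \<Rightarrow> real \<Rightarrow> real) \<Rightarrow> real \<Rightarrow> real \<Rightarrow> real" where
  "L_op C \<tau> h \<mu> \<omega> = C \<omega> / C_tau C \<tau> * phonon_avg (\<lambda>\<mu>' \<omega>'. h \<mu>' \<omega>' / \<tau> \<omega>')"

definition collision ::
  "(real \<Rightarrow> real) \<Rightarrow> real \<Rightarrow> (real \<Rightarrow> real) \<Rightarrow> phase_fun \<Rightarrow> phase_fun" where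
  "collision C \<epsilon> \<tau> h t x \<mu> \<omega> = 1 / (\<epsilon> * \<tau> \<omega>) * (L_op C \<tau> (h t x) \<mu> \<omega> - h t x \<mu> \<omega>)"

text \<open>
  The transport equation
  \<open>\<epsilon> \<partial>\<^sub>t h + \<mu> \<nu> \<partial>\<^sub>x h = (\<epsilon> \<tau>)\<^sup>-\<^sup>1 (L h - h)\<close> for \<open>t \<ge> 0\<close>, \<open>x \<in> [a, b]\<close>.
  The incoming data are discontinuous (the source does not vanish at \<open>t = 0\<close>), so there are in
  general no classical solutions. The left-hand side is the derivative of
  \<open>s \<mapsto> h (t + \<epsilon> s, x + \<mu> \<nu> s)\<close>, and the equation is required in integrated form along every
  such characteristic segment inside the slab. The first conjunct is the integrability that
  makes the collision term meaningful.
\<close>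

definition solves_transport ::
  "(real \<Rightarrow> real) \<Rightarrow> real \<Rightarrow> (real \<Rightarrow> real) \<Rightarrow> (real \<Rightarrow> real) \<Rightarrow> real \<Rightarrow> real \<Rightarrow> phase_fun \<Rightarrow> bool" where
  "solves_transport C \<epsilon> \<nu> \<tau> a b h \<longleftrightarrow>
     (\<forall>T>0. set_integrable lborel ({0..T} \<times> {a..b} \<times> {-1..1} \<times> {0<..})
        (\<lambda>(t, x, \<mu>, \<omega>). h t x \<mu> \<omega> / \<tau> \<omega>)) \<and>
     (\<forall>t\<ge>0. \<forall>x\<in>{a..b}. \<forall>\<mu>\<in>{-1..1}. \<forall>\<omega>>0. \<forall>s\<ge>0. x + \<mu> * \<nu> \<omega> * s \<in> {a..b} \<longrightarrow>
        set_integrable lborel {0..s} (\<lambda>r. collision C \<epsilon> \<tau> h (t + \<epsilon> * r) (x + \<mu> * \<nu> \<omega> * r) \<mu> \<omega>) \<and>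
        h (t + \<epsilon> * s) (x + \<mu> * \<nu> \<omega> * s) \<mu> \<omega> - h t x \<mu> \<omega> =
          (LBINT r:{0..s}. collision C \<epsilon> \<tau> h (t + \<epsilon> * r) (x + \<mu> * \<nu> \<omega> * r) \<mu> \<omega>))"

definition zeta :: "(real \<Rightarrow> real) \<Rightarrow> real \<Rightarrow> real" where
  "zeta \<eta> \<omega> = 1 - \<eta> \<omega>"

definition zeta_s :: "(real \<Rightarrow> real) \<Rightarrow> (real \<Rightarrow> real) \<Rightarrow> (real \<Rightarrow> real) \<Rightarrow> real \<Rightarrow> real" where
  "zeta_s \<nu> \<nu>\<^sub>s \<eta> \<omega> = \<nu> \<omega> / \<nu>\<^sub>s \<omega> * (1 - \<eta> \<omega>)"

definition eta_s :: "(real \<Rightarrow> real) \<Rightarrow> (real \<Rightarrow> real) \<Rightarrow> (real \<Rightarrow> real) \<Rightarrow> real \<Rightarrow> real" where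
  "eta_s \<nu> \<nu>\<^sub>s \<eta> \<omega> = 1 - \<nu> \<omega> / \<nu>\<^sub>s \<omega> * (1 - \<eta> \<omega>)"

definition Omega :: "(real \<Rightarrow> real) set" where
  "Omega = {\<eta>. continuous_on {0<..} \<eta> \<and> (\<forall>\<omega>>0. \<eta> \<omega> \<in> {0..1})}"

definition interface_coeffs_in_unit ::
  "(real \<Rightarrow> real) \<Rightarrow> (real \<Rightarrow> real) \<Rightarrow> (real \<Rightarrow> real) \<Rightarrow> bool" where
  "interface_coeffs_in_unit \<nu> \<nu>\<^sub>s \<eta> \<longleftrightarrow>
     (\<forall>\<omega>>0. \<eta> \<omega> \<in> {0..1} \<and> zeta \<eta> \<omega> \<in> {0..1} \<and>
        zeta_s \<nu> \<nu>\<^sub>s \<eta> \<omega> \<in> {0..1} \<and> eta_s \<nu> \<nu>\<^sub>s \<eta> \<omega> \<in> {0..1})"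

text \<open>
  Boundary and interface conditions are imposed for \<open>t > 0\<close>; at \<open>t = 0\<close> they would contradict the
  zero initial data wherever the source does not vanish initially.
\<close>

definition coupled_solution ::
  "(real \<Rightarrow> real) \<Rightarrow> real \<Rightarrow> real \<Rightarrow> (real \<Rightarrow> real) \<Rightarrow> (real \<Rightarrow> real) \<Rightarrow> (real \<Rightarrow> real) \<Rightarrow> (real \<Rightarrow> real) \<Rightarrow>
   (real \<Rightarrow> real) \<Rightarrow> (real \<Rightarrow> real \<Rightarrow> real \<Rightarrow> real) \<Rightarrow> phase_fun \<Rightarrow> phase_fun \<Rightarrow> bool" where
  "coupled_solution C L\<^sub>s \<epsilon> \<nu> \<tau> \<nu>\<^sub>s \<tau>\<^sub>s \<eta> \<phi> f g \<longleftrightarrow>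
     solves_transport C \<epsilon> \<nu> \<tau> 0 1 f \<and>
     solves_transport C \<epsilon> \<nu>\<^sub>s \<tau>\<^sub>s 1 (1 + L\<^sub>s) g \<and>
     (\<forall>x\<in>{0..1}. \<forall>\<mu>\<in>{-1..1}. \<forall>\<omega>>0. f 0 x \<mu> \<omega> = 0) \<and>
     (\<forall>x\<in>{1..1 + L\<^sub>s}. \<forall>\<mu>\<in>{-1..1}. \<forall>\<omega>>0. g 0 x \<mu> \<omega> = 0) \<and>
     (\<forall>t>0. \<forall>\<mu>\<in>{0<..1}. \<forall>\<omega>>0. f t 0 \<mu> \<omega> = \<phi> t \<mu> \<omega>) \<and>
     (\<forall>t>0. \<forall>\<mu>\<in>{-1..<0}. \<forall>\<omega>>0.
        f t 1 \<mu> \<omega> = \<eta> \<omega> * f t 1 (- \<mu>) \<omega> + zeta \<eta> \<omega> * g t 1 \<mu> \<omega>) \<and>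
     (\<forall>t>0. \<forall>\<mu>\<in>{0<..1}. \<forall>\<omega>>0.
        g t 1 \<mu> \<omega> = eta_s \<nu> \<nu>\<^sub>s \<eta> \<omega> * g t 1 (- \<mu>) \<omega> + zeta_s \<nu> \<nu>\<^sub>s \<eta> \<omega> * f t 1 \<mu> \<omega>) \<and>
     (\<forall>t>0. \<forall>\<mu>\<in>{-1..<0}. \<forall>\<omega>>0. g t (1 + L\<^sub>s) \<mu> \<omega> = 0)"

definition Delta_T :: "(real \<Rightarrow> real) \<Rightarrow> (real \<Rightarrow> real) \<Rightarrow> phase_fun \<Rightarrow> real \<Rightarrow> real \<Rightarrow> real" where
  "Delta_T C \<tau> f t x = phonon_avg (\<lambda>\<mu> \<omega>. f t x \<mu> \<omega> / \<tau> \<omega>) / C_tau C \<tau>"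

definition measurement ::
  "(real \<Rightarrow> real) \<Rightarrow> (real \<Rightarrow> real) \<Rightarrow> real \<Rightarrow> (real \<Rightarrow> real) \<Rightarrow> phase_fun \<Rightarrow> real" where
  "measurement C \<tau> tmax \<psi> f = (LBINT t:{0..tmax}. Delta_T C \<tau> f t 0 * \<psi> t)"

definition cond_A1 :: "(real \<Rightarrow> real) \<Rightarrow> bool" where
  "cond_A1 \<tau> \<longleftrightarrow> continuous_on {0<..} \<tau> \<and> (\<exists>\<tau>min>0. \<forall>\<omega>>0. \<tau>min \<le> \<tau> \<omega>)"

definition cond_A2 :: "(real \<Rightarrow> real) \<Rightarrow> bool" where
  "cond_A2 \<nu> \<longleftrightarrow> \<nu> differentiable_on {0<..} \<and>
     (\<exists>\<nu>min \<nu>max. 0 < \<nu>min \<and> (\<forall>\<omega>>0. \<nu>min \<le> \<nu> \<omega> \<and> \<nu> \<omega> \<le> \<nu>max))"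

definition cond_A4 :: "(real \<Rightarrow> real) \<Rightarrow> real \<Rightarrow> (real \<Rightarrow> real) \<Rightarrow> (real \<Rightarrow> real) \<Rightarrow> bool" where
  "cond_A4 C p \<tau> \<nu> \<longleftrightarrow> (\<exists>c\<^sub>p>0.
     set_integrable lborel {0<..} (\<lambda>\<omega>. C \<omega> / ((\<tau> \<omega>)\<^sup>2 * \<nu> \<omega> powr (1 / p))) \<and>
     (LBINT \<omega>:{0<..}. C \<omega> / ((\<tau> \<omega>)\<^sup>2 * \<nu> \<omega> powr (1 / p))) \<le> c\<^sub>p)"

text \<open>The source is prescribed for incoming directions \<open>\<mu> \<in> (0, 1]\<close> only.\<close>

definition cond_A5 :: "(real \<Rightarrow> real) \<Rightarrow> real \<Rightarrow> (real \<Rightarrow> real \<Rightarrow> real \<Rightarrow> real) \<Rightarrow> bool" where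
  "cond_A5 C p \<phi> \<longleftrightarrow>
     set_integrable lborel ({0..} \<times> {0<..1} \<times> {0<..}) (\<lambda>(t, \<mu>, \<omega>). \<phi> t \<mu> \<omega>) \<and>
     (\<forall>T>0. set_integrable lborel ({0..T} \<times> {0<..1} \<times> {0<..})
        (\<lambda>(t, \<mu>, \<omega>). \<bar>\<phi> t \<mu> \<omega>\<bar> powr p * C \<omega>)) \<and>
     (\<exists>c\<^sub>m>0. \<forall>t\<ge>0. \<forall>\<mu>\<in>{0<..1}. \<forall>\<omega>>0. 0 \<le> \<phi> t \<mu> \<omega> \<and> \<phi> t \<mu> \<omega> \<le> c\<^sub>m * C \<omega>)"

definition smooth_fun :: "(real \<Rightarrow> real) \<Rightarrow> bool" where
  "smooth_fun u \<longleftrightarrow> (\<forall>n. (deriv ^^ n) u differentiable_on UNIV)"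

definition concentrated_source ::
  "(real \<Rightarrow> real) \<Rightarrow> (real \<Rightarrow> real) \<Rightarrow> (real \<Rightarrow> real) \<Rightarrow> real \<Rightarrow> real \<Rightarrow> real \<Rightarrow> real \<Rightarrow> real \<Rightarrow>
   real \<Rightarrow> real \<Rightarrow> real \<Rightarrow> real" where
  "concentrated_source \<phi>\<^sub>t \<phi>\<^sub>\<mu> \<phi>\<^sub>\<omega> \<mu>\<^sub>0 \<omega>\<^sub>0 \<theta>\<^sub>t \<theta>\<^sub>\<mu> \<theta>\<^sub>\<omega> t \<mu> \<omega> =
     1 / (\<theta>\<^sub>\<mu> * \<theta>\<^sub>\<omega> * \<theta>\<^sub>t) * \<phi>\<^sub>t (t / \<theta>\<^sub>t) * \<phi>\<^sub>\<mu> ((\<mu> - \<mu>\<^sub>0) / \<theta>\<^sub>\<mu>) * \<phi>\<^sub>\<omega> ((\<omega> - \<omega>\<^sub>0) / \<theta>\<^sub>\<omega>)"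

definition window_test :: "(real \<Rightarrow> real) \<Rightarrow> real \<Rightarrow> real \<Rightarrow> real \<Rightarrow> real" where
  "window_test \<psi>\<^sub>t t\<^sub>1 \<theta> t = \<psi>\<^sub>t ((t - t\<^sub>1) / \<theta>)"

end

theory Submission
  imports Defs
begin

text \<open>
  The solution is compared with its ballistic part, the source transported along characteristics
  with exponential damping and at most one reflection. The two measurements see the same incoming
  source at \<open>x = 0\<close>; their ballistic parts differ by \<open>\<eta>\<^sub>1 - \<eta>\<^sub>2\<close> at frequencies close to \<open>\<omega>\<^sub>0\<close>, times
  the damping of the way to \<open>x = 1\<close> and back, which tends to
  \<open>exp (- 2 / (\<epsilon> \<mu>\<^sub>0 \<nu>(\<omega>\<^sub>0) \<tau>(\<omega>\<^sub>0)))\<close>. The constant \<open>c\<^sub>0\<close> is half of this rate, so that the damping is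
  already below \<open>exp (- c\<^sub>0 / \<epsilon>)\<close> in a neighbourhood of \<open>(\<mu>\<^sub>0, \<omega>\<^sub>0)\<close> that does not shrink with \<open>\<epsilon>\<close>.
  What remains is to show that everything that has been scattered is invisible as \<open>\<theta> \<rightarrow> 0\<close>. For
  this \<open>\<epsilon>\<close> is fixed and constants may depend on it.

  Along a characteristic a solution differs from its damped initial value by at most a multiple of
  \<open>C\<^sub>\<omega>\<close> times the line integral of the temperature \<open>\<langle>h / \<tau>\<rangle> / C\<^sub>\<tau>\<close> (\<open>transport_segment\<close>). Since
  nothing enters through the far end of the substrate, following a characteristic backwards through
  the interface stops after one further segment (\<open>f_reflected\<close>, \<open>g_transmitted\<close>). Averaging over
  directions and frequencies gives a closed inequality \<open>F \<le> F\<^sub>0 + \<kappa> K F\<close> for the absolute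
  temperature \<open>F\<close> of both layers (\<open>field_le\<close>), where \<open>K\<close> averages three line integrals and
  \<open>F\<^sub>0\<close> comes from the ballistic part. The source has height \<open>\<theta>\<^sup>-\<^sup>3\<close> on a box of side \<open>\<theta>\<close>, hence \<open>F\<^sub>0\<close> is
  \<open>O(1 / \<theta>)\<close> pointwise and \<open>O(1)\<close> in \<open>L\<^sup>1(dx)\<close> at every time.

  Both bounds pass to \<open>F\<close>. For the mass this is Gronwall's inequality (\<open>mass_bound\<close>). For the
  supremum Gronwall's inequality does not apply directly, because \<open>F\<close> is only known to be integrable;
  but the part of \<open>F\<close> above a suitable exponential satisfies the inequality without source, so it has
  mass zero, and \<open>K\<close> of a function of mass zero vanishes everywhere (\<open>sup_bound\<close>).

  Finally, \<open>K\<close> smooths: after a travel time \<open>s\<close> the average over directions spreads a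
  line integral over a length of order \<open>s\<close>, so the contribution at \<open>s\<close> is at most the minimum of
  \<open>O(1 / \<theta>)\<close> and \<open>O(1 / s)\<close>. Splitting at \<open>s = sqrt \<theta>\<close> shows that the scattered temperature at
  \<open>x = 0\<close> is \<open>O(1 / sqrt \<theta>)\<close> (\<open>scatter_le_interpolated\<close>). The test function has \<open>L\<^sup>1\<close> norm of order
  \<open>\<theta>\<close>, so the scattered part contributes \<open>O(sqrt \<theta>)\<close> to the measurement
  (\<open>concentrated_measurement_le\<close>).
\<close>

section \<open>Integrals along backward characteristics\<close>

lemma measurable_curried:
  assumes "case_prod G \<in> borel_measurable (borel \<Otimes>\<^sub>M borel)"
    and [measurable]: "a \<in> borel_measurable M" "b \<in> borel_measurable M"
  shows "(\<lambda>z. G (a z) (b z)) \<in> borel_measurable M"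
  using measurable_compose[OF _ assms(1), of "\<lambda>z. (a z, b z)" M] by simp

text \<open>
  Travel time \<open>s\<close> corresponds to physical time \<open>\<epsilon> s\<close>, so the path that is at \<open>c\<close> at time \<open>t\<close> is
  followed back to time \<open>0\<close>. The velocity \<open>k\<close> is that of the backward motion.
\<close>

definition path_int :: "real \<Rightarrow> (real \<Rightarrow> real \<Rightarrow> ennreal) \<Rightarrow> real \<Rightarrow> real \<Rightarrow> real \<Rightarrow> ennreal" where
  "path_int \<epsilon> G t c k = (\<integral>\<^sup>+s\<in>{0..t / \<epsilon>}. G (t - \<epsilon> * s) (c + k * s) \<partial>lborel)"

lemma measurable_path_int [measurable (raw)]:
  assumes [measurable]: "case_prod G \<in> borel_measurable (borel \<Otimes>\<^sub>M borel)"
    and [measurable]: "t \<in> borel_measurable M" "c \<in> borel_measurable M" "k \<in> borel_measurable M"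
  shows "(\<lambda>z. path_int \<epsilon> G (t z) (c z) (k z)) \<in> borel_measurable M"
proof -
  have [measurable]: "(\<lambda>(z, s). G (t z - \<epsilon> * s) (c z + k z * s)) \<in> borel_measurable (M \<Otimes>\<^sub>M lborel)"
    unfolding case_prod_beta by (rule measurable_curried[OF assms(1)]) simp_all
  have [measurable]: "Measurable.pred (M \<Otimes>\<^sub>M borel) (\<lambda>x. snd x \<in> {0..t (fst x) / \<epsilon>})"
    unfolding atLeastAtMost_iff by measurable
  show ?thesis
    unfolding path_int_def by measurable
qed

lemma path_int_mono:
  assumes "\<epsilon> > 0" "\<And>t' y. 0 \<le> t' \<Longrightarrow> t' \<le> t \<Longrightarrow> G t' y \<le> H t' y"
  shows "path_int \<epsilon> G t c k \<le> path_int \<epsilon> H t c k"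
  unfolding path_int_def
  using assms by (intro nn_integral_mono) (auto simp: indicator_def field_simps)

lemma path_int_add:
  assumes [measurable]: "case_prod G \<in> borel_measurable (borel \<Otimes>\<^sub>M borel)"
    "case_prod H \<in> borel_measurable (borel \<Otimes>\<^sub>M borel)"
  shows "path_int \<epsilon> (\<lambda>t y. G t y + H t y) t c k = path_int \<epsilon> G t c k + path_int \<epsilon> H t c k"
proof -
  have [measurable]: "(\<lambda>s. G (t - \<epsilon> * s) (c + k * s)) \<in> borel_measurable lborel"
    by (rule measurable_curried[OF assms(1)]) simp_all
  have [measurable]: "(\<lambda>s. H (t - \<epsilon> * s) (c + k * s)) \<in> borel_measurable lborel"
    by (rule measurable_curried[OF assms(2)]) simp_all
  show ?thesis
    unfolding path_int_def distrib_right
    by (subst nn_integral_add) auto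
qed

text \<open>
  A path that is joined to another one at travel time \<open>s\<^sub>1\<close> is the tail of a single straight path,
  extrapolated to time \<open>t\<close>. This turns the segments behind the interface into full paths.
\<close>

lemma path_int_shift:
  assumes [measurable]: "case_prod G \<in> borel_measurable (borel \<Otimes>\<^sub>M borel)"
    and "\<epsilon> > 0" "0 \<le> s\<^sub>1"
  shows "path_int \<epsilon> G (t - \<epsilon> * s\<^sub>1) y k \<le> path_int \<epsilon> G t (y - k * s\<^sub>1) k"
proof -
  have [measurable]: "(\<lambda>s. G (t - \<epsilon> * s) (y - k * s\<^sub>1 + k * s)) \<in> borel_measurable borel"
    by (rule measurable_curried[OF assms(1)]) simp_all
  have "path_int \<epsilon> G t (y - k * s\<^sub>1) k =
      (\<integral>\<^sup>+s. G (t - \<epsilon> * (s\<^sub>1 + s)) (y - k * s\<^sub>1 + k * (s\<^sub>1 + s)) * indicator {0..t / \<epsilon>} (s\<^sub>1 + s) \<partial>lborel)"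
    unfolding path_int_def
    by (subst nn_integral_real_affine[where c = 1 and t = s\<^sub>1]) auto
  also have "\<dots> \<ge> path_int \<epsilon> G (t - \<epsilon> * s\<^sub>1) y k"
    unfolding path_int_def
    using assms(2,3) by (intro nn_integral_mono) (auto simp: indicator_def algebra_simps divide_simps)
  finally show ?thesis .
qed

lemma nn_integral_affine:
  fixes g :: "real \<Rightarrow> ennreal"
  assumes [measurable]: "g \<in> borel_measurable borel" and "a \<noteq> 0"
  shows "(\<integral>\<^sup>+x. g (b + a * x) \<partial>lborel) = ennreal (1 / \<bar>a\<bar>) * (\<integral>\<^sup>+y. g y \<partial>lborel)"
proof -
  have "(\<integral>\<^sup>+y. g y \<partial>lborel) = ennreal \<bar>a\<bar> * (\<integral>\<^sup>+x. g (b + a * x) \<partial>lborel)"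
    using assms by (intro nn_integral_real_affine) auto
  then have "ennreal (1 / \<bar>a\<bar>) * (\<integral>\<^sup>+y. g y \<partial>lborel) =
      (ennreal (1 / \<bar>a\<bar>) * ennreal \<bar>a\<bar>) * (\<integral>\<^sup>+x. g (b + a * x) \<partial>lborel)"
    by (simp add: mult.assoc)
  also have "ennreal (1 / \<bar>a\<bar>) * ennreal \<bar>a\<bar> = 1"
    using assms(2) by (subst ennreal_mult[symmetric]) auto
  finally show ?thesis by simp
qed

text \<open>
  If the end point of the path depends on \<open>x\<close> affinely, integration over \<open>x\<close> sees at each travel time
  the whole mass of the time slice, up to the Jacobian.
\<close>

lemma nn_integral_path_int_dx:
  assumes [measurable]: "case_prod G \<in> borel_measurable (borel \<Otimes>\<^sub>M borel)" and "\<sigma> \<noteq> 0"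
  shows "(\<integral>\<^sup>+x. path_int \<epsilon> G t (p + \<sigma> * x) k \<partial>lborel) =
    ennreal (1 / \<bar>\<sigma>\<bar>) * (\<integral>\<^sup>+s\<in>{0..t / \<epsilon>}. (\<integral>\<^sup>+y. G (t - \<epsilon> * s) y \<partial>lborel) \<partial>lborel)"
proof -
  have [measurable]: "(\<lambda>(x, s). G (t - \<epsilon> * s) (p + \<sigma> * x + k * s)) \<in> borel_measurable (lborel \<Otimes>\<^sub>M lborel)"
    unfolding case_prod_beta by (rule measurable_curried[OF assms(1)]) simp_all
  have [measurable]: "\<And>t. G t \<in> borel_measurable borel"
    by (rule measurable_curried[OF assms(1)]) simp_all
  have [measurable]: "(\<lambda>(s, y). G (t - \<epsilon> * s) y) \<in> borel_measurable (lborel \<Otimes>\<^sub>M lborel)"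
    unfolding case_prod_beta by (rule measurable_curried[OF assms(1)]) simp_all
  have "(\<integral>\<^sup>+x. path_int \<epsilon> G t (p + \<sigma> * x) k \<partial>lborel) =
    (\<integral>\<^sup>+s. (\<integral>\<^sup>+x. G (t - \<epsilon> * s) (p + \<sigma> * x + k * s) * indicator {0..t / \<epsilon>} s \<partial>lborel) \<partial>lborel)"
    unfolding path_int_def by (intro lborel_pair.Fubini') measurable
  also have "\<dots> = (\<integral>\<^sup>+s. (\<integral>\<^sup>+x. G (t - \<epsilon> * s) ((p + k * s) + \<sigma> * x) \<partial>lborel) * indicator {0..t / \<epsilon>} s \<partial>lborel)"
    by (intro nn_integral_cong, subst nn_integral_multc) (auto simp: algebra_simps)
  also have "\<dots> = (\<integral>\<^sup>+s. ennreal (1 / \<bar>\<sigma>\<bar>) * ((\<integral>\<^sup>+y. G (t - \<epsilon> * s) y \<partial>lborel) * indicator {0..t / \<epsilon>} s) \<partial>lborel)"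
    using assms(2) by (subst nn_integral_affine) (auto simp: mult.assoc)
  also have "\<dots> = ennreal (1 / \<bar>\<sigma>\<bar>) * (\<integral>\<^sup>+s\<in>{0..t / \<epsilon>}. (\<integral>\<^sup>+y. G (t - \<epsilon> * s) y \<partial>lborel) \<partial>lborel)"
    by (subst nn_integral_cmult) measurable
  finally show ?thesis .
qed

text \<open>
  Exchanging the integrals over directions and travel time reduces the angular average of a line
  integral to the angular average at a single travel time. The time \<open>s = 0\<close>, where the average over
  directions does not move the point at all, is a null set.
\<close>

lemma nn_integral_path_int_angle:
  assumes [measurable]: "case_prod G \<in> borel_measurable (borel \<Otimes>\<^sub>M borel)"
    and bd: "\<And>s. 0 < s \<Longrightarrow> s \<le> t / \<epsilon> \<Longrightarrow> (\<integral>\<^sup>+\<mu>\<in>{-1..1}. G (t - \<epsilon> * s) (c + \<mu> * k * s) \<partial>lborel) \<le> b s"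
  shows "(\<integral>\<^sup>+\<mu>\<in>{-1..1}. path_int \<epsilon> G t c (\<mu> * k) \<partial>lborel) \<le> (\<integral>\<^sup>+s\<in>{0..t / \<epsilon>}. b s \<partial>lborel)"
proof -
  have [measurable]: "(\<lambda>(\<mu>, s). G (t - \<epsilon> * s) (c + \<mu> * k * s)) \<in> borel_measurable (lborel \<Otimes>\<^sub>M lborel)"
    unfolding case_prod_beta by (rule measurable_curried[OF assms(1)]) simp_all
  have "(\<integral>\<^sup>+\<mu>\<in>{-1..1}. path_int \<epsilon> G t c (\<mu> * k) \<partial>lborel) =
    (\<integral>\<^sup>+\<mu>. (\<integral>\<^sup>+s. G (t - \<epsilon> * s) (c + \<mu> * k * s) * indicator {0..t / \<epsilon>} s * indicator {-1..1} \<mu> \<partial>lborel) \<partial>lborel)"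
    unfolding path_int_def by (subst nn_integral_multc) auto
  also have "\<dots> = (\<integral>\<^sup>+s. (\<integral>\<^sup>+\<mu>. G (t - \<epsilon> * s) (c + \<mu> * k * s) * indicator {0..t / \<epsilon>} s * indicator {-1..1} \<mu> \<partial>lborel) \<partial>lborel)"
    by (intro lborel_pair.Fubini') measurable
  also have "\<dots> = (\<integral>\<^sup>+s. (\<integral>\<^sup>+\<mu>\<in>{-1..1}. G (t - \<epsilon> * s) (c + \<mu> * k * s) \<partial>lborel) * indicator {0..t / \<epsilon>} s \<partial>lborel)"
    by (intro nn_integral_cong, subst nn_integral_multc[symmetric]) (auto simp: ac_simps)
  also have "\<dots> \<le> (\<integral>\<^sup>+s\<in>{0..t / \<epsilon>}. b s \<partial>lborel)"
  proof (intro nn_integral_mono_AE)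
    have "AE s in lborel. s \<noteq> (0::real)"
      by (rule AE_lborel_singleton)
    then show "AE s in lborel. (\<integral>\<^sup>+\<mu>\<in>{-1..1}. G (t - \<epsilon> * s) (c + \<mu> * k * s) \<partial>lborel) * indicator {0..t / \<epsilon>} s
        \<le> b s * indicator {0..t / \<epsilon>} s"
      by eventually_elim (use bd in \<open>auto simp: indicator_def\<close>)
  qed
  finally show ?thesis .
qed

lemma nn_integral_angle_le:
  fixes g :: "real \<Rightarrow> ennreal"
  assumes [measurable]: "g \<in> borel_measurable borel" and "a \<noteq> 0"
  shows "(\<integral>\<^sup>+\<mu>\<in>{-1..1}. g (c + \<mu> * a) \<partial>lborel) \<le> ennreal (1 / \<bar>a\<bar>) * (\<integral>\<^sup>+y. g y \<partial>lborel)"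
proof -
  have "(\<integral>\<^sup>+\<mu>\<in>{-1..1}. g (c + \<mu> * a) \<partial>lborel) \<le> (\<integral>\<^sup>+\<mu>. g (c + a * \<mu>) \<partial>lborel)"
    by (intro nn_integral_mono) (auto simp: indicator_def mult.commute)
  then show ?thesis
    using nn_integral_affine[of g a c] assms by simp
qed

section \<open>Gronwall's inequality in travel time\<close>

lemma nn_integral_exp_backward_le:
  assumes "\<epsilon> > 0" "\<gamma> > 0" "t \<ge> 0"
  shows "(\<integral>\<^sup>+s\<in>{0..t / \<epsilon>}. ennreal (exp (\<gamma> * (t - \<epsilon> * s))) \<partial>lborel) \<le> ennreal (exp (\<gamma> * t) / (\<gamma> * \<epsilon>))"
proof -
  have "(\<integral>\<^sup>+s. ennreal (exp (\<gamma> * (t - \<epsilon> * s))) * indicator {0..t / \<epsilon>} s \<partial>lborel) =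
      ennreal (- exp (\<gamma> * (t - \<epsilon> * (t / \<epsilon>))) / (\<gamma> * \<epsilon>) - (- exp (\<gamma> * (t - \<epsilon> * 0)) / (\<gamma> * \<epsilon>)))"
    using assms
    by (intro nn_integral_FTC_Icc) (auto intro!: derivative_eq_intros simp: field_simps)
  also have "\<dots> \<le> ennreal (exp (\<gamma> * t) / (\<gamma> * \<epsilon>))"
    using assms by (intro ennreal_leI) auto
  finally show ?thesis .
qed

text \<open>
  The inequality itself gives boundedness of \<open>N\<close> from its integrability. With the weight
  \<open>exp (- 2 c t / \<epsilon>)\<close> the integral operator has norm at most \<open>1 / 2\<close>, and a finite supremum can be
  absorbed.
\<close>

lemma gronwall_backward:
  fixes N :: "real \<Rightarrow> ennreal"
  assumes [measurable]: "N \<in> borel_measurable borel"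
    and "\<epsilon> > 0" "c > 0" "B \<ge> 0"
    and fin: "(\<integral>\<^sup>+t\<in>{0..T}. N t \<partial>lborel) < \<infinity>"
    and ineq: "\<And>t. 0 \<le> t \<Longrightarrow> t \<le> T \<Longrightarrow>
      N t \<le> ennreal B + ennreal c * (\<integral>\<^sup>+s\<in>{0..t / \<epsilon>}. N (t - \<epsilon> * s) \<partial>lborel)"
    and t: "0 \<le> t" "t \<le> T"
  shows "N t \<le> ennreal (2 * B * exp (2 * c / \<epsilon> * t))"
proof -
  define \<gamma> where "\<gamma> = 2 * c / \<epsilon>"
  have \<gamma>: "\<gamma> > 0" using assms by (auto simp: \<gamma>_def)
  define W where "W = ennreal B + ennreal c * (ennreal (1 / \<epsilon>) * (\<integral>\<^sup>+t\<in>{0..T}. N t \<partial>lborel))"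
  have W: "W < \<infinity>" using fin by (auto simp: W_def ennreal_mult_less_top)
  have NW: "N t \<le> W" if t: "0 \<le> t" "t \<le> T" for t
  proof -
    have "(\<integral>\<^sup>+s\<in>{0..t / \<epsilon>}. N (t - \<epsilon> * s) \<partial>lborel) \<le> (\<integral>\<^sup>+s. N (t + (-\<epsilon>) * s) * indicator {0..T} (t + (-\<epsilon>) * s) \<partial>lborel)"
    proof (intro nn_integral_mono)
      fix s :: real
      have "t \<le> T + \<epsilon> * s" if "s \<ge> 0" using that \<open>\<epsilon> > 0\<close> t by (intro add_increasing2) auto
      then show "N (t - \<epsilon> * s) * indicator {0..t / \<epsilon>} s \<le> N (t + (-\<epsilon>) * s) * indicator {0..T} (t + (-\<epsilon>) * s)"
        using \<open>\<epsilon> > 0\<close> t by (auto simp: indicator_def field_simps)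
    qed
    also have "\<dots> = ennreal (1 / \<epsilon>) * (\<integral>\<^sup>+t\<in>{0..T}. N t \<partial>lborel)"
      using \<open>\<epsilon> > 0\<close> by (subst nn_integral_affine[where g = "\<lambda>t. N t * indicator {0..T} t"]) auto
    finally show ?thesis
      using ineq[OF t] unfolding W_def by (meson add_left_mono mult_left_mono order_trans zero_le)
  qed
  define S where "S = (SUP t\<in>{0..T}. N t * ennreal (exp (- \<gamma> * t)))"
  have "S \<le> W"
    unfolding S_def
  proof (rule SUP_least)
    fix t assume t: "t \<in> {0..T}"
    then have "N t * ennreal (exp (- \<gamma> * t)) \<le> W * 1"
      using NW[of t] \<gamma> by (intro mult_mono) auto
    then show "N t * ennreal (exp (- \<gamma> * t)) \<le> W" by simp
  qed
  then have "S < \<infinity>" using W by (rule le_less_trans)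
  have NS: "N t \<le> S * ennreal (exp (\<gamma> * t))" if "0 \<le> t" "t \<le> T" for t
  proof -
    have "N t * ennreal (exp (- \<gamma> * t)) \<le> S"
      unfolding S_def using that by (intro SUP_upper) auto
    then have "N t * ennreal (exp (- \<gamma> * t)) * ennreal (exp (\<gamma> * t)) \<le> S * ennreal (exp (\<gamma> * t))"
      by (intro mult_right_mono) auto
    then show ?thesis
      by (simp add: mult.assoc ennreal_mult[symmetric] exp_add[symmetric])
  qed
  have "S \<le> ennreal B + S * ennreal (1 / 2)"
    unfolding S_def
  proof (rule SUP_least, fold S_def)
    fix t assume t: "t \<in> {0..T}"
    have "(\<integral>\<^sup>+s\<in>{0..t / \<epsilon>}. N (t - \<epsilon> * s) \<partial>lborel) \<le> (\<integral>\<^sup>+s. S * (ennreal (exp (\<gamma> * (t - \<epsilon> * s))) * indicator {0..t / \<epsilon>} s) \<partial>lborel)"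
      using t \<open>\<epsilon> > 0\<close>
    proof (intro nn_integral_mono)
      fix s :: real
      have "t \<le> T + \<epsilon> * s" if "s \<ge> 0" using that \<open>\<epsilon> > 0\<close> t by (intro add_increasing2) auto
      then show "N (t - \<epsilon> * s) * indicator {0..t / \<epsilon>} s \<le> S * (ennreal (exp (\<gamma> * (t - \<epsilon> * s))) * indicator {0..t / \<epsilon>} s)"
        using NS[of "t - \<epsilon> * s"] t \<open>\<epsilon> > 0\<close> by (auto simp: indicator_def field_simps)
    qed
    also have "\<dots> = S * (\<integral>\<^sup>+s. ennreal (exp (\<gamma> * (t - \<epsilon> * s))) * indicator {0..t / \<epsilon>} s \<partial>lborel)"
      by (subst nn_integral_cmult) auto
    also have "\<dots> \<le> S * ennreal (exp (\<gamma> * t) / (\<gamma> * \<epsilon>))"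
      using nn_integral_exp_backward_le[of \<epsilon> \<gamma> t] \<gamma> \<open>\<epsilon> > 0\<close> t by (intro mult_left_mono) auto
    finally have "N t \<le> ennreal B + ennreal c * (S * ennreal (exp (\<gamma> * t) / (\<gamma> * \<epsilon>)))"
      using ineq[of t] t by (meson add_left_mono mult_left_mono order_trans zero_le atLeastAtMost_iff)
    also have "ennreal c * (S * ennreal (exp (\<gamma> * t) / (\<gamma> * \<epsilon>))) = S * ennreal (exp (\<gamma> * t) / 2)"
      using \<open>c > 0\<close> \<open>\<epsilon> > 0\<close> \<gamma>
      by (subst mult.left_commute, subst ennreal_mult[symmetric]) (auto simp: \<gamma>_def field_simps)
    finally have "N t * ennreal (exp (- \<gamma> * t)) \<le> (ennreal B + S * ennreal (exp (\<gamma> * t) / 2)) * ennreal (exp (- \<gamma> * t))"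
      by (intro mult_right_mono) auto
    also have "\<dots> = ennreal B * ennreal (exp (- \<gamma> * t)) + S * ennreal (1 / 2)"
      by (simp add: distrib_right mult.assoc ennreal_mult[symmetric] exp_add[symmetric] exp_minus field_simps)
    also have "\<dots> \<le> ennreal B * 1 + S * ennreal (1 / 2)"
      using \<gamma> t by (intro add_right_mono mult_left_mono) auto
    finally show "N t * ennreal (exp (- \<gamma> * t)) \<le> ennreal B + S * ennreal (1 / 2)" by simp
  qed
  then have "S \<le> ennreal (2 * B)"
  proof (cases S)
    case (real r)
    assume "S \<le> ennreal B + S * ennreal (1 / 2)"
    also have "ennreal B + S * ennreal (1 / 2) = ennreal (B + r * (1 / 2))"
      unfolding real using real(1) \<open>B \<ge> 0\<close> by (subst ennreal_mult'[symmetric]) (auto simp: ennreal_plus)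
    finally have "r \<le> B + r * (1 / 2)"
      unfolding real using real(1) \<open>B \<ge> 0\<close> by (subst (asm) ennreal_le_iff) auto
    then show ?thesis
      unfolding real by (intro ennreal_leI) auto
  qed (use \<open>S < \<infinity>\<close> in auto)
  then have "S * ennreal (exp (\<gamma> * t)) \<le> ennreal (2 * B) * ennreal (exp (\<gamma> * t))"
    by (intro mult_right_mono) auto
  with NS[OF t] show ?thesis
    using \<open>B \<ge> 0\<close> by (simp add: \<gamma>_def ennreal_mult[symmetric])
qed

section \<open>Scattering as an average of line integrals\<close>

text \<open>
  The three backward paths that can reach a point of a layer with velocity \<open>v\<close>: the direct one, the
  one reflected at the interface \<open>x = 1\<close> (seen as coming straight from the mirror image \<open>2 - x\<close>), and
  the one transmitted from the other layer, with velocity \<open>v'\<close>. The last one is extrapolated from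
  \<open>x = 1\<close> to the present time, whence the factor \<open>v' / v\<close>. Each formula is used for both signs of \<open>\<mu>\<close>,
  which only enlarges the sum.
\<close>

definition ray_sum ::
  "real \<Rightarrow> (real \<Rightarrow> real) \<Rightarrow> (real \<Rightarrow> real) \<Rightarrow> (real \<Rightarrow> real \<Rightarrow> ennreal) \<Rightarrow> real \<Rightarrow> real \<Rightarrow> real \<Rightarrow> real \<Rightarrow> ennreal"
  where
  "ray_sum \<epsilon> v v' G t x \<mu> \<omega> =
     path_int \<epsilon> G t x (\<mu> * (- v \<omega>)) + path_int \<epsilon> G t (2 - x) (\<mu> * v \<omega>) +
     path_int \<epsilon> G t (1 - v' \<omega> / v \<omega> * (1 - x)) (\<mu> * (- v' \<omega>))"

definition phase_avg :: "(real \<Rightarrow> ennreal) \<Rightarrow> (real \<Rightarrow> real \<Rightarrow> ennreal) \<Rightarrow> ennreal" where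
  "phase_avg w q = (\<integral>\<^sup>+\<mu>\<in>{-1..1}. (\<integral>\<^sup>+\<omega>. w \<omega> * q \<mu> \<omega> \<partial>lborel) \<partial>lborel)"

lemma phase_avg_mono:
  assumes "\<And>\<mu> \<omega>. -1 \<le> \<mu> \<Longrightarrow> \<mu> \<le> 1 \<Longrightarrow> w \<omega> * q \<mu> \<omega> \<le> w' \<omega> * q' \<mu> \<omega>"
  shows "phase_avg w q \<le> phase_avg w' q'"
  unfolding phase_avg_def
  using assms by (intro nn_integral_mono) (auto simp: indicator_def intro!: nn_integral_mono)

lemma phase_avg_add:
  assumes [measurable]: "w \<in> borel_measurable borel"
    "case_prod q \<in> borel_measurable (borel \<Otimes>\<^sub>M borel)" "case_prod q' \<in> borel_measurable (borel \<Otimes>\<^sub>M borel)"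
  shows "phase_avg w (\<lambda>\<mu> \<omega>. q \<mu> \<omega> + q' \<mu> \<omega>) = phase_avg w q + phase_avg w q'"
  unfolding phase_avg_def
  by (simp add: distrib_left distrib_right nn_integral_add)

lemma phase_avg_cmult:
  assumes [measurable]: "w \<in> borel_measurable borel" "case_prod q \<in> borel_measurable (borel \<Otimes>\<^sub>M borel)"
  shows "phase_avg w (\<lambda>\<mu> \<omega>. c * q \<mu> \<omega>) = c * phase_avg w q"
  unfolding phase_avg_def
  by (simp add: mult.left_commute[of _ c] nn_integral_cmult mult.assoc)

lemma phase_avg_const:
  assumes [measurable]: "w \<in> borel_measurable borel"
  shows "phase_avg w (\<lambda>_ _. c) = 2 * (\<integral>\<^sup>+\<omega>. w \<omega> \<partial>lborel) * c"
  unfolding phase_avg_def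
  by (simp add: nn_integral_multc nn_integral_cmult mult_ac)

lemma phase_avg_swap:
  assumes [measurable]: "w \<in> borel_measurable borel" "case_prod q \<in> borel_measurable (borel \<Otimes>\<^sub>M borel)"
  shows "phase_avg w q = (\<integral>\<^sup>+\<omega>. w \<omega> * (\<integral>\<^sup>+\<mu>\<in>{-1..1}. q \<mu> \<omega> \<partial>lborel) \<partial>lborel)"
proof -
  have "phase_avg w q = (\<integral>\<^sup>+\<mu>. (\<integral>\<^sup>+\<omega>. w \<omega> * q \<mu> \<omega> * indicator {-1..1} \<mu> \<partial>lborel) \<partial>lborel)"
    unfolding phase_avg_def by (simp add: nn_integral_multc)
  also have "\<dots> = (\<integral>\<^sup>+\<omega>. (\<integral>\<^sup>+\<mu>. w \<omega> * q \<mu> \<omega> * indicator {-1..1} \<mu> \<partial>lborel) \<partial>lborel)"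
    by (intro lborel_pair.Fubini') measurable
  also have "\<dots> = (\<integral>\<^sup>+\<omega>. w \<omega> * (\<integral>\<^sup>+\<mu>\<in>{-1..1}. q \<mu> \<omega> \<partial>lborel) \<partial>lborel)"
    by (simp add: nn_integral_cmult mult.assoc)
  finally show ?thesis .
qed

lemma nn_integral_phase_avg:
  assumes [measurable]: "w \<in> borel_measurable borel"
    "(\<lambda>(x, \<mu>, \<omega>). q x \<mu> \<omega>) \<in> borel_measurable (borel \<Otimes>\<^sub>M borel \<Otimes>\<^sub>M borel)"
  shows "(\<integral>\<^sup>+x. phase_avg w (q x) \<partial>lborel) = phase_avg w (\<lambda>\<mu> \<omega>. \<integral>\<^sup>+x. q x \<mu> \<omega> \<partial>lborel)"
proof -
  have [measurable (raw)]: "(\<lambda>z. q (a z) (b z) (c z)) \<in> borel_measurable N"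
    if [measurable]: "a \<in> borel_measurable N" "b \<in> borel_measurable N" "c \<in> borel_measurable N"
    for N :: "'n measure" and a b c
    using measurable_compose[of "\<lambda>z. (a z, b z, c z)" N _ _ borel, OF _ assms(2)] by simp
  have [measurable]: "(\<lambda>x::real \<times> real. indicator {-1..1::real} (fst x) :: ennreal) \<in> borel_measurable (lborel \<Otimes>\<^sub>M lborel)"
    by measurable
  have "(\<integral>\<^sup>+x. phase_avg w (q x) \<partial>lborel)
      = (\<integral>\<^sup>+\<mu>. (\<integral>\<^sup>+x. (\<integral>\<^sup>+\<omega>. w \<omega> * q x \<mu> \<omega> \<partial>lborel) * indicator {-1..1} \<mu> \<partial>lborel) \<partial>lborel)"
    unfolding phase_avg_def by (intro lborel_pair.Fubini') measurable
  also have "\<dots> = (\<integral>\<^sup>+\<mu>\<in>{-1..1}. (\<integral>\<^sup>+x. (\<integral>\<^sup>+\<omega>. w \<omega> * q x \<mu> \<omega> \<partial>lborel) \<partial>lborel) \<partial>lborel)"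
    by (simp add: nn_integral_multc)
  also have "\<dots> = (\<integral>\<^sup>+\<mu>\<in>{-1..1}. (\<integral>\<^sup>+\<omega>. (\<integral>\<^sup>+x. w \<omega> * q x \<mu> \<omega> \<partial>lborel) \<partial>lborel) \<partial>lborel)"
    by (intro nn_integral_cong arg_cong2[where f = "(*)"] lborel_pair.Fubini' refl) measurable
  also have "\<dots> = phase_avg w (\<lambda>\<mu> \<omega>. \<integral>\<^sup>+x. q x \<mu> \<omega> \<partial>lborel)"
    unfolding phase_avg_def by (simp add: nn_integral_cmult)
  finally show ?thesis .
qed

text \<open>
  The weight \<open>w\<close> stands for \<open>C\<^sub>\<omega> / (\<tau> C\<^sub>\<tau>)\<close>. The velocities are constrained only where it is
  nonzero, since they have no meaning for \<open>\<omega> \<le> 0\<close>. The total weight is \<open>1\<close> by the choice of \<open>C\<^sub>\<tau>\<close>; the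
  factor \<open>2\<close> is the length of the range of \<open>\<mu>\<close>.
\<close>

locale ray_kernel =
  fixes \<epsilon> v\<^sub>0 v\<^sub>1 :: real and v v' :: "real \<Rightarrow> real" and w :: "real \<Rightarrow> ennreal"
  assumes eps: "\<epsilon> > 0" and v0: "v\<^sub>0 > 0"
    and v_meas [measurable]: "v \<in> borel_measurable borel" "v' \<in> borel_measurable borel"
    and w_meas [measurable]: "w \<in> borel_measurable borel"
    and v_bounds: "\<And>\<omega>. w \<omega> \<noteq> 0 \<Longrightarrow> v\<^sub>0 \<le> v \<omega> \<and> v \<omega> \<le> v\<^sub>1 \<and> v\<^sub>0 \<le> v' \<omega> \<and> v' \<omega> \<le> v\<^sub>1"
    and w_mass: "2 * (\<integral>\<^sup>+\<omega>. w \<omega> \<partial>lborel) \<le> 1"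
begin

definition scatter :: "(real \<Rightarrow> real \<Rightarrow> ennreal) \<Rightarrow> real \<Rightarrow> real \<Rightarrow> ennreal" where
  "scatter G t x = phase_avg w (ray_sum \<epsilon> v v' G t x)"

lemma measurable_ray_sum [measurable (raw)]:
  assumes [measurable]: "case_prod G \<in> borel_measurable (borel \<Otimes>\<^sub>M borel)"
    and [measurable]: "t \<in> borel_measurable M" "x \<in> borel_measurable M" "\<mu> \<in> borel_measurable M" "\<omega> \<in> borel_measurable M"
  shows "(\<lambda>z. ray_sum \<epsilon> v v' G (t z) (x z) (\<mu> z) (\<omega> z)) \<in> borel_measurable M"
  unfolding ray_sum_def by measurable

lemma measurable_scatter [measurable (raw)]:
  assumes [measurable]: "case_prod G \<in> borel_measurable (borel \<Otimes>\<^sub>M borel)"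
    and [measurable]: "t \<in> borel_measurable M" "x \<in> borel_measurable M"
  shows "(\<lambda>z. scatter G (t z) (x z)) \<in> borel_measurable M"
  unfolding scatter_def phase_avg_def by measurable

lemma scatter_mono:
  assumes "\<And>t' y. 0 \<le> t' \<Longrightarrow> t' \<le> t \<Longrightarrow> G t' y \<le> H t' y"
  shows "scatter G t x \<le> scatter H t x"
  unfolding scatter_def ray_sum_def
  by (intro phase_avg_mono mult_left_mono add_mono path_int_mono eps assms) auto

lemma scatter_add:
  assumes [measurable]: "case_prod G \<in> borel_measurable (borel \<Otimes>\<^sub>M borel)"
    "case_prod H \<in> borel_measurable (borel \<Otimes>\<^sub>M borel)"
  shows "scatter (\<lambda>t y. G t y + H t y) t x = scatter G t x + scatter H t x"
proof -
  have "ray_sum \<epsilon> v v' (\<lambda>t y. G t y + H t y) t x =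
      (\<lambda>\<mu> \<omega>. ray_sum \<epsilon> v v' G t x \<mu> \<omega> + ray_sum \<epsilon> v v' H t x \<mu> \<omega>)"
    by (intro ext) (simp add: ray_sum_def path_int_add add_ac)
  then show ?thesis
    unfolding scatter_def by (simp add: phase_avg_add)
qed

text \<open>
  A function of time alone has the same integral along each of the three paths.
\<close>

lemma scatter_uniform_le:
  "scatter (\<lambda>t _. m t) t x \<le> 3 * (\<integral>\<^sup>+s\<in>{0..t / \<epsilon>}. m (t - \<epsilon> * s) \<partial>lborel)"
proof -
  let ?I = "\<integral>\<^sup>+s\<in>{0..t / \<epsilon>}. m (t - \<epsilon> * s) \<partial>lborel"
  have "ray_sum \<epsilon> v v' (\<lambda>t _. m t) t x = (\<lambda>_ _. 3 * ?I)"
  proof -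
    have "?I + ?I + ?I = (1 + 1 + 1) * ?I" by (simp only: distrib_right mult_1)
    then have "?I + ?I + ?I = 3 * ?I" by simp
    then show ?thesis by (intro ext) (simp add: ray_sum_def path_int_def)
  qed
  then have "scatter (\<lambda>t _. m t) t x = (2 * (\<integral>\<^sup>+\<omega>. w \<omega> \<partial>lborel)) * (3 * ?I)"
    unfolding scatter_def by (simp add: phase_avg_const)
  also have "\<dots> \<le> 1 * (3 * ?I)"
    by (intro mult_right_mono w_mass) auto
  finally show ?thesis by simp
qed

text \<open>
  The mass after scattering is controlled by the masses of the earlier time slices: the direct and the
  reflected path have unit Jacobian in \<open>x\<close>, the transmitted one has Jacobian \<open>v' / v\<close>.
\<close>

lemma nn_integral_scatter_le:
  assumes [measurable]: "case_prod G \<in> borel_measurable (borel \<Otimes>\<^sub>M borel)"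
  shows "(\<integral>\<^sup>+x. scatter G t x \<partial>lborel) \<le>
    ennreal (2 + v\<^sub>1 / v\<^sub>0) * (\<integral>\<^sup>+s\<in>{0..t / \<epsilon>}. (\<integral>\<^sup>+y. G (t - \<epsilon> * s) y \<partial>lborel) \<partial>lborel)"
proof -
  let ?I = "\<integral>\<^sup>+s\<in>{0..t / \<epsilon>}. (\<integral>\<^sup>+y. G (t - \<epsilon> * s) y \<partial>lborel) \<partial>lborel"
  have ray: "(\<integral>\<^sup>+x. ray_sum \<epsilon> v v' G t x \<mu> \<omega> \<partial>lborel) \<le> ennreal (2 + v\<^sub>1 / v\<^sub>0) * ?I" if "w \<omega> \<noteq> 0" for \<mu> \<omega>
  proof -
    note b = v_bounds[OF that]
    define r where "r = v' \<omega> / v \<omega>"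
    have r: "r > 0" "1 / r \<le> v\<^sub>1 / v\<^sub>0"
      using b v0 by (auto simp: r_def intro!: frac_le)
    have *: "(\<integral>\<^sup>+x. path_int \<epsilon> G t (p + \<sigma> * x) k \<partial>lborel) = ennreal (1 / \<bar>\<sigma>\<bar>) * ?I" if "\<sigma> \<noteq> 0" for p \<sigma> k
      using that by (rule nn_integral_path_int_dx[OF assms])
    have "(\<integral>\<^sup>+x. ray_sum \<epsilon> v v' G t x \<mu> \<omega> \<partial>lborel) =
      (\<integral>\<^sup>+x. path_int \<epsilon> G t (0 + 1 * x) (\<mu> * (- v \<omega>)) \<partial>lborel) +
      (\<integral>\<^sup>+x. path_int \<epsilon> G t (2 + (-1) * x) (\<mu> * v \<omega>) \<partial>lborel) +
      (\<integral>\<^sup>+x. path_int \<epsilon> G t (1 - r + r * x) (\<mu> * (- v' \<omega>)) \<partial>lborel)"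
    proof -
      have "ray_sum \<epsilon> v v' G t x \<mu> \<omega> = path_int \<epsilon> G t (0 + 1 * x) (\<mu> * (- v \<omega>)) +
        path_int \<epsilon> G t (2 + (-1) * x) (\<mu> * v \<omega>) + path_int \<epsilon> G t (1 - r + r * x) (\<mu> * (- v' \<omega>))" for x
      proof -
        have "1 - v' \<omega> / v \<omega> * (1 - x) = 1 - r + r * x" by (simp add: r_def right_diff_distrib)
        then show ?thesis unfolding ray_sum_def by (simp only: mult_1 mult_minus_left add_0 diff_conv_add_uminus)
      qed
      then show ?thesis by (simp add: nn_integral_add del: mult_minus_right)
    qed
    also have "\<dots> = ?I + ?I + ennreal (1 / r) * ?I"
    proof -
      have "ennreal (1 / \<bar>1\<bar>) * ?I = ?I" "ennreal (1 / \<bar>-1\<bar>) * ?I = ?I" by simp_all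
      then show ?thesis
        using *[of 1 0] *[of "-1" 2] *[of r "1 - r"] r by simp
    qed
    also have "\<dots> = ennreal (2 + 1 / r) * ?I"
      using r by (simp add: distrib_right mult_2)
    also have "\<dots> \<le> ennreal (2 + v\<^sub>1 / v\<^sub>0) * ?I"
      using r by (intro mult_right_mono ennreal_leI) auto
    finally show ?thesis .
  qed
  have "(\<integral>\<^sup>+x. scatter G t x \<partial>lborel) = phase_avg w (\<lambda>\<mu> \<omega>. \<integral>\<^sup>+x. ray_sum \<epsilon> v v' G t x \<mu> \<omega> \<partial>lborel)"
    unfolding scatter_def by (intro nn_integral_phase_avg) measurable
  also have "\<dots> \<le> phase_avg w (\<lambda>_ _. ennreal (2 + v\<^sub>1 / v\<^sub>0) * ?I)"
  proof (intro phase_avg_mono)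
    fix \<mu> \<omega> show "w \<omega> * (\<integral>\<^sup>+x. ray_sum \<epsilon> v v' G t x \<mu> \<omega> \<partial>lborel) \<le> w \<omega> * (ennreal (2 + v\<^sub>1 / v\<^sub>0) * ?I)"
      using ray[of \<omega> \<mu>] by (cases "w \<omega> = 0") (auto intro: mult_left_mono)
  qed
  also have "\<dots> = 2 * (\<integral>\<^sup>+\<omega>. w \<omega> \<partial>lborel) * (ennreal (2 + v\<^sub>1 / v\<^sub>0) * ?I)"
    by (simp add: phase_avg_const)
  also have "\<dots> \<le> 1 * (ennreal (2 + v\<^sub>1 / v\<^sub>0) * ?I)"
    by (intro mult_right_mono w_mass) auto
  finally show ?thesis by simp
qed

text \<open>
  All three paths move with velocity \<open>\<plusminus> \<mu> v\<close> or \<open>\<plusminus> \<mu> v'\<close>, so a bound for the average over \<open>\<mu>\<close> at one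
  travel time, uniform in the base point and in speeds at least \<open>v\<^sub>0\<close>, bounds the whole operator.
\<close>

lemma scatter_le_angular:
  assumes [measurable]: "case_prod G \<in> borel_measurable (borel \<Otimes>\<^sub>M borel)"
    and bd: "\<And>s c k. 0 < s \<Longrightarrow> s \<le> t / \<epsilon> \<Longrightarrow> v\<^sub>0 \<le> \<bar>k\<bar> \<Longrightarrow>
      (\<integral>\<^sup>+\<mu>\<in>{-1..1}. G (t - \<epsilon> * s) (c + \<mu> * k * s) \<partial>lborel) \<le> b s"
  shows "scatter G t x \<le> 3 * (\<integral>\<^sup>+s\<in>{0..t / \<epsilon>}. b s \<partial>lborel)"
proof -
  let ?I = "\<integral>\<^sup>+s\<in>{0..t / \<epsilon>}. b s \<partial>lborel"
  have III: "?I + ?I + ?I = 3 * ?I"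
  proof -
    have "?I + ?I + ?I = (1 + 1 + 1) * ?I" by (simp only: distrib_right mult_1)
    then show ?thesis by simp
  qed
  have ray: "(\<integral>\<^sup>+\<mu>\<in>{-1..1}. ray_sum \<epsilon> v v' G t x \<mu> \<omega> \<partial>lborel) \<le> 3 * ?I" if "w \<omega> \<noteq> 0" for \<omega>
  proof -
    note b = v_bounds[OF that]
    have *: "(\<integral>\<^sup>+\<mu>\<in>{-1..1}. path_int \<epsilon> G t c (\<mu> * k) \<partial>lborel) \<le> ?I" if "v\<^sub>0 \<le> \<bar>k\<bar>" for c k
      using that by (intro nn_integral_path_int_angle assms)
    have "(\<integral>\<^sup>+\<mu>\<in>{-1..1}. ray_sum \<epsilon> v v' G t x \<mu> \<omega> \<partial>lborel) =
      (\<integral>\<^sup>+\<mu>\<in>{-1..1}. path_int \<epsilon> G t x (\<mu> * (- v \<omega>)) \<partial>lborel) +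
      (\<integral>\<^sup>+\<mu>\<in>{-1..1}. path_int \<epsilon> G t (2 - x) (\<mu> * v \<omega>) \<partial>lborel) +
      (\<integral>\<^sup>+\<mu>\<in>{-1..1}. path_int \<epsilon> G t (1 - v' \<omega> / v \<omega> * (1 - x)) (\<mu> * (- v' \<omega>)) \<partial>lborel)"
      unfolding ray_sum_def distrib_right by (simp add: nn_integral_add)
    also have "\<dots> \<le> ?I + ?I + ?I"
      using b v0 by (intro add_mono *) auto
    finally show ?thesis by (simp add: III)
  qed
  have "scatter G t x = (\<integral>\<^sup>+\<omega>. w \<omega> * (\<integral>\<^sup>+\<mu>\<in>{-1..1}. ray_sum \<epsilon> v v' G t x \<mu> \<omega> \<partial>lborel) \<partial>lborel)"
    unfolding scatter_def by (intro phase_avg_swap) measurable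
  also have "\<dots> \<le> (\<integral>\<^sup>+\<omega>. w \<omega> * (3 * ?I) \<partial>lborel)"
  proof (intro nn_integral_mono)
    fix \<omega> show "w \<omega> * (\<integral>\<^sup>+\<mu>\<in>{-1..1}. ray_sum \<epsilon> v v' G t x \<mu> \<omega> \<partial>lborel) \<le> w \<omega> * (3 * ?I)"
      using ray[of \<omega>] by (cases "w \<omega> = 0") (auto intro: mult_left_mono)
  qed
  also have "\<dots> = (\<integral>\<^sup>+\<omega>. w \<omega> \<partial>lborel) * (3 * ?I)"
    by (simp add: nn_integral_multc)
  also have "\<dots> \<le> 1 * (3 * ?I)"
  proof (intro mult_right_mono)
    have "1 * (\<integral>\<^sup>+\<omega>. w \<omega> \<partial>lborel) \<le> 2 * (\<integral>\<^sup>+\<omega>. w \<omega> \<partial>lborel)"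
      by (intro mult_right_mono) auto
    with w_mass show "(\<integral>\<^sup>+\<omega>. w \<omega> \<partial>lborel) \<le> 1" by simp
  qed auto
  finally show ?thesis by simp
qed

text \<open>
  At travel time \<open>s\<close> the substitution \<open>y = c + \<mu> k s\<close> turns the average over \<open>\<mu>\<close> into an integral over
  positions with density at most \<open>1 / (v\<^sub>0 s)\<close>. The kernel is not integrable at \<open>s = 0\<close>, so this is
  of use only for functions of mass zero.
\<close>

lemma scatter_le_mass:
  assumes [measurable]: "case_prod G \<in> borel_measurable (borel \<Otimes>\<^sub>M borel)"
  shows "scatter G t x \<le> 3 * (\<integral>\<^sup>+s\<in>{0..t / \<epsilon>}. ennreal (1 / (v\<^sub>0 * s)) * (\<integral>\<^sup>+y. G (t - \<epsilon> * s) y \<partial>lborel) \<partial>lborel)"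
proof (rule scatter_le_angular)
  fix s c k :: real assume s: "0 < s" "s \<le> t / \<epsilon>" and k: "v\<^sub>0 \<le> \<bar>k\<bar>"
  have [measurable]: "G (t - \<epsilon> * s) \<in> borel_measurable borel"
    by (rule measurable_curried[OF assms(1)]) simp_all
  have "(\<integral>\<^sup>+\<mu>\<in>{-1..1}. G (t - \<epsilon> * s) (c + \<mu> * (k * s)) \<partial>lborel) \<le> ennreal (1 / \<bar>k * s\<bar>) * (\<integral>\<^sup>+y. G (t - \<epsilon> * s) y \<partial>lborel)"
    using s k v0 by (intro nn_integral_angle_le) auto
  also have "\<dots> \<le> ennreal (1 / (v\<^sub>0 * s)) * (\<integral>\<^sup>+y. G (t - \<epsilon> * s) y \<partial>lborel)"
    using s k v0 by (intro mult_right_mono ennreal_leI divide_left_mono) (auto simp: abs_mult)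
  finally show "(\<integral>\<^sup>+\<mu>\<in>{-1..1}. G (t - \<epsilon> * s) (c + \<mu> * k * s) \<partial>lborel) \<le> ennreal (1 / (v\<^sub>0 * s)) * (\<integral>\<^sup>+y. G (t - \<epsilon> * s) y \<partial>lborel)"
    by (simp add: mult.assoc)
qed fact

text \<open>
  The supremum is used for travel times below \<open>\<delta>\<close>, the mass above \<open>\<delta>\<close>. This interpolation is the
  smoothing effect on which the theorem rests: with \<open>M\<close> of order \<open>1 / \<theta>\<close> and \<open>\<delta> = sqrt \<theta>\<close> the result
  is much smaller than \<open>M\<close>.
\<close>

lemma scatter_le_interpolated:
  assumes [measurable]: "case_prod G \<in> borel_measurable (borel \<Otimes>\<^sub>M borel)"
    and "t \<ge> 0" "\<delta> > 0" "M \<ge> 0" "N \<ge> 0"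
    and sup: "\<And>t' y. 0 \<le> t' \<Longrightarrow> t' \<le> t \<Longrightarrow> G t' y \<le> ennreal M"
    and mass: "\<And>t'. 0 \<le> t' \<Longrightarrow> t' \<le> t \<Longrightarrow> (\<integral>\<^sup>+y. G t' y \<partial>lborel) \<le> ennreal N"
  shows "scatter G t x \<le> ennreal (3 * (2 * M * \<delta> + N * t / (\<epsilon> * v\<^sub>0 * \<delta>)))"
proof -
  define b where "b s = ennreal (2 * M) * indicator {0..\<delta>} s + ennreal (N / (v\<^sub>0 * \<delta>)) * indicator {0..t / \<epsilon>} s" for s :: real
  have "scatter G t x \<le> 3 * (\<integral>\<^sup>+s\<in>{0..t / \<epsilon>}. b s \<partial>lborel)"
  proof (rule scatter_le_angular)
    fix s c k :: real assume s: "0 < s" "s \<le> t / \<epsilon>" and k: "v\<^sub>0 \<le> \<bar>k\<bar>"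
    have [measurable]: "G (t - \<epsilon> * s) \<in> borel_measurable borel"
      by (rule measurable_curried[OF assms(1)]) simp_all
    have t': "0 \<le> t - \<epsilon> * s" "t - \<epsilon> * s \<le> t"
      using s eps by (auto simp: field_simps)
    show "(\<integral>\<^sup>+\<mu>\<in>{-1..1}. G (t - \<epsilon> * s) (c + \<mu> * k * s) \<partial>lborel) \<le> b s"
    proof (cases "s \<le> \<delta>")
      case True
      have "(\<integral>\<^sup>+\<mu>\<in>{-1..1}. G (t - \<epsilon> * s) (c + \<mu> * k * s) \<partial>lborel) \<le> (\<integral>\<^sup>+\<mu>\<in>{-1..1::real}. ennreal M \<partial>lborel)"
        using sup[OF t'] by (intro nn_integral_mono mult_right_mono) auto
      also have "\<dots> = ennreal (2 * M)"
        using \<open>M \<ge> 0\<close> by (subst nn_integral_cmult_indicator) (auto simp: ennreal_mult mult.commute)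
      finally show ?thesis
        using True s by (auto simp: b_def indicator_def intro: order_trans)
    next
      case False
      have "(\<integral>\<^sup>+\<mu>\<in>{-1..1}. G (t - \<epsilon> * s) (c + \<mu> * (k * s)) \<partial>lborel) \<le> ennreal (1 / \<bar>k * s\<bar>) * (\<integral>\<^sup>+y. G (t - \<epsilon> * s) y \<partial>lborel)"
        using s k v0 by (intro nn_integral_angle_le) auto
      also have "\<dots> \<le> ennreal (1 / (v\<^sub>0 * \<delta>)) * ennreal N"
        using s k v0 False \<open>\<delta> > 0\<close>
        by (intro mult_mono ennreal_leI divide_left_mono mass t') (auto simp: abs_mult intro!: mult_mono)
      also have "\<dots> = ennreal (N / (v\<^sub>0 * \<delta>))"
        using v0 \<open>\<delta> > 0\<close> \<open>N \<ge> 0\<close> by (subst ennreal_mult[symmetric]) auto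
      finally show ?thesis
        using False s \<open>\<delta> > 0\<close> by (auto simp: b_def indicator_def mult.assoc)
    qed
  qed fact
  also have "\<dots> \<le> 3 * (\<integral>\<^sup>+s. b s \<partial>lborel)"
    by (intro mult_left_mono nn_integral_mono) (auto simp: indicator_def)
  also have "(\<integral>\<^sup>+s. b s \<partial>lborel) = ennreal (2 * M) * ennreal \<delta> + ennreal (N / (v\<^sub>0 * \<delta>)) * ennreal (t / \<epsilon>)"
    unfolding b_def using assms eps by (subst nn_integral_add) (auto simp: nn_integral_cmult)
  also have "3 * \<dots> = ennreal (3 * (2 * M * \<delta> + N * t / (\<epsilon> * v\<^sub>0 * \<delta>)))"
  proof -
    have "ennreal (2 * M) * ennreal \<delta> + ennreal (N / (v\<^sub>0 * \<delta>)) * ennreal (t / \<epsilon>) =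
        ennreal (2 * M * \<delta> + N * t / (\<epsilon> * v\<^sub>0 * \<delta>))"
      using assms eps v0 by (simp add: ennreal_mult[symmetric] ennreal_plus[symmetric] mult_ac del: ennreal_plus)
    moreover have "3 * ennreal a = ennreal (3 * a)" for a
      using ennreal_mult'[of 3 a] by simp
    ultimately show ?thesis by simp
  qed
  finally show ?thesis .
qed

end

section \<open>The scattering inequality: mass and supremum\<close>

locale ray_kernel_pair =
  upper: ray_kernel \<epsilon> v\<^sub>0 v\<^sub>1 v v' w + lower: ray_kernel \<epsilon> v\<^sub>0 v\<^sub>1 v' v w'
  for \<epsilon> v\<^sub>0 v\<^sub>1 v v' w w' +
  fixes \<kappa> :: real
  assumes kappa: "\<kappa> > 0" and v_le: "v\<^sub>0 \<le> v\<^sub>1"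
begin

definition scatter_both :: "(real \<Rightarrow> real \<Rightarrow> ennreal) \<Rightarrow> real \<Rightarrow> real \<Rightarrow> ennreal" where
  "scatter_both G t x = upper.scatter G t x + lower.scatter G t x"

lemma mass_bound:
  assumes F [measurable]: "case_prod F \<in> borel_measurable (borel \<Otimes>\<^sub>M borel)"
    and F0 [measurable]: "\<And>t. F\<^sub>0 t \<in> borel_measurable borel"
    and fin: "(\<integral>\<^sup>+t\<in>{0..T}. (\<integral>\<^sup>+x. F t x \<partial>lborel) \<partial>lborel) < \<infinity>"
    and ineq: "\<And>t x. 0 \<le> t \<Longrightarrow> t \<le> T \<Longrightarrow> F t x \<le> F\<^sub>0 t x + ennreal \<kappa> * scatter_both F t x"
    and mass: "\<And>t. 0 \<le> t \<Longrightarrow> t \<le> T \<Longrightarrow> (\<integral>\<^sup>+x. F\<^sub>0 t x \<partial>lborel) \<le> ennreal n"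
    and "n \<ge> 0" "0 \<le> t" "t \<le> T"
  shows "(\<integral>\<^sup>+x. F t x \<partial>lborel) \<le> ennreal (2 * n * exp (4 * \<kappa> * (2 + v\<^sub>1 / v\<^sub>0) / \<epsilon> * t))"
proof -
  define c where "c = \<kappa> * (2 * (2 + v\<^sub>1 / v\<^sub>0))"
  have r: "v\<^sub>1 / v\<^sub>0 > 0" using v_le upper.v0 by simp
  then have c: "c > 0" using kappa by (auto simp: c_def intro!: mult_pos_pos add_pos_pos)
  have [measurable]: "\<And>t. F t \<in> borel_measurable borel"
    using measurable_compose[of "\<lambda>y. (_, y)" borel "borel \<Otimes>\<^sub>M borel" "case_prod F" borel] by simp
  have "(\<integral>\<^sup>+x. F t x \<partial>lborel) \<le> ennreal (2 * n * exp (2 * c / \<epsilon> * t))"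
  proof (rule gronwall_backward)
    show "(\<lambda>t. \<integral>\<^sup>+x. F t x \<partial>lborel) \<in> borel_measurable borel" by measurable
    show "\<epsilon> > 0" by (rule upper.eps)
    fix t assume t: "0 \<le> t" "t \<le> T"
    let ?I = "\<integral>\<^sup>+s\<in>{0..t / \<epsilon>}. (\<integral>\<^sup>+y. F (t - \<epsilon> * s) y \<partial>lborel) \<partial>lborel"
    have "(\<integral>\<^sup>+x. F t x \<partial>lborel) \<le> (\<integral>\<^sup>+x. F\<^sub>0 t x + ennreal \<kappa> * scatter_both F t x \<partial>lborel)"
      using ineq[OF t] by (intro nn_integral_mono)
    also have "\<dots> = (\<integral>\<^sup>+x. F\<^sub>0 t x \<partial>lborel) + ennreal \<kappa> *
        ((\<integral>\<^sup>+x. upper.scatter F t x \<partial>lborel) + (\<integral>\<^sup>+x. lower.scatter F t x \<partial>lborel))"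
      unfolding scatter_both_def by (simp add: nn_integral_add nn_integral_cmult)
    also have "\<dots> \<le> ennreal n + ennreal \<kappa> * (ennreal (2 + v\<^sub>1 / v\<^sub>0) * ?I + ennreal (2 + v\<^sub>1 / v\<^sub>0) * ?I)"
      by (intro add_mono mult_left_mono mass t upper.nn_integral_scatter_le lower.nn_integral_scatter_le F) auto
    also have "\<dots> = ennreal n + ennreal c * ?I"
    proof -
      have "ennreal \<kappa> * (ennreal (2 + v\<^sub>1 / v\<^sub>0) * ?I + ennreal (2 + v\<^sub>1 / v\<^sub>0) * ?I) =
        (ennreal \<kappa> * (2 * ennreal (2 + v\<^sub>1 / v\<^sub>0))) * ?I"
        by (simp only: mult_2 distrib_left distrib_right mult.assoc)
      also have "ennreal \<kappa> * (2 * ennreal (2 + v\<^sub>1 / v\<^sub>0)) = ennreal c"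
      proof -
        have "2 * ennreal a = ennreal (2 * a)" for a
          using ennreal_mult'[of 2 a] by simp
        then show ?thesis
          unfolding c_def using r kappa by (simp only: ennreal_mult')
      qed
      finally show ?thesis by simp
    qed
    finally show "(\<integral>\<^sup>+x. F t x \<partial>lborel) \<le> ennreal n + ennreal c * ?I" .
  qed (use assms c in auto)
  then show ?thesis by (simp add: c_def mult_ac)
qed

text \<open>
  The bound \<open>m t = 2 b exp (\<gamma> t)\<close> is a supersolution of the inequality: \<open>\<gamma>\<close> is chosen such that the
  scattering of \<open>m\<close> is at most \<open>m / 2\<close>, and the source is at most \<open>m / 2\<close>, too. Hence the excess
  \<open>E\<close> of \<open>F\<close> over \<open>m\<close> satisfies the inequality without a source. By \<open>mass_bound\<close> it has mass zero in
  every time slice, then its scattering vanishes at every point and not only almost everywhere, and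
  so does \<open>E\<close>.
\<close>

lemma sup_bound:
  assumes F [measurable]: "case_prod F \<in> borel_measurable (borel \<Otimes>\<^sub>M borel)"
    and fin: "(\<integral>\<^sup>+t\<in>{0..T}. (\<integral>\<^sup>+x. F t x \<partial>lborel) \<partial>lborel) < \<infinity>"
    and ineq: "\<And>t x. 0 \<le> t \<Longrightarrow> t \<le> T \<Longrightarrow> F t x \<le> ennreal b + ennreal \<kappa> * scatter_both F t x"
    and "b \<ge> 0" "0 \<le> t" "t \<le> T"
  shows "F t x \<le> ennreal (2 * b * exp (12 * \<kappa> / \<epsilon> * t))"
proof -
  define \<gamma> where "\<gamma> = 12 * \<kappa> / \<epsilon>"
  have \<gamma>: "\<gamma> > 0" using kappa upper.eps by (simp add: \<gamma>_def)
  define m where "m t = ennreal (2 * b * exp (\<gamma> * t))" for t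
  \<comment> \<open>Subtraction on extended nonnegative reals is truncated at \<open>0\<close>, so this is the positive part.\<close>
  define E where "E t x = F t x - m t" for t x
  have [measurable]: "m \<in> borel_measurable borel" unfolding m_def by measurable
  have [measurable]: "case_prod E \<in> borel_measurable (borel \<Otimes>\<^sub>M borel)"
    unfolding E_def by measurable
  have [measurable]: "case_prod (\<lambda>t (y::real). m t) \<in> borel_measurable (borel \<Otimes>\<^sub>M borel)"
    by measurable
  have FmE: "F t x \<le> m t + E t x" for t x
    unfolding E_def using ennreal_minus_le_iff[of "F t x" "m t" "F t x - m t"] by simp
  have E_ineq: "E t x \<le> 0 + ennreal \<kappa> * scatter_both E t x" if t: "0 \<le> t" "t \<le> T" for t x
  proof -
    let ?M = "\<integral>\<^sup>+s\<in>{0..t / \<epsilon>}. m (t - \<epsilon> * s) \<partial>lborel"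
    have M: "?M \<le> ennreal (2 * b * (exp (\<gamma> * t) / (\<gamma> * \<epsilon>)))"
    proof -
      have "?M = (\<integral>\<^sup>+s. ennreal (2 * b) * (ennreal (exp (\<gamma> * (t - \<epsilon> * s))) * indicator {0..t / \<epsilon>} s) \<partial>lborel)"
        unfolding m_def using \<open>b \<ge> 0\<close> by (subst ennreal_mult) (auto simp: mult.assoc)
      also have "\<dots> = ennreal (2 * b) * (\<integral>\<^sup>+s\<in>{0..t / \<epsilon>}. ennreal (exp (\<gamma> * (t - \<epsilon> * s))) \<partial>lborel)"
        by (rule nn_integral_cmult) measurable
      also have "\<dots> \<le> ennreal (2 * b) * ennreal (exp (\<gamma> * t) / (\<gamma> * \<epsilon>))"
        using upper.eps \<gamma> t by (intro mult_left_mono nn_integral_exp_backward_le) auto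
      also have "\<dots> = ennreal (2 * b * (exp (\<gamma> * t) / (\<gamma> * \<epsilon>)))"
        using \<open>b \<ge> 0\<close> \<gamma> upper.eps by (subst ennreal_mult) auto
      finally show ?thesis .
    qed
    have "scatter_both F t x \<le> scatter_both (\<lambda>t y. m t + E t y) t x"
      unfolding scatter_both_def by (intro add_mono upper.scatter_mono lower.scatter_mono FmE)
    also have "\<dots> = (upper.scatter (\<lambda>t y. m t) t x + lower.scatter (\<lambda>t y. m t) t x) + scatter_both E t x"
      unfolding scatter_both_def by (simp add: upper.scatter_add lower.scatter_add add_ac)
    also have "\<dots> \<le> (3 * ?M + 3 * ?M) + scatter_both E t x"
      by (intro add_mono upper.scatter_uniform_le lower.scatter_uniform_le) auto
    also have "\<dots> \<le> (3 * ennreal (2 * b * (exp (\<gamma> * t) / (\<gamma> * \<epsilon>))) + 3 * ennreal (2 * b * (exp (\<gamma> * t) / (\<gamma> * \<epsilon>)))) + scatter_both E t x"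
      by (intro add_mono mult_left_mono M) auto
    also have "3 * ennreal (2 * b * (exp (\<gamma> * t) / (\<gamma> * \<epsilon>))) + 3 * ennreal (2 * b * (exp (\<gamma> * t) / (\<gamma> * \<epsilon>))) =
       ennreal (12 * b * (exp (\<gamma> * t) / (\<gamma> * \<epsilon>)))"
    proof -
      have "3 * ennreal a + 3 * ennreal a = ennreal (6 * a)" if "a \<ge> 0" for a
      proof -
        have *: "3 * ennreal a = ennreal (3 * a)"
          using ennreal_mult'[of 3 a] by simp
        show ?thesis
          unfolding * using that by (subst ennreal_plus[symmetric]) auto
      qed
      then show ?thesis using \<open>b \<ge> 0\<close> \<gamma> upper.eps by simp
    qed
    finally have "ennreal \<kappa> * scatter_both F t x \<le>
        ennreal \<kappa> * (ennreal (12 * b * (exp (\<gamma> * t) / (\<gamma> * \<epsilon>))) + scatter_both E t x)"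
      by (intro mult_left_mono) auto
    also have "\<dots> = ennreal (b * exp (\<gamma> * t)) + ennreal \<kappa> * scatter_both E t x"
    proof -
      have "ennreal \<kappa> * ennreal (12 * b * (exp (\<gamma> * t) / (\<gamma> * \<epsilon>))) = ennreal (b * exp (\<gamma> * t))"
        using \<open>b \<ge> 0\<close> kappa upper.eps by (subst ennreal_mult[symmetric]) (auto simp: \<gamma>_def)
      then show ?thesis by (simp add: distrib_left)
    qed
    finally have "F t x \<le> ennreal b + (ennreal (b * exp (\<gamma> * t)) + ennreal \<kappa> * scatter_both E t x)"
      using ineq[OF t, of x] by (meson add_left_mono order_trans)
    also have "\<dots> = ennreal (b + b * exp (\<gamma> * t)) + ennreal \<kappa> * scatter_both E t x"
      using \<open>b \<ge> 0\<close> by (simp add: ennreal_plus add.assoc)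
    also have "\<dots> \<le> m t + ennreal \<kappa> * scatter_both E t x"
    proof -
      have "b * 1 \<le> b * exp (\<gamma> * t)"
        using \<open>b \<ge> 0\<close> \<gamma> t by (intro mult_left_mono) auto
      then show ?thesis
        unfolding m_def by (intro add_mono ennreal_leI) auto
    qed
    finally show ?thesis
      unfolding E_def by (simp add: ennreal_minus_le_iff m_def)
  qed
  have "(\<integral>\<^sup>+t\<in>{0..T}. (\<integral>\<^sup>+x. E t x \<partial>lborel) \<partial>lborel) \<le> (\<integral>\<^sup>+t\<in>{0..T}. (\<integral>\<^sup>+x. F t x \<partial>lborel) \<partial>lborel)"
    unfolding E_def by (intro nn_integral_mono mult_right_mono) (auto simp: diff_le_self_ennreal)
  with fin have E_fin: "(\<integral>\<^sup>+t\<in>{0..T}. (\<integral>\<^sup>+x. E t x \<partial>lborel) \<partial>lborel) < \<infinity>" by order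
  have E_null: "(\<integral>\<^sup>+x. E t x \<partial>lborel) = 0" if t: "0 \<le> t" "t \<le> T" for t
    using mass_bound[where F = E and F\<^sub>0 = "\<lambda>_ _. 0" and T = T and n = 0 and t = t] E_fin E_ineq t by simp
  have scatter_null: "3 * (\<integral>\<^sup>+s\<in>{0..t / \<epsilon>}. ennreal (1 / (v\<^sub>0 * s)) * (\<integral>\<^sup>+y. E (t - \<epsilon> * s) y \<partial>lborel) \<partial>lborel) = 0"
  proof -
    have "ennreal (1 / (v\<^sub>0 * s)) * (\<integral>\<^sup>+y. E (t - \<epsilon> * s) y \<partial>lborel) * indicator {0..t / \<epsilon>} s = 0" for s
    proof (cases "s \<in> {0..t / \<epsilon>}")
      case True
      then have "0 \<le> t - \<epsilon> * s" "\<epsilon> * s \<ge> 0"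
        using upper.eps by (auto simp: field_simps)
      then show ?thesis using E_null[of "t - \<epsilon> * s"] assms by simp
    qed auto
    then have "(\<integral>\<^sup>+s\<in>{0..t / \<epsilon>}. ennreal (1 / (v\<^sub>0 * s)) * (\<integral>\<^sup>+y. E (t - \<epsilon> * s) y \<partial>lborel) \<partial>lborel) =
        (\<integral>\<^sup>+s. 0 \<partial>(lborel :: real measure))"
      by (intro nn_integral_cong)
    then show ?thesis by simp
  qed
  have "upper.scatter E t x = 0" "lower.scatter E t x = 0"
    using upper.scatter_le_mass[of E t x] lower.scatter_le_mass[of E t x] scatter_null by simp_all
  then have "E t x = 0"
    using E_ineq[of t x] assms by (simp add: scatter_both_def)
  then have "F t x \<le> m t"
    using FmE[of t x] by simp
  then show ?thesis by (simp add: m_def \<gamma>_def)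
qed

end

section \<open>Transport along one characteristic\<close>

text \<open>
  This is Duhamel's formula for \<open>h' = \<kappa> (a - h)\<close>, in an integrated form where \<open>a\<close> is merely
  integrable. Subtracting the primitive of \<open>\<kappa> a\<close> leaves a continuously differentiable function, to
  which the mean value theorem applies. The constant \<open>2\<close> instead of \<open>1\<close> is the price for that.
\<close>

lemma relaxation_bound:
  fixes h a :: "real \<Rightarrow> real"
  assumes "\<kappa> > 0" "s \<ge> 0"
    and eq: "\<And>r. 0 \<le> r \<Longrightarrow> r \<le> s \<Longrightarrow>
      set_integrable lborel {0..r} (\<lambda>r. \<kappa> * (a r - h r)) \<and>
      h r - h 0 = (LBINT r:{0..r}. \<kappa> * (a r - h r))"
  shows "ennreal \<bar>h s - exp (- \<kappa> * s) * h 0\<bar> \<le> ennreal (2 * \<kappa>) * (\<integral>\<^sup>+r\<in>{0..s}. ennreal \<bar>a r\<bar> \<partial>lborel)"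
proof -
  have int: "set_integrable lborel {0..s} (\<lambda>r. \<kappa> * (a r - h r))"
    using eq[of s] assms(2) by simp
  have h_eq: "h r = h 0 + integral {0..r} (\<lambda>r. \<kappa> * (a r - h r))" if "0 \<le> r" "r \<le> s" for r
    using eq[OF that] set_borel_integral_eq_integral(2)[of "{0..r}" "\<lambda>r. \<kappa> * (a r - h r)"] by linarith
  define \<Phi> where "\<Phi> = (\<lambda>r. \<kappa> * (a r - h r))"
  have "\<Phi> integrable_on {0..s}"
    unfolding \<Phi>_def using int by (rule set_borel_integral_eq_integral(1))
  then have "continuous_on {0..s} (\<lambda>r. integral {0..r} \<Phi>)"
    by (rule indefinite_integral_continuous_1)
  then have "continuous_on {0..s} (\<lambda>r. h 0 + integral {0..r} \<Phi>)"
    by (rule continuous_on_add[OF continuous_on_const])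
  then have h_cont: "continuous_on {0..s} h"
  proof (rule continuous_on_eq)
    fix r assume "r \<in> {0..s}"
    then show "h 0 + integral {0..r} \<Phi> = h r"
      unfolding \<Phi>_def by (intro h_eq[symmetric]) auto
  qed
  have h_int: "set_integrable lborel {0..s} h"
    by (rule borel_integrable_atLeastAtMost') fact
  have "set_integrable lborel {0..s} (\<lambda>r. (1 / \<kappa>) * (\<kappa> * (a r - h r)) + h r)"
    by (intro set_integral_add set_integrable_mult_right int h_int)
  then have a_int: "set_integrable lborel {0..s} a"
    using assms(1) by simp
  have a_int': "set_integrable lborel {0..r} a" and h_int': "set_integrable lborel {0..r} h" if "0 \<le> r" "r \<le> s" for r
    using that by (auto intro: set_integrable_subset[OF a_int] set_integrable_subset[OF h_int])
  define A where "A = (LBINT r:{0..s}. \<kappa> * \<bar>a r\<bar>)"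
  define G where "G r = (LBINT r:{0..r}. \<kappa> * a r)" for r
  \<comment> \<open>\<open>u\<close> has the derivative \<open>- \<kappa> h\<close>, which is continuous, whereas \<open>h\<close> need not be differentiable.\<close>
  define u where "u r = h r - G r" for r
  have absa_int: "set_integrable lborel {0..s} (\<lambda>r. \<kappa> * \<bar>a r\<bar>)"
    using a_int by (intro set_integrable_mult_right set_integrable_abs)
  have G_le: "\<bar>G r\<bar> \<le> A" if "0 \<le> r" "r \<le> s" for r
  proof -
    have "\<bar>G r\<bar> \<le> (LBINT r:{0..r}. \<bar>\<kappa> * a r\<bar>)"
      unfolding G_def set_lebesgue_integral_def
      by (rule order_trans[OF integral_abs_bound]) (simp add: abs_mult)
    also have "\<dots> = (LBINT r:{0..r}. \<kappa> * \<bar>a r\<bar>)"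
      using assms(1) by (simp add: abs_mult)
    also have "\<dots> \<le> A"
      unfolding A_def set_lebesgue_integral_def
    proof (rule integral_mono)
      show "integrable lborel (\<lambda>r. indicat_real {0..s} r *\<^sub>R (\<kappa> * \<bar>a r\<bar>))"
        using absa_int by (simp add: set_integrable_def)
      have "set_integrable lborel {0..r} (\<lambda>r. \<kappa> * \<bar>a r\<bar>)"
        using that by (intro set_integrable_subset[OF absa_int]) auto
      then show "integrable lborel (\<lambda>x. indicat_real {0..r} x *\<^sub>R (\<kappa> * \<bar>a x\<bar>))"
        by (simp add: set_integrable_def)
    qed (use that assms(1) in \<open>auto simp: indicator_def\<close>)
    finally show ?thesis .
  qed
  have u_eq: "u r = h 0 - \<kappa> * integral {0..r} h" if "0 \<le> r" "r \<le> s" for r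
  proof -
    have "(LBINT r:{0..r}. \<kappa> * (a r - h r)) = (LBINT r:{0..r}. \<kappa> * a r) - (LBINT r:{0..r}. \<kappa> * h r)"
      unfolding right_diff_distrib
      using that by (intro set_integral_diff set_integrable_mult_right a_int' h_int')
    moreover have "(LBINT r:{0..r}. \<kappa> * h r) = \<kappa> * integral {0..r} h"
      using h_int'[OF that] by (simp add: set_borel_integral_eq_integral(2))
    ultimately show ?thesis
      using conjunct2[OF eq[OF that]] unfolding u_def G_def by linarith
  qed
  have u_deriv: "(u has_real_derivative - \<kappa> * h r) (at r within {0..s})" if "r \<in> {0..s}" for r
  proof -
    have "((\<lambda>r. h 0 - \<kappa> * integral {0..r} h) has_real_derivative 0 - \<kappa> * h r) (at r within {0..s})"
      by (intro DERIV_diff DERIV_const DERIV_cmult integral_has_real_derivative h_cont that)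
    then show ?thesis
      using that u_eq by (auto intro: has_field_derivative_transform_within[of _ _ _ _ 1])
  qed
  have exp_deriv: "((\<lambda>r. exp (\<kappa> * r)) has_real_derivative \<kappa> * exp (\<kappa> * r)) (at r within X)" for r X
    by (auto intro!: derivative_eq_intros)
  \<comment> \<open>Both signs \<open>\<sigma> = \<plusminus> 1\<close> together give the bound for the absolute value.\<close>
  have mono: "\<sigma> * (exp (\<kappa> * s) * u s - u 0) \<le> A * (exp (\<kappa> * s) - 1)" if "\<bar>\<sigma>\<bar> = 1" for \<sigma>
  proof -
    define d where "d r = \<sigma> * (exp (\<kappa> * r) * (- \<kappa> * h r) + \<kappa> * exp (\<kappa> * r) * u r) - A * (\<kappa> * exp (\<kappa> * r))" for r
    have "((\<lambda>r. \<sigma> * (exp (\<kappa> * r) * u r) - A * exp (\<kappa> * r)) has_derivative (\<lambda>x. d r * x)) (at r within {0..s})"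
      if "0 \<le> r" "r \<le> s" for r
      unfolding d_def has_field_derivative_def[symmetric]
      using that u_deriv[of r]
      by (intro DERIV_diff DERIV_cmult exp_deriv) (auto intro!: derivative_eq_intros)
    then obtain r where r: "r \<in> {0..s}" and
      "(\<sigma> * (exp (\<kappa> * s) * u s) - A * exp (\<kappa> * s)) - (\<sigma> * (exp (\<kappa> * 0) * u 0) - A * exp (\<kappa> * 0)) = d r * (s - 0)"
      using mvt_very_simple[of 0 s "\<lambda>r. \<sigma> * (exp (\<kappa> * r) * u r) - A * exp (\<kappa> * r)" "\<lambda>r x. d r * x"] assms(2) by auto
    moreover have "d r \<le> 0"
    proof -
      have "- \<sigma> * G r \<le> A"
        using G_le[of r] r that by (auto simp: abs_if split: if_splits)
      then have "(- \<sigma> * G r - A) * (\<kappa> * exp (\<kappa> * r)) \<le> 0"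
        using assms(1) by (intro mult_nonpos_nonneg) auto
      also have "(- \<sigma> * G r - A) * (\<kappa> * exp (\<kappa> * r)) = d r"
        by (simp add: d_def u_def algebra_simps)
      finally show ?thesis .
    qed
    then have "d r * (s - 0) \<le> 0"
      using assms(2) by (intro mult_nonpos_nonneg) auto
    ultimately show ?thesis by (simp add: algebra_simps)
  qed
  have "A \<ge> 0" using G_le[of 0] assms(2) by simp
  have "\<bar>exp (\<kappa> * s) * u s - u 0\<bar> \<le> A * exp (\<kappa> * s)"
    using mono[of 1] mono[of "-1"] \<open>A \<ge> 0\<close> by (auto simp: abs_le_iff algebra_simps)
  then have "exp (- \<kappa> * s) * \<bar>exp (\<kappa> * s) * u s - u 0\<bar> \<le> exp (- \<kappa> * s) * (A * exp (\<kappa> * s))"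
    by (intro mult_left_mono) auto
  moreover have "exp (- \<kappa> * s) * \<bar>exp (\<kappa> * s) * u s - u 0\<bar> = \<bar>u s - exp (- \<kappa> * s) * u 0\<bar>"
  proof -
    have "exp (- \<kappa> * s) * \<bar>exp (\<kappa> * s) * u s - u 0\<bar> = \<bar>exp (- \<kappa> * s) * (exp (\<kappa> * s) * u s - u 0)\<bar>"
      by (simp add: abs_mult)
    also have "exp (- \<kappa> * s) * (exp (\<kappa> * s) * u s - u 0) = u s - exp (- \<kappa> * s) * u 0"
      by (simp add: right_diff_distrib exp_minus)
    finally show ?thesis .
  qed
  moreover have "exp (- \<kappa> * s) * (A * exp (\<kappa> * s)) = A"
    by (simp add: exp_minus)
  ultimately have "\<bar>u s - exp (- \<kappa> * s) * u 0\<bar> \<le> A" by argo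
  moreover have "u 0 = h 0"
    using u_eq[of 0] assms(2) by simp
  ultimately have "\<bar>h s - exp (- \<kappa> * s) * h 0\<bar> \<le> 2 * A"
    using G_le[of s] assms(2) by (simp add: u_def)
  then have "ennreal \<bar>h s - exp (- \<kappa> * s) * h 0\<bar> \<le> ennreal (2 * A)"
    by (rule ennreal_leI)
  also have "2 * A = (LBINT r:{0..s}. (2 * \<kappa>) * \<bar>a r\<bar>)"
    by (simp add: A_def mult.assoc)
  also have "ennreal \<dots> = (\<integral>\<^sup>+r. ennreal (2 * \<kappa>) * (ennreal \<bar>a r\<bar> * indicator {0..s} r) \<partial>lborel)"
  proof -
    have "integrable lborel (\<lambda>r. indicator {0..s} r *\<^sub>R (2 * \<kappa> * \<bar>a r\<bar>))"
      using a_int unfolding set_integrable_def[symmetric] by (intro set_integrable_mult_right set_integrable_abs)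
    then have "ennreal (LBINT r:{0..s}. (2 * \<kappa>) * \<bar>a r\<bar>) = (\<integral>\<^sup>+r. ennreal (indicator {0..s} r *\<^sub>R (2 * \<kappa> * \<bar>a r\<bar>)) \<partial>lborel)"
      unfolding set_lebesgue_integral_def using assms(1) by (intro nn_integral_eq_integral[symmetric]) auto
    also have "\<dots> = (\<integral>\<^sup>+r. ennreal (2 * \<kappa>) * (ennreal \<bar>a r\<bar> * indicator {0..s} r) \<partial>lborel)"
      using assms(1) by (intro nn_integral_cong) (auto simp: indicator_def ennreal_mult)
    finally show ?thesis .
  qed
  also have "\<dots> = ennreal (2 * \<kappa>) * (\<integral>\<^sup>+r\<in>{0..s}. ennreal \<bar>a r\<bar> \<partial>lborel)"
  proof (rule nn_integral_cmult)
    have "(\<lambda>r. ennreal \<bar>indicator {0..s} r *\<^sub>R a r\<bar>) \<in> borel_measurable lborel"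
      using a_int unfolding set_integrable_def by auto
    also have "(\<lambda>r. ennreal \<bar>indicator {0..s} r *\<^sub>R a r\<bar>) = (\<lambda>r. ennreal \<bar>a r\<bar> * indicator {0..s} r)"
      by (auto simp: indicator_def)
    finally show "(\<lambda>r. ennreal \<bar>a r\<bar> * indicator {0..s} r) \<in> borel_measurable lborel" .
  qed
  finally show ?thesis .
qed

text \<open>
  Any measurable majorant \<open>G\<close> of the temperature is admitted, so that the temperatures of both layers
  can later be collected in one function.
\<close>

lemma transport_segment:
  assumes sol: "solves_transport C \<epsilon> \<nu> \<tau> a b h"
    and pos: "\<epsilon> > 0" "\<omega> > 0" "\<tau>\<^sub>0 > 0" "\<tau>\<^sub>0 \<le> \<tau> \<omega>" "C \<omega> > 0"
    and \<mu>: "-1 \<le> \<mu>" "\<mu> \<le> 1" and x: "a \<le> x" "x \<le> b" and s: "0 \<le> s" "\<epsilon> * s \<le> t"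
    and y: "a \<le> x - \<mu> * \<nu> \<omega> * s" "x - \<mu> * \<nu> \<omega> * s \<le> b"
    and G: "\<And>t' y. 0 \<le> t' \<Longrightarrow> t' \<le> t \<Longrightarrow> a \<le> y \<Longrightarrow> y \<le> b \<Longrightarrow> ennreal \<bar>Delta_T C \<tau> h t' y\<bar> \<le> G t' y"
    and G_meas [measurable]: "case_prod G \<in> borel_measurable (borel \<Otimes>\<^sub>M borel)"
  shows "ennreal \<bar>h t x \<mu> \<omega> - exp (- s / (\<epsilon> * \<tau> \<omega>)) * h (t - \<epsilon> * s) (x - \<mu> * \<nu> \<omega> * s) \<mu> \<omega>\<bar>
    \<le> ennreal (2 / (\<epsilon> * \<tau>\<^sub>0) * C \<omega>) * path_int \<epsilon> G t x (\<mu> * (- \<nu> \<omega>))"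
proof -
  define k where "k = \<mu> * \<nu> \<omega>"
  define \<kappa> where "\<kappa> = 1 / (\<epsilon> * \<tau> \<omega>)"
  \<comment> \<open>The equation is stated forwards from the earlier end point \<open>(t0, x0)\<close> of the segment.\<close>
  define t0 x0 where "t0 = t - \<epsilon> * s" and "x0 = x - k * s"
  define H where "H r = h (t0 + \<epsilon> * r) (x0 + k * r) \<mu> \<omega>" for r
  define D where "D r = Delta_T C \<tau> h (t0 + \<epsilon> * r) (x0 + k * r)" for r
  have \<kappa>: "\<kappa> > 0" "\<kappa> \<le> 1 / (\<epsilon> * \<tau>\<^sub>0)"
    using pos by (auto simp: \<kappa>_def intro!: divide_left_mono mult_left_mono mult_pos_pos)
  have [measurable]: "(\<lambda>r. G (t0 + \<epsilon> * r) (x0 + k * r)) \<in> borel_measurable borel"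
    by (rule measurable_curried[OF G_meas]) simp_all
  have inside: "a \<le> x0 + k * r \<and> x0 + k * r \<le> b" if "0 \<le> r" "r \<le> s" for r
  proof (cases "k \<ge> 0")
    case True
    then have "0 \<le> k * r" "k * r \<le> k * s" using that by (auto intro: mult_left_mono)
    then show ?thesis using x y by (auto simp: x0_def k_def)
  next
    case False
    then have "k * r \<le> 0" "k * s \<le> k * r" using that by (auto intro: mult_left_mono_neg mult_nonpos_nonneg)
    then show ?thesis using x y by (auto simp: x0_def k_def)
  qed
  have coll: "collision C \<epsilon> \<tau> h (t0 + \<epsilon> * r) (x0 + k * r) \<mu> \<omega> = \<kappa> * (C \<omega> * D r - H r)" for r
    by (simp add: collision_def L_op_def D_def H_def \<kappa>_def Delta_T_def)
  have relax: "ennreal \<bar>H s - exp (- \<kappa> * s) * H 0\<bar> \<le> ennreal (2 * \<kappa>) * (\<integral>\<^sup>+r\<in>{0..s}. ennreal \<bar>C \<omega> * D r\<bar> \<partial>lborel)"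
  proof (rule relaxation_bound)
    fix r assume r: "0 \<le> r" "r \<le> s"
    have "t0 \<ge> 0" "x0 \<in> {a..b}" "\<mu> \<in> {-1..1}" "x0 + \<mu> * \<nu> \<omega> * r \<in> {a..b}"
      using s inside[of 0] inside[OF r] \<mu> by (auto simp: t0_def k_def)
    with sol r \<open>\<omega> > 0\<close>
    have "set_integrable lborel {0..r} (\<lambda>r. collision C \<epsilon> \<tau> h (t0 + \<epsilon> * r) (x0 + \<mu> * \<nu> \<omega> * r) \<mu> \<omega>) \<and>
        h (t0 + \<epsilon> * r) (x0 + \<mu> * \<nu> \<omega> * r) \<mu> \<omega> - h t0 x0 \<mu> \<omega> =
          (LBINT r:{0..r}. collision C \<epsilon> \<tau> h (t0 + \<epsilon> * r) (x0 + \<mu> * \<nu> \<omega> * r) \<mu> \<omega>)"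
      unfolding solves_transport_def by blast
    then show "set_integrable lborel {0..r} (\<lambda>r. \<kappa> * (C \<omega> * D r - H r)) \<and>
      H r - H 0 = (LBINT r:{0..r}. \<kappa> * (C \<omega> * D r - H r))"
      unfolding k_def[symmetric] coll by (simp add: H_def)
  qed (use \<kappa> s in auto)
  have "(\<integral>\<^sup>+r\<in>{0..s}. ennreal \<bar>C \<omega> * D r\<bar> \<partial>lborel) \<le>
      (\<integral>\<^sup>+r. ennreal (C \<omega>) * (G (t0 + \<epsilon> * r) (x0 + k * r) * indicator {0..s} r) \<partial>lborel)"
  proof (intro nn_integral_mono)
    fix r
    have "ennreal \<bar>C \<omega> * D r\<bar> \<le> ennreal (C \<omega>) * G (t0 + \<epsilon> * r) (x0 + k * r)" if r: "0 \<le> r" "r \<le> s"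
    proof -
      have "0 \<le> \<epsilon> * r" "\<epsilon> * r \<le> \<epsilon> * s" using r pos by auto
      then have "ennreal \<bar>D r\<bar> \<le> G (t0 + \<epsilon> * r) (x0 + k * r)"
        unfolding D_def using s inside[OF r] by (intro G) (auto simp: t0_def)
      then show ?thesis
        using \<open>C \<omega> > 0\<close> by (simp add: abs_mult ennreal_mult mult_left_mono)
    qed
    then show "ennreal \<bar>C \<omega> * D r\<bar> * indicator {0..s} r \<le>
        ennreal (C \<omega>) * (G (t0 + \<epsilon> * r) (x0 + k * r) * indicator {0..s} r)"
      by (auto simp: indicator_def)
  qed
  also have "\<dots> = ennreal (C \<omega>) * (\<integral>\<^sup>+r. G (t0 + \<epsilon> * r) (x0 + k * r) * indicator {0..s} r \<partial>lborel)"
    by (rule nn_integral_cmult) measurable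
  also have "(\<integral>\<^sup>+r. G (t0 + \<epsilon> * r) (x0 + k * r) * indicator {0..s} r \<partial>lborel) =
      (\<integral>\<^sup>+r. G (t0 + \<epsilon> * (s + (-1) * r)) (x0 + k * (s + (-1) * r)) * indicator {0..s} (s + (-1) * r) \<partial>lborel)"
    by (subst nn_integral_real_affine[where c = "-1" and t = s]) auto
  finally have step: "(\<integral>\<^sup>+r\<in>{0..s}. ennreal \<bar>C \<omega> * D r\<bar> \<partial>lborel) \<le> ennreal (C \<omega>) *
    (\<integral>\<^sup>+r. G (t0 + \<epsilon> * (s + (-1) * r)) (x0 + k * (s + (-1) * r)) * indicator {0..s} (s + (-1) * r) \<partial>lborel)" .
  have "(\<integral>\<^sup>+r. G (t0 + \<epsilon> * (s + (-1) * r)) (x0 + k * (s + (-1) * r)) * indicator {0..s} (s + (-1) * r) \<partial>lborel)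
      \<le> path_int \<epsilon> G t x (\<mu> * (- \<nu> \<omega>))"
    unfolding path_int_def
  proof (intro nn_integral_mono)
    fix r
    have "t0 + \<epsilon> * (s + (-1) * r) = t - \<epsilon> * r" "x0 + k * (s + (-1) * r) = x + \<mu> * (- \<nu> \<omega>) * r"
      by (auto simp: t0_def x0_def k_def algebra_simps)
    moreover have "s \<le> t / \<epsilon>" using s pos by (simp add: field_simps)
    ultimately show "G (t0 + \<epsilon> * (s + (-1) * r)) (x0 + k * (s + (-1) * r)) * indicator {0..s} (s + (-1) * r) \<le>
        G (t - \<epsilon> * r) (x + \<mu> * (- \<nu> \<omega>) * r) * indicator {0..t / \<epsilon>} r"
      by (auto simp: indicator_def)
  qed
  then have "ennreal (2 * \<kappa>) * (\<integral>\<^sup>+r\<in>{0..s}. ennreal \<bar>C \<omega> * D r\<bar> \<partial>lborel) \<le>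
      ennreal (2 * \<kappa>) * (ennreal (C \<omega>) * path_int \<epsilon> G t x (\<mu> * (- \<nu> \<omega>)))"
    using step by (intro mult_left_mono[of _ _ "ennreal (2 * \<kappa>)"]) (meson mult_left_mono order_trans zero_le, simp)
  note order_trans[OF relax this]
  also have "ennreal (2 * \<kappa>) * (ennreal (C \<omega>) * path_int \<epsilon> G t x (\<mu> * (- \<nu> \<omega>))) =
      ennreal (2 * \<kappa> * C \<omega>) * path_int \<epsilon> G t x (\<mu> * (- \<nu> \<omega>))"
    using \<kappa> pos by (simp add: ennreal_mult mult.assoc)
  also have "\<dots> \<le> ennreal (2 / (\<epsilon> * \<tau>\<^sub>0) * C \<omega>) * path_int \<epsilon> G t x (\<mu> * (- \<nu> \<omega>))"
    using \<kappa> pos by (intro mult_right_mono ennreal_leI) auto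
  finally show ?thesis
    by (simp add: H_def t0_def x0_def k_def \<kappa>_def)
qed

section \<open>Phase averages and the temperature\<close>

text \<open>
  A Bochner integral that does not exist has the value \<open>0\<close>, so the bound holds for every function. The
  temperature may be such a default value on a null set of times and positions.
\<close>

lemma ennreal_abs_integral_le:
  fixes f :: "'a \<Rightarrow> real"
  shows "ennreal \<bar>integral\<^sup>L M f\<bar> \<le> (\<integral>\<^sup>+x. ennreal \<bar>f x\<bar> \<partial>M)"
proof (cases "integrable M f")
  case True
  then show ?thesis using integral_norm_bound_ennreal[of M f] by simp
qed (simp add: not_integrable_integral_eq)

lemma phonon_avg_abs_le:
  "ennreal \<bar>phonon_avg q\<bar> \<le> phase_avg (indicator {0<..}) (\<lambda>\<mu> \<omega>. ennreal \<bar>q \<mu> \<omega>\<bar>)"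
proof -
  have "ennreal \<bar>phonon_avg q\<bar> \<le> (\<integral>\<^sup>+\<mu>. ennreal \<bar>indicat_real {-1..1} \<mu> *\<^sub>R (LBINT \<omega>:{0<..}. q \<mu> \<omega>)\<bar> \<partial>lborel)"
    using ennreal_abs_integral_le[of lborel "\<lambda>\<mu>. indicat_real {-1..1} \<mu> *\<^sub>R (LBINT \<omega>:{0<..}. q \<mu> \<omega>)"]
    by (simp add: phonon_avg_def set_lebesgue_integral_def[of _ "{-1..1}"])
  also have "\<dots> = (\<integral>\<^sup>+\<mu>\<in>{-1..1}. ennreal \<bar>LBINT \<omega>:{0<..}. q \<mu> \<omega>\<bar> \<partial>lborel)"
    by (intro nn_integral_cong) (auto simp: indicator_def)
  also have "\<dots> \<le> phase_avg (indicator {0<..}) (\<lambda>\<mu> \<omega>. ennreal \<bar>q \<mu> \<omega>\<bar>)"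
    unfolding phase_avg_def
  proof (intro nn_integral_mono mult_right_mono)
    fix \<mu>
    have "ennreal \<bar>LBINT \<omega>:{0<..}. q \<mu> \<omega>\<bar> \<le> (\<integral>\<^sup>+\<omega>. ennreal \<bar>indicat_real {0<..} \<omega> *\<^sub>R q \<mu> \<omega>\<bar> \<partial>lborel)"
      unfolding set_lebesgue_integral_def by (rule ennreal_abs_integral_le)
    also have "\<dots> = (\<integral>\<^sup>+\<omega>. indicator {0<..} \<omega> * ennreal \<bar>q \<mu> \<omega>\<bar> \<partial>lborel)"
      by (intro nn_integral_cong) (auto simp: indicator_def)
    finally show "ennreal \<bar>LBINT \<omega>:{0<..}. q \<mu> \<omega>\<bar> \<le> (\<integral>\<^sup>+\<omega>. indicator {0<..} \<omega> * ennreal \<bar>q \<mu> \<omega>\<bar> \<partial>lborel)" .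
  qed auto
  finally show ?thesis .
qed

definition phase_cut :: "(real \<Rightarrow> real \<Rightarrow> real) \<Rightarrow> real \<times> real \<Rightarrow> real" where
  "phase_cut q = (\<lambda>(\<mu>, \<omega>). indicator {-1..1} \<mu> * (indicator {0<..} \<omega> * q \<mu> \<omega>))"

lemma phonon_avg_cut: "phonon_avg q = (LINT \<mu>|lborel. LINT \<omega>|lborel. phase_cut q (\<mu>, \<omega>))"
  unfolding phonon_avg_def phase_cut_def set_lebesgue_integral_def by simp

lemma integrable_phase_cut:
  assumes [measurable]: "phase_cut q \<in> borel_measurable (lborel \<Otimes>\<^sub>M lborel)"
    and fin: "phase_avg (indicator {0<..}) (\<lambda>\<mu> \<omega>. ennreal \<bar>q \<mu> \<omega>\<bar>) < \<infinity>"
  shows "integrable (lborel \<Otimes>\<^sub>M lborel) (phase_cut q)"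
proof (rule integrableI_bounded)
  have "(\<integral>\<^sup>+z. ennreal (norm (phase_cut q z)) \<partial>(lborel \<Otimes>\<^sub>M lborel)) =
      (\<integral>\<^sup>+\<mu>. (\<integral>\<^sup>+\<omega>. ennreal (norm (phase_cut q (\<mu>, \<omega>))) \<partial>lborel) \<partial>lborel)"
    by (rule lborel.nn_integral_fst[symmetric]) measurable
  also have "\<dots> \<le> phase_avg (indicator {0<..}) (\<lambda>\<mu> \<omega>. ennreal \<bar>q \<mu> \<omega>\<bar>)"
    unfolding phase_avg_def phase_cut_def
    by (intro nn_integral_mono) (auto simp: indicator_def intro!: nn_integral_mono)
  finally show "(\<integral>\<^sup>+z. ennreal (norm (phase_cut q z)) \<partial>(lborel \<Otimes>\<^sub>M lborel)) < \<infinity>"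
    using fin by order
qed fact

text \<open>
  Iterated Bochner integrals need not be additive; the bounds on the averages of the absolute values
  make both integrands integrable on the plane.
\<close>

lemma phonon_avg_diff_abs_le:
  assumes "phase_cut q \<in> borel_measurable (lborel \<Otimes>\<^sub>M lborel)"
    and "phase_cut q' \<in> borel_measurable (lborel \<Otimes>\<^sub>M lborel)"
    and "phase_avg (indicator {0<..}) (\<lambda>\<mu> \<omega>. ennreal \<bar>q \<mu> \<omega>\<bar>) < \<infinity>"
    and "phase_avg (indicator {0<..}) (\<lambda>\<mu> \<omega>. ennreal \<bar>q' \<mu> \<omega>\<bar>) < \<infinity>"
  shows "ennreal \<bar>phonon_avg q - phonon_avg q'\<bar> \<le>
    phase_avg (indicator {0<..}) (\<lambda>\<mu> \<omega>. ennreal \<bar>q \<mu> \<omega> - q' \<mu> \<omega>\<bar>)"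
proof -
  let ?P = "lborel \<Otimes>\<^sub>M lborel :: (real \<times> real) measure"
  have i: "integrable ?P (phase_cut q)" "integrable ?P (phase_cut q')"
    using assms by (auto intro: integrable_phase_cut)
  have eq: "phonon_avg r = integral\<^sup>L ?P (phase_cut r)" if "integrable ?P (phase_cut r)" for r
    using lborel_pair.integral_fst'[OF that] by (simp add: phonon_avg_cut)
  have cut: "phase_cut (\<lambda>\<mu> \<omega>. q \<mu> \<omega> - q' \<mu> \<omega>) = (\<lambda>z. phase_cut q z - phase_cut q' z)"
    by (auto simp: phase_cut_def fun_eq_iff algebra_simps)
  have "phonon_avg q - phonon_avg q' = phonon_avg (\<lambda>\<mu> \<omega>. q \<mu> \<omega> - q' \<mu> \<omega>)"
    using i by (simp add: eq cut)
  then show ?thesis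
    using phonon_avg_abs_le[of "\<lambda>\<mu> \<omega>. q \<mu> \<omega> - q' \<mu> \<omega>"] by simp
qed

text \<open>
  The flux density extended by \<open>0\<close>; a Borel function on the whole space, so its sections, such as the
  trace at \<open>x = 0\<close>, are Borel as well.
\<close>

definition cut_off ::
  "real set \<Rightarrow> real set \<Rightarrow> phase_fun \<Rightarrow> (real \<Rightarrow> real) \<Rightarrow> real \<times> real \<times> real \<times> real \<Rightarrow> real" where
  "cut_off I X h \<tau> z = indicator (I \<times> X \<times> {-1..1} \<times> {0<..}) z * (case z of (t, x, \<mu>, \<omega>) \<Rightarrow> h t x \<mu> \<omega> / \<tau> \<omega>)"

lemma cut_off_section:
  "cut_off I X h \<tau> (t, x, z) = indicator I t * indicator X x * phase_cut (\<lambda>\<mu> \<omega>. h t x \<mu> \<omega> / \<tau> \<omega>) z"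
  by (auto simp: cut_off_def phase_cut_def indicator_def split: prod.splits)

lemma borel_measurable_cut_off:
  assumes "set_integrable lborel (I \<times> X \<times> {-1..1} \<times> {0<..}) (\<lambda>(t, x, \<mu>, \<omega>). h t x \<mu> \<omega> / \<tau> \<omega>)"
  shows "cut_off I X h \<tau> \<in> borel_measurable (borel \<Otimes>\<^sub>M borel \<Otimes>\<^sub>M borel \<Otimes>\<^sub>M borel)"
proof -
  have "cut_off I X h \<tau> \<in> borel_measurable lborel"
    using borel_measurable_integrable[OF assms[unfolded set_integrable_def]]
    by (simp add: cut_off_def[abs_def])
  then show ?thesis by (simp add: borel_prod)
qed

lemma borel_measurable_Delta_T:
  assumes int: "set_integrable lborel ({0..T} \<times> {a..b} \<times> {-1..1} \<times> {0<..}) (\<lambda>(t, x, \<mu>, \<omega>). h t x \<mu> \<omega> / \<tau> \<omega>)"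
  shows "(\<lambda>(t, x). indicator {0..T} t * indicator {a..b} x * Delta_T C \<tau> h t x) \<in> borel_measurable (borel \<Otimes>\<^sub>M borel)"
proof -
  note cut [measurable] = borel_measurable_cut_off[OF int]
  have "indicator {0..T} t * indicator {a..b} x * Delta_T C \<tau> h t x =
      (LINT \<mu>|lborel. LINT \<omega>|lborel. cut_off {0..T} {a..b} h \<tau> (t, x, \<mu>, \<omega>)) / C_tau C \<tau>" for t x
    by (simp add: cut_off_section Delta_T_def phonon_avg_cut)
  then have "(\<lambda>(t, x). indicator {0..T} t * indicator {a..b} x * Delta_T C \<tau> h t x) =
      (\<lambda>z. (LINT \<mu>|lborel. LINT \<omega>|lborel. cut_off {0..T} {a..b} h \<tau> (fst z, snd z, \<mu>, \<omega>)) / C_tau C \<tau>)"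
    by (simp add: fun_eq_iff)
  moreover have "(\<lambda>z. (LINT \<mu>|lborel. LINT \<omega>|lborel. cut_off {0..T} {a..b} h \<tau> (fst z, snd z, \<mu>, \<omega>)) / C_tau C \<tau>)
      \<in> borel_measurable (borel \<Otimes>\<^sub>M borel)"
    by measurable
  ultimately show ?thesis by simp
qed

lemma borel_measurable_phase_cut_section:
  fixes h :: phase_fun
  assumes int: "set_integrable lborel ({0..T} \<times> {a..b} \<times> {-1..1} \<times> {0<..}) (\<lambda>(t, x, \<mu>, \<omega>). h t x \<mu> \<omega> / \<tau> \<omega>)"
    and "t \<in> {0..T}" "x \<in> {a..b}"
  shows "phase_cut (\<lambda>\<mu> \<omega>. h t x \<mu> \<omega> / \<tau> \<omega>) \<in> borel_measurable (lborel \<Otimes>\<^sub>M lborel)"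
proof -
  note [measurable] = borel_measurable_cut_off[OF int]
  have "(\<lambda>z. cut_off {0..T} {a..b} h \<tau> (t, x, z)) \<in> borel_measurable (borel \<Otimes>\<^sub>M borel)"
    by measurable
  then show ?thesis
    using assms(2,3) by (simp add: cut_off_section cong: measurable_cong_sets)
qed

lemma nn_integral_Delta_T_finite:
  assumes int: "set_integrable lborel ({0..T} \<times> {a..b} \<times> {-1..1} \<times> {0<..}) (\<lambda>(t, x, \<mu>, \<omega>). h t x \<mu> \<omega> / \<tau> \<omega>)"
    and "C_tau C \<tau> > 0"
  shows "(\<integral>\<^sup>+t. (\<integral>\<^sup>+x. indicator {0..T} t * indicator {a..b} x * ennreal \<bar>Delta_T C \<tau> h t x\<bar> \<partial>lborel) \<partial>lborel) < \<infinity>"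
proof -
  let ?Q = "cut_off {0..T} {a..b} h \<tau>"
  note cut [measurable] = borel_measurable_cut_off[OF int]
  have "(\<lambda>z. ?Q (t, z)) \<in> borel_measurable (borel \<Otimes>\<^sub>M borel \<Otimes>\<^sub>M borel)"
    "(\<lambda>z. ?Q (t, x, z)) \<in> borel_measurable (borel \<Otimes>\<^sub>M borel)" for t x
    by measurable
  with cut have [measurable]: "?Q \<in> borel_measurable borel" "\<And>t. (\<lambda>z. ?Q (t, z)) \<in> borel_measurable borel"
    "\<And>t x. (\<lambda>z. ?Q (t, x, z)) \<in> borel_measurable borel"
    by (simp_all add: borel_prod)
  have "integrable lborel ?Q"
    using int by (simp add: set_integrable_def cut_off_def[abs_def])
  then have "(\<integral>\<^sup>+z. ennreal \<bar>?Q z\<bar> \<partial>lborel) < \<infinity>"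
    by (simp add: integrable_iff_bounded)
  also have "(\<integral>\<^sup>+z. ennreal \<bar>?Q z\<bar> \<partial>lborel) = (\<integral>\<^sup>+t. (\<integral>\<^sup>+z. ennreal \<bar>?Q (t, z)\<bar> \<partial>lborel) \<partial>lborel)"
    unfolding lborel_prod[symmetric] by (rule sigma_finite_measure.nn_integral_fst[symmetric])
      (auto simp: lborel_prod lborel.sigma_finite_measure_axioms)
  also have "\<dots> = (\<integral>\<^sup>+t. (\<integral>\<^sup>+x. (\<integral>\<^sup>+z. ennreal \<bar>?Q (t, x, z)\<bar> \<partial>lborel) \<partial>lborel) \<partial>lborel)"
    unfolding lborel_prod[symmetric] by (intro nn_integral_cong sigma_finite_measure.nn_integral_fst[symmetric])
      (auto simp: lborel_prod lborel.sigma_finite_measure_axioms)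
  also have "\<dots> = (\<integral>\<^sup>+t. (\<integral>\<^sup>+x. (\<integral>\<^sup>+\<mu>. (\<integral>\<^sup>+\<omega>. ennreal \<bar>?Q (t, x, \<mu>, \<omega>)\<bar> \<partial>lborel) \<partial>lborel) \<partial>lborel) \<partial>lborel)"
    unfolding lborel_prod[symmetric] by (intro nn_integral_cong sigma_finite_measure.nn_integral_fst[symmetric])
      (auto simp: lborel.sigma_finite_measure_axioms)
  finally have fin: "(\<integral>\<^sup>+t. (\<integral>\<^sup>+x. (\<integral>\<^sup>+\<mu>. (\<integral>\<^sup>+\<omega>. ennreal \<bar>?Q (t, x, \<mu>, \<omega>)\<bar> \<partial>lborel) \<partial>lborel) \<partial>lborel) \<partial>lborel) < \<infinity>" .
  have pt: "indicator {0..T} t * indicator {a..b} x * ennreal \<bar>Delta_T C \<tau> h t x\<bar> \<le>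
      ennreal (1 / C_tau C \<tau>) * (\<integral>\<^sup>+\<mu>. (\<integral>\<^sup>+\<omega>. ennreal \<bar>?Q (t, x, \<mu>, \<omega>)\<bar> \<partial>lborel) \<partial>lborel)" for t x
  proof (cases "t \<in> {0..T} \<and> x \<in> {a..b}")
    case True
    have "ennreal \<bar>phonon_avg (\<lambda>\<mu> \<omega>. h t x \<mu> \<omega> / \<tau> \<omega>)\<bar> \<le>
        (\<integral>\<^sup>+\<mu>. ennreal \<bar>LINT \<omega>|lborel. ?Q (t, x, \<mu>, \<omega>)\<bar> \<partial>lborel)"
      unfolding phonon_avg_cut using True by (simp add: cut_off_section ennreal_abs_integral_le)
    also have "\<dots> \<le> (\<integral>\<^sup>+\<mu>. (\<integral>\<^sup>+\<omega>. ennreal \<bar>?Q (t, x, \<mu>, \<omega>)\<bar> \<partial>lborel) \<partial>lborel)"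
      by (intro nn_integral_mono ennreal_abs_integral_le)
    finally have "ennreal (1 / C_tau C \<tau>) * ennreal \<bar>phonon_avg (\<lambda>\<mu> \<omega>. h t x \<mu> \<omega> / \<tau> \<omega>)\<bar> \<le>
        ennreal (1 / C_tau C \<tau>) * (\<integral>\<^sup>+\<mu>. (\<integral>\<^sup>+\<omega>. ennreal \<bar>?Q (t, x, \<mu>, \<omega>)\<bar> \<partial>lborel) \<partial>lborel)"
      by (intro mult_left_mono) auto
    then show ?thesis
      using True assms(2) by (simp add: Delta_T_def abs_divide flip: ennreal_mult')
  qed auto
  have "(\<integral>\<^sup>+t. (\<integral>\<^sup>+x. indicator {0..T} t * indicator {a..b} x * ennreal \<bar>Delta_T C \<tau> h t x\<bar> \<partial>lborel) \<partial>lborel) \<le>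
      (\<integral>\<^sup>+t. (\<integral>\<^sup>+x. ennreal (1 / C_tau C \<tau>) * (\<integral>\<^sup>+\<mu>. (\<integral>\<^sup>+\<omega>. ennreal \<bar>?Q (t, x, \<mu>, \<omega>)\<bar> \<partial>lborel) \<partial>lborel) \<partial>lborel) \<partial>lborel)"
    by (intro nn_integral_mono pt)
  also have "\<dots> = ennreal (1 / C_tau C \<tau>) * (\<integral>\<^sup>+t. (\<integral>\<^sup>+x. (\<integral>\<^sup>+\<mu>. (\<integral>\<^sup>+\<omega>. ennreal \<bar>?Q (t, x, \<mu>, \<omega>)\<bar> \<partial>lborel) \<partial>lborel) \<partial>lborel) \<partial>lborel)"
    by (simp add: nn_integral_cmult)
  also have "\<dots> < \<infinity>"
    using fin by (simp add: ennreal_mult_less_top)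
  finally show ?thesis .
qed

definition weight :: "(real \<Rightarrow> real) \<Rightarrow> (real \<Rightarrow> real) \<Rightarrow> real \<Rightarrow> ennreal" where
  "weight C \<tau> \<omega> = indicator {0<..} \<omega> * ennreal (C \<omega> / \<tau> \<omega> / C_tau C \<tau>)"

lemma C_tau_eq: "C_tau C \<tau> = 2 * (LBINT \<omega>:{0<..}. C \<omega> / \<tau> \<omega>)"
  unfolding C_tau_def phonon_avg_def by (simp add: set_integral_const measure_def)

lemma
  assumes int: "set_integrable lborel {0<..} (\<lambda>\<omega>. C \<omega> / \<tau> \<omega>)"
    and pos: "\<And>\<omega>. \<omega> > 0 \<Longrightarrow> C \<omega> > 0" "\<And>\<omega>. \<omega> > 0 \<Longrightarrow> \<tau> \<omega> > 0"
  shows C_tau_pos: "C_tau C \<tau> > 0"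
    and borel_measurable_weight: "weight C \<tau> \<in> borel_measurable borel"
    and weight_mass: "2 * (\<integral>\<^sup>+\<omega>. weight C \<tau> \<omega> \<partial>lborel) = 1"
proof -
  let ?u = "\<lambda>\<omega>. indicat_real {0<..} \<omega> * (C \<omega> / \<tau> \<omega>)"
  have i: "integrable lborel ?u"
    using int by (simp add: set_integrable_def)
  have nn: "?u \<omega> \<ge> 0" for \<omega>
    using pos[of \<omega>] by (auto simp: indicator_def)
  have I: "(LBINT \<omega>:{0<..}. C \<omega> / \<tau> \<omega>) = integral\<^sup>L lborel ?u"
    by (simp add: set_lebesgue_integral_def)
  have "integral\<^sup>L lborel ?u \<noteq> 0"
  proof
    assume "integral\<^sup>L lborel ?u = 0"
    then have "AE \<omega> in lborel. ?u \<omega> = 0"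
      using i nn by (subst (asm) integral_nonneg_eq_0_iff_AE) auto
    then have "AE \<omega> in lborel. \<omega> \<notin> {0<..<1::real}"
      by eventually_elim (use pos in \<open>force simp: indicator_def\<close>)
    then have "emeasure lborel {0<..<1::real} = 0"
      by (subst (asm) AE_iff_null_sets[symmetric]) auto
    then show False by simp
  qed
  moreover have "integral\<^sup>L lborel ?u \<ge> 0"
    using nn by (intro integral_nonneg_AE) auto
  ultimately show C: "C_tau C \<tau> > 0"
    unfolding C_tau_eq I by simp
  have w_eq: "weight C \<tau> = (\<lambda>\<omega>. ennreal (?u \<omega> / C_tau C \<tau>))"
    by (auto simp: weight_def indicator_def)
  show "weight C \<tau> \<in> borel_measurable borel"
    unfolding w_eq using borel_measurable_integrable[OF i] by measurable
  have "(\<integral>\<^sup>+\<omega>. weight C \<tau> \<omega> \<partial>lborel) = ennreal (integral\<^sup>L lborel (\<lambda>\<omega>. ?u \<omega> / C_tau C \<tau>))"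
    unfolding w_eq
    by (intro nn_integral_eq_integral AE_I2 divide_nonneg_nonneg nn less_imp_le[OF C] integrable_divide_zero i)
  also have "integral\<^sup>L lborel (\<lambda>\<omega>. ?u \<omega> / C_tau C \<tau>) = 1 / 2"
  proof -
    have "integral\<^sup>L lborel (\<lambda>\<omega>. ?u \<omega> / C_tau C \<tau>) = integral\<^sup>L lborel ?u / C_tau C \<tau>"
      by (rule integral_divide_zero)
    moreover have "C_tau C \<tau> = 2 * integral\<^sup>L lborel ?u"
      unfolding C_tau_eq I ..
    ultimately show ?thesis using C by auto
  qed
  finally show "2 * (\<integral>\<^sup>+\<omega>. weight C \<tau> \<omega> \<partial>lborel) = 1"
    using ennreal_mult'[of 2 "1/2"] by simp
qed

section \<open>The two media\<close>

text \<open>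
  Velocities are measurable only on the positive half-line; cut off, they are Borel functions.
\<close>

definition vel :: "(real \<Rightarrow> real) \<Rightarrow> real \<Rightarrow> real" where
  "vel u \<omega> = indicator {0<..} \<omega> * u \<omega>"

lemma vel_pos [simp]: "\<omega> > 0 \<Longrightarrow> vel u \<omega> = u \<omega>"
  by (simp add: vel_def)

locale two_media =
  fixes C \<tau> \<tau>\<^sub>s \<nu> \<nu>\<^sub>s :: "real \<Rightarrow> real" and \<epsilon> \<tau>\<^sub>0 v\<^sub>0 v\<^sub>1 :: real
  assumes eps_pos: "\<epsilon> > 0" and tau0_pos: "\<tau>\<^sub>0 > 0" and v0_pos: "v\<^sub>0 > 0"
    and C_pos: "\<And>\<omega>. \<omega> > 0 \<Longrightarrow> C \<omega> > 0"
    and tau_ge: "\<And>\<omega>. \<omega> > 0 \<Longrightarrow> \<tau>\<^sub>0 \<le> \<tau> \<omega>" "\<And>\<omega>. \<omega> > 0 \<Longrightarrow> \<tau>\<^sub>0 \<le> \<tau>\<^sub>s \<omega>"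
    and nu_ge: "\<And>\<omega>. \<omega> > 0 \<Longrightarrow> v\<^sub>0 \<le> \<nu> \<omega>" "\<And>\<omega>. \<omega> > 0 \<Longrightarrow> v\<^sub>0 \<le> \<nu>\<^sub>s \<omega>"
    and nu_le: "\<And>\<omega>. \<omega> > 0 \<Longrightarrow> \<nu> \<omega> \<le> v\<^sub>1" "\<And>\<omega>. \<omega> > 0 \<Longrightarrow> \<nu>\<^sub>s \<omega> \<le> v\<^sub>1"
    and C_int: "set_integrable lborel {0<..} (\<lambda>\<omega>. C \<omega> / \<tau> \<omega>)"
      "set_integrable lborel {0<..} (\<lambda>\<omega>. C \<omega> / \<tau>\<^sub>s \<omega>)"
    and vel_meas [measurable]: "vel \<nu> \<in> borel_measurable borel" "vel \<nu>\<^sub>s \<in> borel_measurable borel"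
begin

lemma tau_pos: "\<omega> > 0 \<Longrightarrow> \<tau> \<omega> > 0" "\<omega> > 0 \<Longrightarrow> \<tau>\<^sub>s \<omega> > 0"
  using tau_ge tau0_pos by (meson less_le_trans)+

lemma nu_pos: "\<omega> > 0 \<Longrightarrow> \<nu> \<omega> > 0" "\<omega> > 0 \<Longrightarrow> \<nu>\<^sub>s \<omega> > 0"
  using nu_ge v0_pos by (meson less_le_trans)+

lemma v_le: "v\<^sub>0 \<le> v\<^sub>1"
  using nu_ge(1)[of 1] nu_le(1)[of 1] by linarith

lemma C_tau_both_pos: "C_tau C \<tau> > 0" "C_tau C \<tau>\<^sub>s > 0"
  by (intro C_tau_pos C_int C_pos tau_pos; assumption)+

abbreviation (input) "\<kappa> \<equiv> 2 / (\<epsilon> * \<tau>\<^sub>0)"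

sublocale ray_kernel_pair \<epsilon> v\<^sub>0 v\<^sub>1 "vel \<nu>" "vel \<nu>\<^sub>s" "weight C \<tau>" "weight C \<tau>\<^sub>s" "2 / (\<epsilon> * \<tau>\<^sub>0)"
proof -
  have w: "\<omega> > 0" if "weight C u \<omega> \<noteq> 0" for \<omega> u
    using that by (auto simp: weight_def indicator_def split: if_splits)
  have b: "v\<^sub>0 \<le> vel \<nu> \<omega> \<and> vel \<nu> \<omega> \<le> v\<^sub>1 \<and> v\<^sub>0 \<le> vel \<nu>\<^sub>s \<omega> \<and> vel \<nu>\<^sub>s \<omega> \<le> v\<^sub>1" if "\<omega> > 0" for \<omega>
    using that nu_ge nu_le by simp
  have m: "2 * (\<integral>\<^sup>+\<omega>. weight C \<tau> \<omega> \<partial>lborel) \<le> 1" "2 * (\<integral>\<^sup>+\<omega>. weight C \<tau>\<^sub>s \<omega> \<partial>lborel) \<le> 1"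
    using weight_mass[OF C_int(1) C_pos tau_pos(1)] weight_mass[OF C_int(2) C_pos tau_pos(2)] by auto
  have wm: "weight C \<tau> \<in> borel_measurable borel" "weight C \<tau>\<^sub>s \<in> borel_measurable borel"
    by (intro borel_measurable_weight C_int C_pos tau_pos; assumption)+
  show "ray_kernel_pair \<epsilon> v\<^sub>0 v\<^sub>1 (vel \<nu>) (vel \<nu>\<^sub>s) (weight C \<tau>) (weight C \<tau>\<^sub>s) (2 / (\<epsilon> * \<tau>\<^sub>0))"
    by unfold_locales (use eps_pos v0_pos w b m wm vel_meas v_le tau0_pos in \<open>auto\<close>)
qed

text \<open>
  The factor \<open>C \<omega>\<close> that each segment of a characteristic contributes is what turns the average
  \<open>\<langle>\<cdot> / \<tau>\<rangle>\<close> into an average with total weight \<open>1\<close>, whatever the size of \<open>C\<close>.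
\<close>

lemma phase_avg_over_tau_le:
  fixes q :: "real \<Rightarrow> real \<Rightarrow> real"
  assumes \<sigma>: "\<sigma> = \<tau> \<or> \<sigma> = \<tau>\<^sub>s"
    and [measurable]: "case_prod Z \<in> borel_measurable (borel \<Otimes>\<^sub>M borel)" "case_prod R \<in> borel_measurable (borel \<Otimes>\<^sub>M borel)"
    and bd: "\<And>\<mu> \<omega>. -1 \<le> \<mu> \<Longrightarrow> \<mu> \<le> 1 \<Longrightarrow> \<omega> > 0 \<Longrightarrow>
      ennreal \<bar>q \<mu> \<omega>\<bar> \<le> Z \<mu> \<omega> + ennreal (\<kappa> * C \<omega>) * R \<mu> \<omega>"
  shows "phase_avg (indicator {0<..}) (\<lambda>\<mu> \<omega>. ennreal \<bar>q \<mu> \<omega> / \<sigma> \<omega>\<bar>) \<le>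
    ennreal (C_tau C \<sigma>) * (ennreal (1 / (\<tau>\<^sub>0 * C_tau C \<sigma>)) * phase_avg (indicator {0<..}) Z +
      ennreal \<kappa> * phase_avg (weight C \<sigma>) R)"
proof -
  have c: "C_tau C \<sigma> > 0" using \<sigma> C_tau_both_pos by auto
  have s: "\<tau>\<^sub>0 \<le> \<sigma> \<omega>" if "\<omega> > 0" for \<omega> using that \<sigma> tau_ge by auto
  have [measurable]: "weight C \<sigma> \<in> borel_measurable borel"
    using \<sigma> upper.w_meas lower.w_meas by auto
  let ?c = "C_tau C \<sigma>"
  have pt: "indicator {0<..} \<omega> * ennreal \<bar>q \<mu> \<omega> / \<sigma> \<omega>\<bar> \<le>
      indicator {0<..} \<omega> * (ennreal (1 / \<tau>\<^sub>0) * Z \<mu> \<omega>) + weight C \<sigma> \<omega> * (ennreal (?c * \<kappa>) * R \<mu> \<omega>)"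
    if \<mu>: "-1 \<le> \<mu>" "\<mu> \<le> 1" for \<mu> \<omega>
  proof (cases "\<omega> > 0")
    case True
    note s = s[OF True] and C = C_pos[OF True]
    have "ennreal \<bar>q \<mu> \<omega> / \<sigma> \<omega>\<bar> = ennreal (1 / \<sigma> \<omega>) * ennreal \<bar>q \<mu> \<omega>\<bar>"
      using s tau0_pos by (simp add: ennreal_mult[symmetric] abs_divide)
    also have "\<dots> \<le> ennreal (1 / \<sigma> \<omega>) * (Z \<mu> \<omega> + ennreal (\<kappa> * C \<omega>) * R \<mu> \<omega>)"
      by (intro mult_left_mono bd \<mu> True) auto
    also have "\<dots> = ennreal (1 / \<sigma> \<omega>) * Z \<mu> \<omega> + (ennreal (1 / \<sigma> \<omega>) * ennreal (\<kappa> * C \<omega>)) * R \<mu> \<omega>"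
      by (simp only: distrib_left mult.assoc)
    also have "ennreal (1 / \<sigma> \<omega>) * ennreal (\<kappa> * C \<omega>) = ennreal (C \<omega> / \<sigma> \<omega> / ?c) * ennreal (?c * \<kappa>)"
      using s tau0_pos C c eps_pos by (subst (1 2) ennreal_mult[symmetric]) auto
    also have "ennreal (1 / \<sigma> \<omega>) * Z \<mu> \<omega> + ennreal (C \<omega> / \<sigma> \<omega> / ?c) * ennreal (?c * \<kappa>) * R \<mu> \<omega> \<le>
        ennreal (1 / \<tau>\<^sub>0) * Z \<mu> \<omega> + ennreal (C \<omega> / \<sigma> \<omega> / ?c) * ennreal (?c * \<kappa>) * R \<mu> \<omega>"
      using s tau0_pos by (intro add_right_mono mult_right_mono ennreal_leI divide_left_mono) auto
    finally show ?thesis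
      using True by (simp add: weight_def mult.assoc)
  qed simp
  have "phase_avg (indicator {0<..}) (\<lambda>\<mu> \<omega>. ennreal \<bar>q \<mu> \<omega> / \<sigma> \<omega>\<bar>) \<le>
      phase_avg (\<lambda>_. 1) (\<lambda>\<mu> \<omega>. indicator {0<..} \<omega> * (ennreal (1 / \<tau>\<^sub>0) * Z \<mu> \<omega>) + weight C \<sigma> \<omega> * (ennreal (?c * \<kappa>) * R \<mu> \<omega>))"
    using pt by (intro phase_avg_mono) simp
  also have "\<dots> = phase_avg (\<lambda>_. 1) (\<lambda>\<mu> \<omega>. indicator {0<..} \<omega> * (ennreal (1 / \<tau>\<^sub>0) * Z \<mu> \<omega>)) +
      phase_avg (\<lambda>_. 1) (\<lambda>\<mu> \<omega>. weight C \<sigma> \<omega> * (ennreal (?c * \<kappa>) * R \<mu> \<omega>))"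
    by (intro phase_avg_add) measurable
  also have "\<dots> = phase_avg (indicator {0<..}) (\<lambda>\<mu> \<omega>. ennreal (1 / \<tau>\<^sub>0) * Z \<mu> \<omega>) +
      phase_avg (weight C \<sigma>) (\<lambda>\<mu> \<omega>. ennreal (?c * \<kappa>) * R \<mu> \<omega>)"
    by (simp add: phase_avg_def)
  also have "\<dots> = ennreal (1 / \<tau>\<^sub>0) * phase_avg (indicator {0<..}) Z + ennreal (?c * \<kappa>) * phase_avg (weight C \<sigma>) R"
    by (subst (1 2) phase_avg_cmult) auto
  also have "ennreal (1 / \<tau>\<^sub>0) = ennreal ?c * ennreal (1 / (\<tau>\<^sub>0 * ?c))"
    using c tau0_pos by (subst ennreal_mult[symmetric]) auto
  also have "ennreal (?c * \<kappa>) = ennreal ?c * ennreal \<kappa>"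
    using c tau0_pos eps_pos by (subst ennreal_mult[symmetric]) auto
  finally show ?thesis by (simp only: distrib_left mult.assoc)
qed

lemma Delta_T_abs_le:
  assumes \<sigma>: "\<sigma> = \<tau> \<or> \<sigma> = \<tau>\<^sub>s"
    and "case_prod Z \<in> borel_measurable (borel \<Otimes>\<^sub>M borel)" "case_prod R \<in> borel_measurable (borel \<Otimes>\<^sub>M borel)"
    and "\<And>\<mu> \<omega>. -1 \<le> \<mu> \<Longrightarrow> \<mu> \<le> 1 \<Longrightarrow> \<omega> > 0 \<Longrightarrow>
      ennreal \<bar>h t x \<mu> \<omega>\<bar> \<le> Z \<mu> \<omega> + ennreal (\<kappa> * C \<omega>) * R \<mu> \<omega>"
  shows "ennreal \<bar>Delta_T C \<sigma> h t x\<bar> \<le> ennreal (1 / (\<tau>\<^sub>0 * C_tau C \<sigma>)) * phase_avg (indicator {0<..}) Z +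
      ennreal \<kappa> * phase_avg (weight C \<sigma>) R"
    (is "_ \<le> ?B")
proof -
  have c: "C_tau C \<sigma> > 0" using \<sigma> C_tau_both_pos by auto
  have "ennreal \<bar>Delta_T C \<sigma> h t x\<bar> = ennreal (1 / C_tau C \<sigma>) * ennreal \<bar>phonon_avg (\<lambda>\<mu> \<omega>. h t x \<mu> \<omega> / \<sigma> \<omega>)\<bar>"
    using c by (simp add: Delta_T_def abs_divide ennreal_mult[symmetric])
  also have "\<dots> \<le> ennreal (1 / C_tau C \<sigma>) * (ennreal (C_tau C \<sigma>) * ?B)"
    by (intro mult_left_mono order_trans[OF phonon_avg_abs_le] phase_avg_over_tau_le assms) auto
  also have "\<dots> = (ennreal (1 / C_tau C \<sigma>) * ennreal (C_tau C \<sigma>)) * ?B"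
    by (simp only: mult.assoc)
  also have "ennreal (1 / C_tau C \<sigma>) * ennreal (C_tau C \<sigma>) = 1"
    using c by (subst ennreal_mult[symmetric]) auto
  finally show ?thesis by simp
qed

end

section \<open>Representation of a coupled solution\<close>

lemma ennreal_abs_triangle3:
  assumes "\<bar>d\<bar> \<le> \<bar>a\<bar> + \<bar>b\<bar> + \<bar>c\<bar>"
    and "ennreal \<bar>a\<bar> \<le> K * A" "ennreal \<bar>b\<bar> \<le> K * B" "ennreal \<bar>c\<bar> \<le> K * D"
  shows "ennreal \<bar>d\<bar> \<le> K * (A + B + D)"
proof -
  have "ennreal \<bar>d\<bar> \<le> ennreal (\<bar>a\<bar> + \<bar>b\<bar> + \<bar>c\<bar>)"
    by (intro ennreal_leI assms)
  also have "\<dots> = ennreal \<bar>a\<bar> + ennreal \<bar>b\<bar> + ennreal \<bar>c\<bar>"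
    by simp
  also have "\<dots> \<le> K * A + K * B + K * D"
    by (intro add_mono assms)
  finally show ?thesis by (simp only: distrib_left)
qed

lemma abs_mult_le_unit: "\<bar>e\<bar> \<le> 1 \<Longrightarrow> \<bar>e * y\<bar> \<le> \<bar>y\<bar>" for e y :: real
  by (simp add: abs_mult mult_left_le_one_le)

lemma abs_le_add_ennreal:
  assumes "ennreal \<bar>a - b\<bar> \<le> R" "ennreal \<bar>b\<bar> \<le> Z"
  shows "ennreal \<bar>a\<bar> \<le> Z + R"
proof -
  have "ennreal \<bar>a\<bar> \<le> ennreal (\<bar>b\<bar> + \<bar>a - b\<bar>)"
    by (intro ennreal_leI) linarith
  also have "\<dots> \<le> Z + R"
    using assms by (simp add: add_mono)
  finally show ?thesis .
qed

locale coupled_run = two_media +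
  fixes L T \<theta> H \<mu>\<^sub>0 \<omega>\<^sub>0 :: real and \<eta> :: "real \<Rightarrow> real"
    and \<phi> :: "real \<Rightarrow> real \<Rightarrow> real \<Rightarrow> real" and f g :: phase_fun
  assumes L_pos: "L > 0" and T_pos: "T > 0" and theta_pos: "\<theta> > 0" and H_nonneg: "H \<ge> 0"
    and sol: "coupled_solution C L \<epsilon> \<nu> \<tau> \<nu>\<^sub>s \<tau>\<^sub>s \<eta> \<phi> f g"
    and unit: "interface_coeffs_in_unit \<nu> \<nu>\<^sub>s \<eta>"
    and src: "\<And>t \<mu> \<omega>. \<bar>\<phi> t \<mu> \<omega>\<bar> \<le>
      H * indicator {-\<theta>..\<theta>} t * indicator {\<mu>\<^sub>0 - \<theta>..\<mu>\<^sub>0 + \<theta>} \<mu> * indicator {\<omega>\<^sub>0 - \<theta>..\<omega>\<^sub>0 + \<theta>} \<omega>"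
begin

text \<open>
  The absolute temperatures of both layers in one function on the line. It is cut off at \<open>T\<close> because
  integrability is available on bounded time intervals only.
\<close>

definition field :: "real \<Rightarrow> real \<Rightarrow> ennreal" where
  "field t x = indicator {0..T} t * indicator {0..1} x * ennreal \<bar>Delta_T C \<tau> f t x\<bar> +
     indicator {0..T} t * indicator {1..1 + L} x * ennreal \<bar>Delta_T C \<tau>\<^sub>s g t x\<bar>"

lemmas sol_unfolded = sol[unfolded coupled_solution_def]

lemma transport: "solves_transport C \<epsilon> \<nu> \<tau> 0 1 f" "solves_transport C \<epsilon> \<nu>\<^sub>s \<tau>\<^sub>s 1 (1 + L) g"
  by (rule sol_unfolded[THEN conjunct1]) (rule sol_unfolded[THEN conjunct2, THEN conjunct1])

lemma initial:
  shows "x \<in> {0..1} \<Longrightarrow> \<mu> \<in> {-1..1} \<Longrightarrow> \<omega> > 0 \<Longrightarrow> f 0 x \<mu> \<omega> = 0"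
    and "x \<in> {1..1 + L} \<Longrightarrow> \<mu> \<in> {-1..1} \<Longrightarrow> \<omega> > 0 \<Longrightarrow> g 0 x \<mu> \<omega> = 0"
  by (rule sol_unfolded[THEN conjunct2, THEN conjunct2, THEN conjunct1, rule_format]; assumption)
    (rule sol_unfolded[THEN conjunct2, THEN conjunct2, THEN conjunct2, THEN conjunct1, rule_format]; assumption)

lemma boundary:
  shows "t > 0 \<Longrightarrow> \<mu> \<in> {0<..1} \<Longrightarrow> \<omega> > 0 \<Longrightarrow> f t 0 \<mu> \<omega> = \<phi> t \<mu> \<omega>"
    and "t > 0 \<Longrightarrow> \<mu> \<in> {-1..<0} \<Longrightarrow> \<omega> > 0 \<Longrightarrow> g t (1 + L) \<mu> \<omega> = 0"
  by (rule sol_unfolded[THEN conjunct2, THEN conjunct2, THEN conjunct2, THEN conjunct2, THEN conjunct1, rule_format]; assumption)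
    (rule sol_unfolded[THEN conjunct2, THEN conjunct2, THEN conjunct2, THEN conjunct2, THEN conjunct2, THEN conjunct2, THEN conjunct2, rule_format]; assumption)

lemma interface:
  shows "t > 0 \<Longrightarrow> \<mu> \<in> {-1..<0} \<Longrightarrow> \<omega> > 0 \<Longrightarrow>
      f t 1 \<mu> \<omega> = \<eta> \<omega> * f t 1 (- \<mu>) \<omega> + zeta \<eta> \<omega> * g t 1 \<mu> \<omega>"
    and "t > 0 \<Longrightarrow> \<mu> \<in> {0<..1} \<Longrightarrow> \<omega> > 0 \<Longrightarrow>
      g t 1 \<mu> \<omega> = eta_s \<nu> \<nu>\<^sub>s \<eta> \<omega> * g t 1 (- \<mu>) \<omega> + zeta_s \<nu> \<nu>\<^sub>s \<eta> \<omega> * f t 1 \<mu> \<omega>"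
  by (rule sol_unfolded[THEN conjunct2, THEN conjunct2, THEN conjunct2, THEN conjunct2, THEN conjunct2, THEN conjunct1, rule_format]; assumption)
    (rule sol_unfolded[THEN conjunct2, THEN conjunct2, THEN conjunct2, THEN conjunct2, THEN conjunct2, THEN conjunct2, THEN conjunct1, rule_format]; assumption)

lemma flux_integrable:
  "set_integrable lborel ({0..T} \<times> {0..1} \<times> {-1..1} \<times> {0<..}) (\<lambda>(t, x, \<mu>, \<omega>). f t x \<mu> \<omega> / \<tau> \<omega>)"
  "set_integrable lborel ({0..T} \<times> {1..1 + L} \<times> {-1..1} \<times> {0<..}) (\<lambda>(t, x, \<mu>, \<omega>). g t x \<mu> \<omega> / \<tau>\<^sub>s \<omega>)"
  by (rule transport(1)[unfolded solves_transport_def, THEN conjunct1, rule_format, OF T_pos])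
    (rule transport(2)[unfolded solves_transport_def, THEN conjunct1, rule_format, OF T_pos])

lemma field_meas [measurable]: "case_prod field \<in> borel_measurable (borel \<Otimes>\<^sub>M borel)"
proof -
  note [measurable] = borel_measurable_Delta_T[OF flux_integrable(1), of C] borel_measurable_Delta_T[OF flux_integrable(2), of C]
  have "case_prod field = (\<lambda>z.
      ennreal \<bar>(\<lambda>(t, x). indicator {0..T} t * indicator {0..1} x * Delta_T C \<tau> f t x) z\<bar> +
      ennreal \<bar>(\<lambda>(t, x). indicator {0..T} t * indicator {1..1 + L} x * Delta_T C \<tau>\<^sub>s g t x) z\<bar>)"
    by (auto simp: field_def fun_eq_iff indicator_def)
  also have "\<dots> \<in> borel_measurable (borel \<Otimes>\<^sub>M borel)"
    by measurable
  finally show ?thesis .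
qed

lemma field_finite: "(\<integral>\<^sup>+t\<in>{0..T}. (\<integral>\<^sup>+x. field t x \<partial>lborel) \<partial>lborel) < \<infinity>"
proof -
  let ?a = "\<lambda>t x. indicator {0..T} t * indicator {0..1} x * ennreal \<bar>Delta_T C \<tau> f t x\<bar>"
  let ?b = "\<lambda>t x. indicator {0..T} t * indicator {1..1 + L} x * ennreal \<bar>Delta_T C \<tau>\<^sub>s g t x\<bar>"
  note m [measurable] = borel_measurable_Delta_T[OF flux_integrable(1), of C] borel_measurable_Delta_T[OF flux_integrable(2), of C]
  have eq: "case_prod ?a = (\<lambda>z. ennreal \<bar>(\<lambda>(t, x). indicator {0..T} t * indicator {0..1} x * Delta_T C \<tau> f t x) z\<bar>)"
    "case_prod ?b = (\<lambda>z. ennreal \<bar>(\<lambda>(t, x). indicator {0..T} t * indicator {1..1 + L} x * Delta_T C \<tau>\<^sub>s g t x) z\<bar>)"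
    by (auto simp: fun_eq_iff indicator_def)
  have am: "case_prod ?a \<in> borel_measurable (borel \<Otimes>\<^sub>M borel)" unfolding eq by measurable
  have bm: "case_prod ?b \<in> borel_measurable (borel \<Otimes>\<^sub>M borel)" unfolding eq by measurable
  note [measurable] = am bm
  have [measurable]: "?a t \<in> borel_measurable lborel" "?b t \<in> borel_measurable lborel" for t
    using measurable_compose[of "\<lambda>y. (t, y)" borel "borel \<Otimes>\<^sub>M borel" "case_prod ?a" borel, OF _ am]
      measurable_compose[of "\<lambda>y. (t, y)" borel "borel \<Otimes>\<^sub>M borel" "case_prod ?b" borel, OF _ bm] by simp_all
  have "(\<integral>\<^sup>+t\<in>{0..T}. (\<integral>\<^sup>+x. field t x \<partial>lborel) \<partial>lborel) \<le> (\<integral>\<^sup>+t. (\<integral>\<^sup>+x. ?a t x + ?b t x \<partial>lborel) \<partial>lborel)"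
    unfolding field_def by (intro nn_integral_mono) (auto simp: indicator_def)
  also have "\<dots> = (\<integral>\<^sup>+t. (\<integral>\<^sup>+x. ?a t x \<partial>lborel) + (\<integral>\<^sup>+x. ?b t x \<partial>lborel) \<partial>lborel)"
    by (intro nn_integral_cong nn_integral_add) measurable
  also have "\<dots> = (\<integral>\<^sup>+t. (\<integral>\<^sup>+x. ?a t x \<partial>lborel) \<partial>lborel) + (\<integral>\<^sup>+t. (\<integral>\<^sup>+x. ?b t x \<partial>lborel) \<partial>lborel)"
    by (intro nn_integral_add) measurable
  also have "\<dots> < \<infinity>"
    using nn_integral_Delta_T_finite[OF flux_integrable(1) C_tau_both_pos(1)]
      nn_integral_Delta_T_finite[OF flux_integrable(2) C_tau_both_pos(2)] by simp
  finally show ?thesis .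
qed

abbreviation (input) "P \<equiv> path_int \<epsilon> field"

lemma segment_f:
  assumes "0 \<le> x" "x \<le> 1" "-1 \<le> \<mu>" "\<mu> \<le> 1" "\<omega> > 0" "t \<le> T" "0 \<le> s" "\<epsilon> * s \<le> t"
    and "0 \<le> x - \<mu> * \<nu> \<omega> * s" "x - \<mu> * \<nu> \<omega> * s \<le> 1"
  shows "ennreal \<bar>f t x \<mu> \<omega> - exp (- s / (\<epsilon> * \<tau> \<omega>)) * f (t - \<epsilon> * s) (x - \<mu> * \<nu> \<omega> * s) \<mu> \<omega>\<bar>
    \<le> ennreal (\<kappa> * C \<omega>) * P t x (\<mu> * (- \<nu> \<omega>))"
  by (rule transport_segment[OF transport(1) eps_pos _ tau0_pos])
    (use assms in \<open>auto simp: tau_ge C_pos field_def add_increasing2\<close>)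

lemma segment_g:
  assumes "1 \<le> x" "x \<le> 1 + L" "-1 \<le> \<mu>" "\<mu> \<le> 1" "\<omega> > 0" "t \<le> T" "0 \<le> s" "\<epsilon> * s \<le> t"
    and "1 \<le> x - \<mu> * \<nu>\<^sub>s \<omega> * s" "x - \<mu> * \<nu>\<^sub>s \<omega> * s \<le> 1 + L"
  shows "ennreal \<bar>g t x \<mu> \<omega> - exp (- s / (\<epsilon> * \<tau>\<^sub>s \<omega>)) * g (t - \<epsilon> * s) (x - \<mu> * \<nu>\<^sub>s \<omega> * s) \<mu> \<omega>\<bar>
    \<le> ennreal (\<kappa> * C \<omega>) * P t x (\<mu> * (- \<nu>\<^sub>s \<omega>))"
  by (rule transport_segment[OF transport(2) eps_pos _ tau0_pos])
    (use assms in \<open>auto simp: tau_ge C_pos field_def add_increasing\<close>)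

lemma path_shift: "0 \<le> s \<Longrightarrow> P (t - \<epsilon> * s) y k \<le> P t (y - k * s) k"
  by (rule path_int_shift[OF field_meas eps_pos])

text \<open>
  The ballistic part in the transducer for \<open>\<mu> > 0\<close>. For short times the backward characteristic meets
  the zero initial data instead of the boundary.
\<close>

definition incoming :: phase_fun where
  "incoming t x \<mu> \<omega> = (let s = x / (\<mu> * \<nu> \<omega>) in
     if \<epsilon> * s < t then exp (- s / (\<epsilon> * \<tau> \<omega>)) * \<phi> (t - \<epsilon> * s) \<mu> \<omega> else 0)"

text \<open>
  The ballistic part in the transducer for \<open>\<mu> < 0\<close>: the source with direction \<open>- \<mu>\<close>, reflected at
  \<open>x = 1\<close>. The path has length \<open>2 - x\<close>.
\<close>

definition reflected :: phase_fun where
  "reflected t x \<mu> \<omega> = (let s = (2 - x) / (- \<mu> * \<nu> \<omega>) in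
     if \<epsilon> * s < t then \<eta> \<omega> * exp (- s / (\<epsilon> * \<tau> \<omega>)) * \<phi> (t - \<epsilon> * s) (- \<mu>) \<omega> else 0)"

text \<open>
  An upper bound, without damping, for the ballistic part in the substrate for \<open>\<mu> > 0\<close>; the travel
  time is the sum over the two layers.
\<close>

definition transmitted :: phase_fun where
  "transmitted t x \<mu> \<omega> = (let s = (x - 1) / (\<mu> * \<nu>\<^sub>s \<omega>) + 1 / (\<mu> * \<nu> \<omega>) in
     if \<epsilon> * s < t then \<phi> (t - \<epsilon> * s) \<mu> \<omega> else 0)"

lemma f_incoming:
  assumes t: "0 \<le> t" "t \<le> T" and x: "0 \<le> x" "x \<le> 1" and \<mu>: "0 < \<mu>" "\<mu> \<le> 1" and \<omega>: "\<omega> > 0"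
  shows "ennreal \<bar>f t x \<mu> \<omega> - incoming t x \<mu> \<omega>\<bar> \<le> ennreal (\<kappa> * C \<omega>) * P t x (\<mu> * (- \<nu> \<omega>))"
proof -
  define s where "s = x / (\<mu> * \<nu> \<omega>)"
  have k: "\<mu> * \<nu> \<omega> > 0" using \<mu> nu_pos[OF \<omega>] by simp
  have s: "0 \<le> s" "\<mu> * \<nu> \<omega> * s = x" using x k by (auto simp: s_def)
  show ?thesis
  proof (cases "\<epsilon> * s < t")
    case True
    then show ?thesis
      using segment_f[of x \<mu> \<omega> t s] boundary(1)[of "t - \<epsilon> * s" \<mu> \<omega>] t x \<mu> \<omega> s
      by (simp add: incoming_def s_def[symmetric])
  next
    case False
    define r where "r = t / \<epsilon>"
    have r: "0 \<le> r" "\<epsilon> * r = t" using t eps_pos by (auto simp: r_def)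
    have "r \<le> s" using False r eps_pos by (simp add: r_def field_simps)
    then have "\<mu> * \<nu> \<omega> * r \<le> x" "0 \<le> \<mu> * \<nu> \<omega> * r"
      using mult_left_mono[of r s "\<mu> * \<nu> \<omega>"] k s r by auto
    then show ?thesis
      using segment_f[of x \<mu> \<omega> t r] initial(1)[of "x - \<mu> * \<nu> \<omega> * r" \<mu> \<omega>] t x \<mu> \<omega> r False
      by (simp add: incoming_def s_def[symmetric])
  qed
qed

text \<open>
  Nothing enters at the far end of the substrate, so there is no ballistic part: what moves back
  towards the interface has been scattered.
\<close>

lemma g_incoming:
  assumes t: "0 \<le> t" "t \<le> T" and x: "1 \<le> x" "x \<le> 1 + L" and \<mu>: "-1 \<le> \<mu>" "\<mu> < 0" and \<omega>: "\<omega> > 0"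
  shows "ennreal \<bar>g t x \<mu> \<omega>\<bar> \<le> ennreal (\<kappa> * C \<omega>) * P t x (\<mu> * (- \<nu>\<^sub>s \<omega>))"
proof -
  define k where "k = - (\<mu> * \<nu>\<^sub>s \<omega>)"
  define s where "s = (1 + L - x) / k"
  have k: "k > 0" using \<mu> nu_pos[OF \<omega>] by (simp add: k_def mult_neg_pos)
  have s: "0 \<le> s" "k * s = 1 + L - x" using x k by (auto simp: s_def)
  show ?thesis
  proof (cases "\<epsilon> * s < t")
    case True
    have "x - \<mu> * \<nu>\<^sub>s \<omega> * s = 1 + L" using s(2) by (simp add: k_def)
    then show ?thesis
      using segment_g[of x \<mu> \<omega> t s] boundary(2)[of "t - \<epsilon> * s" \<mu> \<omega>] t x \<mu> \<omega> s True L_pos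
      by simp
  next
    case False
    define r where "r = t / \<epsilon>"
    have r: "0 \<le> r" "\<epsilon> * r = t" using t eps_pos by (auto simp: r_def)
    have "r \<le> s" using False r eps_pos by (simp add: r_def field_simps)
    then have "k * r \<le> 1 + L - x" "0 \<le> k * r"
      using mult_left_mono[of r s k] k s r by auto
    then have "1 \<le> x - \<mu> * \<nu>\<^sub>s \<omega> * r" "x - \<mu> * \<nu>\<^sub>s \<omega> * r \<le> 1 + L"
      using x by (auto simp: k_def)
    then show ?thesis
      using segment_g[of x \<mu> \<omega> t r] initial(2)[of "x - \<mu> * \<nu>\<^sub>s \<omega> * r" \<mu> \<omega>] t x \<mu> \<omega> r
      by simp
  qed
qed

lemma unit_coeffs:
  assumes "\<omega> > 0"
  shows "\<eta> \<omega> \<in> {0..1}" "zeta \<eta> \<omega> \<in> {0..1}" "zeta_s \<nu> \<nu>\<^sub>s \<eta> \<omega> \<in> {0..1}" "eta_s \<nu> \<nu>\<^sub>s \<eta> \<omega> \<in> {0..1}"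
  using unit assms unfolding interface_coeffs_in_unit_def by auto

text \<open>
  One segment back to the interface, where the interface condition gives the values for \<open>- \<mu>\<close> in the
  transducer and for \<open>\<mu>\<close> in the substrate. Both are traced back by one more segment to boundaries with
  prescribed data. As the coefficients and the damping are at most \<open>1\<close>, the errors add up.
\<close>

lemma f_reflected:
  assumes t: "0 \<le> t" "t \<le> T" and x: "0 \<le> x" "x \<le> 1" and \<mu>: "-1 \<le> \<mu>" "\<mu> < 0" and \<omega>: "\<omega> > 0"
  shows "ennreal \<bar>f t x \<mu> \<omega> - reflected t x \<mu> \<omega>\<bar> \<le> ennreal (\<kappa> * C \<omega>) * ray_sum \<epsilon> \<nu> \<nu>\<^sub>s field t x \<mu> \<omega>"
proof -
  define k where "k = - \<mu> * \<nu> \<omega>"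
  define s where "s = (1 - x) / k"
  have k: "k > 0" using \<mu> nu_pos[OF \<omega>] by (simp add: k_def mult_neg_pos)
  have s: "0 \<le> s" "k * s = 1 - x" using x k by (auto simp: s_def)
  have s2: "s + 1 / k = (2 - x) / k" by (simp add: s_def add_divide_distrib[symmetric])
  let ?K = "ennreal (\<kappa> * C \<omega>)"
  note u = unit_coeffs[OF \<omega>]
  have refl: "reflected t x \<mu> \<omega> = (if \<epsilon> * (s + 1 / k) < t then
      \<eta> \<omega> * exp (- (s + 1 / k) / (\<epsilon> * \<tau> \<omega>)) * \<phi> (t - \<epsilon> * (s + 1 / k)) (- \<mu>) \<omega> else 0)"
    unfolding reflected_def Let_def k_def[symmetric] s2 ..
  show ?thesis
  proof (cases "\<epsilon> * s < t")
    case True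
    define t' where "t' = t - \<epsilon> * s"
    have t': "0 < t'" "t' \<le> T" using True t s eps_pos by (auto simp: t'_def intro: order_trans[of _ t])
    define e where "e = exp (- s / (\<epsilon> * \<tau> \<omega>))"
    have e: "0 \<le> e" "e \<le> 1" using s eps_pos tau_pos[OF \<omega>] by (auto simp: e_def)
    have xs: "x - \<mu> * \<nu> \<omega> * s = 1" using s(2) by (simp add: k_def)
    \<comment> \<open>The three errors match the three paths of \<open>ray_sum\<close>: direct, reflected, transmitted.\<close>
    have 1: "ennreal \<bar>f t x \<mu> \<omega> - e * f t' 1 \<mu> \<omega>\<bar> \<le> ?K * P t x (\<mu> * (- \<nu> \<omega>))"
      using segment_f[of x \<mu> \<omega> t s] t x \<mu> \<omega> s True unfolding xs by (simp add: e_def t'_def)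
    have "ennreal \<bar>f t' 1 (- \<mu>) \<omega> - incoming t' 1 (- \<mu>) \<omega>\<bar> \<le> ?K * P t' 1 ((- \<mu>) * (- \<nu> \<omega>))"
      using t' \<mu> \<omega> by (intro f_incoming) auto
    also have "\<dots> \<le> ?K * P t (1 - ((- \<mu>) * (- \<nu> \<omega>)) * s) ((- \<mu>) * (- \<nu> \<omega>))"
      unfolding t'_def by (intro mult_left_mono path_shift s) auto
    also have "1 - ((- \<mu>) * (- \<nu> \<omega>)) * s = 2 - x" using s(2) by (simp add: k_def)
    finally have 2: "ennreal \<bar>f t' 1 (- \<mu>) \<omega> - incoming t' 1 (- \<mu>) \<omega>\<bar> \<le> ?K * P t (2 - x) (\<mu> * \<nu> \<omega>)"
      by simp
    have "ennreal \<bar>g t' 1 \<mu> \<omega>\<bar> \<le> ?K * P t' 1 (\<mu> * (- \<nu>\<^sub>s \<omega>))"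
      using t' \<mu> \<omega> L_pos by (intro g_incoming) auto
    also have "\<dots> \<le> ?K * P t (1 - (\<mu> * (- \<nu>\<^sub>s \<omega>)) * s) (\<mu> * (- \<nu>\<^sub>s \<omega>))"
      unfolding t'_def by (intro mult_left_mono path_shift s) auto
    also have "1 - (\<mu> * (- \<nu>\<^sub>s \<omega>)) * s = 1 - \<nu>\<^sub>s \<omega> / \<nu> \<omega> * (1 - x)"
      using \<mu> nu_pos[OF \<omega>] by (simp add: s_def k_def)
    finally have 3: "ennreal \<bar>g t' 1 \<mu> \<omega>\<bar> \<le> ?K * P t (1 - \<nu>\<^sub>s \<omega> / \<nu> \<omega> * (1 - x)) (\<mu> * (- \<nu>\<^sub>s \<omega>))" .
    have refl': "reflected t x \<mu> \<omega> = e * (\<eta> \<omega> * incoming t' 1 (- \<mu>) \<omega>)"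
    proof -
      have "\<epsilon> * (s + 1 / k) < t \<longleftrightarrow> \<epsilon> * (1 / k) < t'" by (simp add: t'_def algebra_simps)
      moreover have "t - \<epsilon> * (s + 1 / k) = t' - \<epsilon> * (1 / k)" by (simp add: t'_def algebra_simps)
      moreover have "exp (- (s + 1 / k) / (\<epsilon> * \<tau> \<omega>)) = e * exp (- (1 / k) / (\<epsilon> * \<tau> \<omega>))"
        by (simp add: e_def exp_add[symmetric] diff_divide_distrib)
      ultimately show ?thesis
        unfolding refl incoming_def Let_def k_def[symmetric] by simp
    qed
    have f1: "f t' 1 \<mu> \<omega> = \<eta> \<omega> * f t' 1 (- \<mu>) \<omega> + zeta \<eta> \<omega> * g t' 1 \<mu> \<omega>"
      using t' \<mu> \<omega> by (intro interface) auto
    have "f t x \<mu> \<omega> - reflected t x \<mu> \<omega> = (f t x \<mu> \<omega> - e * f t' 1 \<mu> \<omega>) +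
        (e * \<eta> \<omega>) * (f t' 1 (- \<mu>) \<omega> - incoming t' 1 (- \<mu>) \<omega>) + (e * zeta \<eta> \<omega>) * g t' 1 \<mu> \<omega>"
      unfolding refl' f1 by (simp add: algebra_simps)
    moreover have "\<bar>(e * \<eta> \<omega>) * (f t' 1 (- \<mu>) \<omega> - incoming t' 1 (- \<mu>) \<omega>)\<bar> \<le> \<bar>f t' 1 (- \<mu>) \<omega> - incoming t' 1 (- \<mu>) \<omega>\<bar>"
      using e u by (intro abs_mult_le_unit) (auto simp: mult_le_one)
    moreover have "\<bar>(e * zeta \<eta> \<omega>) * g t' 1 \<mu> \<omega>\<bar> \<le> \<bar>g t' 1 \<mu> \<omega>\<bar>"
      using e u by (intro abs_mult_le_unit) (auto simp: mult_le_one)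
    ultimately have "\<bar>f t x \<mu> \<omega> - reflected t x \<mu> \<omega>\<bar> \<le> \<bar>f t x \<mu> \<omega> - e * f t' 1 \<mu> \<omega>\<bar> +
       \<bar>f t' 1 (- \<mu>) \<omega> - incoming t' 1 (- \<mu>) \<omega>\<bar> + \<bar>g t' 1 \<mu> \<omega>\<bar>"
      by linarith
    from ennreal_abs_triangle3[OF this 1 2 3] show ?thesis
      unfolding ray_sum_def .
  next
    case False
    define r where "r = t / \<epsilon>"
    have r: "0 \<le> r" "\<epsilon> * r = t" using t eps_pos by (auto simp: r_def)
    have "r \<le> s" using False r eps_pos by (simp add: r_def field_simps)
    then have "k * r \<le> 1 - x" "0 \<le> k * r"
      using mult_left_mono[of r s k] k s r by auto
    then have "0 \<le> x - \<mu> * \<nu> \<omega> * r" "x - \<mu> * \<nu> \<omega> * r \<le> 1"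
      using x by (auto simp: k_def)
    then have "ennreal \<bar>f t x \<mu> \<omega>\<bar> \<le> ?K * P t x (\<mu> * (- \<nu> \<omega>))"
      using segment_f[of x \<mu> \<omega> t r] initial(1)[of "x - \<mu> * \<nu> \<omega> * r" \<mu> \<omega>] t x \<mu> \<omega> r
      by simp
    also have "\<dots> \<le> ?K * ray_sum \<epsilon> \<nu> \<nu>\<^sub>s field t x \<mu> \<omega>"
      unfolding ray_sum_def by (intro mult_left_mono) (auto simp: add.assoc)
    finally have "ennreal \<bar>f t x \<mu> \<omega>\<bar> \<le> ?K * ray_sum \<epsilon> \<nu> \<nu>\<^sub>s field t x \<mu> \<omega>" .
    moreover have "reflected t x \<mu> \<omega> = 0"
    proof -
      have "0 \<le> \<epsilon> * (1 / k)" using k eps_pos by simp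
      then show ?thesis unfolding refl using False by (auto simp: distrib_left)
    qed
    ultimately show ?thesis by simp
  qed
qed

text \<open>
  The same argument in the substrate. Only the trace of \<open>f\<close> is measured, so for \<open>g\<close> an upper bound of the
  ballistic part suffices.
\<close>

lemma g_transmitted:
  assumes t: "0 \<le> t" "t \<le> T" and x: "1 \<le> x" "x \<le> 1 + L" and \<mu>: "0 < \<mu>" "\<mu> \<le> 1" and \<omega>: "\<omega> > 0"
  shows "ennreal \<bar>g t x \<mu> \<omega>\<bar> \<le> ennreal \<bar>transmitted t x \<mu> \<omega>\<bar> +
    ennreal (\<kappa> * C \<omega>) * ray_sum \<epsilon> \<nu>\<^sub>s \<nu> field t x \<mu> \<omega>"
proof -
  define k where "k = \<mu> * \<nu>\<^sub>s \<omega>"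
  define s where "s = (x - 1) / k"
  have k: "k > 0" using \<mu> nu_pos[OF \<omega>] by (simp add: k_def)
  have s: "0 \<le> s" "k * s = x - 1" using x k by (auto simp: s_def)
  let ?K = "ennreal (\<kappa> * C \<omega>)"
  note u = unit_coeffs[OF \<omega>]
  show ?thesis
  proof (cases "\<epsilon> * s < t")
    case True
    define t' where "t' = t - \<epsilon> * s"
    have t': "0 < t'" "t' \<le> T" using True t s eps_pos by (auto simp: t'_def intro: order_trans[of _ t])
    define e where "e = exp (- s / (\<epsilon> * \<tau>\<^sub>s \<omega>))"
    have e: "0 \<le> e" "e \<le> 1" using s eps_pos tau_pos[OF \<omega>] by (auto simp: e_def)
    have xs: "x - \<mu> * \<nu>\<^sub>s \<omega> * s = 1" using s(2) by (simp add: k_def)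
    have 1: "ennreal \<bar>g t x \<mu> \<omega> - e * g t' 1 \<mu> \<omega>\<bar> \<le> ?K * P t x (\<mu> * (- \<nu>\<^sub>s \<omega>))"
      using segment_g[of x \<mu> \<omega> t s] t x \<mu> \<omega> s True L_pos unfolding xs by (simp add: e_def t'_def)
    have "ennreal \<bar>g t' 1 (- \<mu>) \<omega>\<bar> \<le> ?K * P t' 1 ((- \<mu>) * (- \<nu>\<^sub>s \<omega>))"
      using t' \<mu> \<omega> L_pos by (intro g_incoming) auto
    also have "\<dots> \<le> ?K * P t (1 - ((- \<mu>) * (- \<nu>\<^sub>s \<omega>)) * s) ((- \<mu>) * (- \<nu>\<^sub>s \<omega>))"
      unfolding t'_def by (intro mult_left_mono path_shift s) auto
    also have "1 - ((- \<mu>) * (- \<nu>\<^sub>s \<omega>)) * s = 2 - x" using s(2) by (simp add: k_def)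
    finally have 2: "ennreal \<bar>g t' 1 (- \<mu>) \<omega>\<bar> \<le> ?K * P t (2 - x) (\<mu> * \<nu>\<^sub>s \<omega>)"
      by simp
    have "ennreal \<bar>f t' 1 \<mu> \<omega> - incoming t' 1 \<mu> \<omega>\<bar> \<le> ?K * P t' 1 (\<mu> * (- \<nu> \<omega>))"
      using t' \<mu> \<omega> by (intro f_incoming) auto
    also have "\<dots> \<le> ?K * P t (1 - (\<mu> * (- \<nu> \<omega>)) * s) (\<mu> * (- \<nu> \<omega>))"
      unfolding t'_def by (intro mult_left_mono path_shift s) auto
    also have "1 - (\<mu> * (- \<nu> \<omega>)) * s = 1 - \<nu> \<omega> / \<nu>\<^sub>s \<omega> * (1 - x)"
      using \<mu> nu_pos[OF \<omega>] by (simp add: s_def k_def divide_simps) (simp add: algebra_simps)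
    finally have 3: "ennreal \<bar>f t' 1 \<mu> \<omega> - incoming t' 1 \<mu> \<omega>\<bar> \<le> ?K * P t (1 - \<nu> \<omega> / \<nu>\<^sub>s \<omega> * (1 - x)) (\<mu> * (- \<nu> \<omega>))" .
    have tr: "\<bar>incoming t' 1 \<mu> \<omega>\<bar> \<le> \<bar>transmitted t x \<mu> \<omega>\<bar>"
    proof -
      define r where "r = 1 / (\<mu> * \<nu> \<omega>)"
      have r: "r > 0" using \<mu> nu_pos[OF \<omega>] by (simp add: r_def)
      have "\<epsilon> * (s + r) < t \<longleftrightarrow> \<epsilon> * r < t'" by (simp add: t'_def algebra_simps)
      moreover have "t - \<epsilon> * (s + r) = t' - \<epsilon> * r" by (simp add: t'_def algebra_simps)
      moreover have "exp (- r / (\<epsilon> * \<tau> \<omega>)) \<le> 1" using r eps_pos tau_pos[OF \<omega>] by simp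
      ultimately show ?thesis
        unfolding incoming_def transmitted_def Let_def k_def[symmetric] s_def[symmetric] r_def[symmetric]
        using abs_mult_le_unit by auto
    qed
    have g1: "g t' 1 \<mu> \<omega> = eta_s \<nu> \<nu>\<^sub>s \<eta> \<omega> * g t' 1 (- \<mu>) \<omega> + zeta_s \<nu> \<nu>\<^sub>s \<eta> \<omega> * f t' 1 \<mu> \<omega>"
      using t' \<mu> \<omega> by (intro interface) auto
    define d where "d = g t x \<mu> \<omega> - (e * zeta_s \<nu> \<nu>\<^sub>s \<eta> \<omega>) * incoming t' 1 \<mu> \<omega>"
    have "d = (g t x \<mu> \<omega> - e * g t' 1 \<mu> \<omega>) + (e * eta_s \<nu> \<nu>\<^sub>s \<eta> \<omega>) * g t' 1 (- \<mu>) \<omega> +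
        (e * zeta_s \<nu> \<nu>\<^sub>s \<eta> \<omega>) * (f t' 1 \<mu> \<omega> - incoming t' 1 \<mu> \<omega>)"
      unfolding d_def g1 by (simp add: algebra_simps)
    moreover have "\<bar>(e * eta_s \<nu> \<nu>\<^sub>s \<eta> \<omega>) * g t' 1 (- \<mu>) \<omega>\<bar> \<le> \<bar>g t' 1 (- \<mu>) \<omega>\<bar>"
      using e u by (intro abs_mult_le_unit) (auto simp: mult_le_one)
    moreover have "\<bar>(e * zeta_s \<nu> \<nu>\<^sub>s \<eta> \<omega>) * (f t' 1 \<mu> \<omega> - incoming t' 1 \<mu> \<omega>)\<bar> \<le> \<bar>f t' 1 \<mu> \<omega> - incoming t' 1 \<mu> \<omega>\<bar>"
      using e u by (intro abs_mult_le_unit) (auto simp: mult_le_one)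
    ultimately have "\<bar>d\<bar> \<le> \<bar>g t x \<mu> \<omega> - e * g t' 1 \<mu> \<omega>\<bar> + \<bar>g t' 1 (- \<mu>) \<omega>\<bar> + \<bar>f t' 1 \<mu> \<omega> - incoming t' 1 \<mu> \<omega>\<bar>"
      by linarith
    from ennreal_abs_triangle3[OF this 1 2 3]
    have d: "ennreal \<bar>d\<bar> \<le> ?K * ray_sum \<epsilon> \<nu>\<^sub>s \<nu> field t x \<mu> \<omega>"
      unfolding ray_sum_def .
    have "\<bar>(e * zeta_s \<nu> \<nu>\<^sub>s \<eta> \<omega>) * incoming t' 1 \<mu> \<omega>\<bar> \<le> \<bar>incoming t' 1 \<mu> \<omega>\<bar>"
      using e u by (intro abs_mult_le_unit) (auto simp: mult_le_one)
    then have "\<bar>g t x \<mu> \<omega>\<bar> \<le> \<bar>transmitted t x \<mu> \<omega>\<bar> + \<bar>d\<bar>"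
      unfolding d_def using tr by linarith
    then have "ennreal \<bar>g t x \<mu> \<omega>\<bar> \<le> ennreal \<bar>transmitted t x \<mu> \<omega>\<bar> + ennreal \<bar>d\<bar>"
      by (subst ennreal_plus[symmetric]) (auto intro: ennreal_leI simp del: ennreal_plus)
    also have "\<dots> \<le> ennreal \<bar>transmitted t x \<mu> \<omega>\<bar> + ?K * ray_sum \<epsilon> \<nu>\<^sub>s \<nu> field t x \<mu> \<omega>"
      by (intro add_left_mono d)
    finally show ?thesis .
  next
    case False
    define r where "r = t / \<epsilon>"
    have r: "0 \<le> r" "\<epsilon> * r = t" using t eps_pos by (auto simp: r_def)
    have "r \<le> s" using False r eps_pos by (simp add: r_def field_simps)
    then have "k * r \<le> x - 1" "0 \<le> k * r"
      using mult_left_mono[of r s k] k s r by auto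
    then have "1 \<le> x - \<mu> * \<nu>\<^sub>s \<omega> * r" "x - \<mu> * \<nu>\<^sub>s \<omega> * r \<le> 1 + L"
      using x by (auto simp: k_def)
    then have "ennreal \<bar>g t x \<mu> \<omega>\<bar> \<le> ?K * P t x (\<mu> * (- \<nu>\<^sub>s \<omega>))"
      using segment_g[of x \<mu> \<omega> t r] initial(2)[of "x - \<mu> * \<nu>\<^sub>s \<omega> * r" \<mu> \<omega>] t x \<mu> \<omega> r
      by simp
    also have "\<dots> \<le> ?K * ray_sum \<epsilon> \<nu>\<^sub>s \<nu> field t x \<mu> \<omega>"
      unfolding ray_sum_def by (intro mult_left_mono) (auto simp: add.assoc)
    finally show ?thesis by (rule add_increasing[OF zero_le])
  qed
qed

lemma f_grazing:
  assumes t: "0 \<le> t" "t \<le> T" and x: "0 \<le> x" "x \<le> 1" and \<omega>: "\<omega> > 0"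
  shows "ennreal \<bar>f t x 0 \<omega>\<bar> \<le> ennreal (\<kappa> * C \<omega>) * P t x (0 * (- \<nu> \<omega>))"
proof -
  define r where "r = t / \<epsilon>"
  have r: "0 \<le> r" "\<epsilon> * r = t" using t eps_pos by (auto simp: r_def)
  then show ?thesis
    using segment_f[of x 0 \<omega> t r] initial(1)[of x 0 \<omega>] t x \<omega> by simp
qed

lemma g_grazing:
  assumes t: "0 \<le> t" "t \<le> T" and x: "1 \<le> x" "x \<le> 1 + L" and \<omega>: "\<omega> > 0"
  shows "ennreal \<bar>g t x 0 \<omega>\<bar> \<le> ennreal (\<kappa> * C \<omega>) * P t x (0 * (- \<nu>\<^sub>s \<omega>))"
proof -
  define r where "r = t / \<epsilon>"
  have r: "0 \<le> r" "\<epsilon> * r = t" using t eps_pos by (auto simp: r_def)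
  then show ?thesis
    using segment_g[of x 0 \<omega> t r] initial(2)[of x 0 \<omega>] t x \<omega> by simp
qed

end

section \<open>Bounds for the temperature\<close>

lemma nn_integral_indicator_affine:
  fixes \<sigma> :: real
  assumes "\<sigma> \<noteq> 0" "\<theta> \<ge> 0"
  shows "(\<integral>\<^sup>+x. indicator {-\<theta>..\<theta>} (p + \<sigma> * x) \<partial>lborel) = ennreal (2 * \<theta> / \<bar>\<sigma>\<bar>)"
proof -
  have "(\<integral>\<^sup>+x. indicator {-\<theta>..\<theta>} (p + \<sigma> * x) \<partial>lborel) = ennreal (1 / \<bar>\<sigma>\<bar>) * (\<integral>\<^sup>+y. indicator {-\<theta>..\<theta>} y \<partial>(lborel :: real measure))"
    by (rule nn_integral_affine) (use assms in auto)
  also have "\<dots> = ennreal (1 / \<bar>\<sigma>\<bar>) * ennreal (2 * \<theta>)"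
    using assms by simp
  also have "\<dots> = ennreal (2 * \<theta> / \<bar>\<sigma>\<bar>)"
    using assms by (subst ennreal_mult[symmetric]) auto
  finally show ?thesis .
qed

lemma ray_sum_vel:
  assumes "\<omega> > 0"
  shows "ray_sum \<epsilon> (vel u) (vel u') G t x \<mu> \<omega> = ray_sum \<epsilon> u u' G t x \<mu> \<omega>"
  using assms by (simp add: ray_sum_def)

lemma path_le_ray_sum: "path_int \<epsilon> G t x (\<mu> * (- v \<omega>)) \<le> ray_sum \<epsilon> v v' G t x \<mu> \<omega>"
  unfolding ray_sum_def by (simp add: add.assoc)

context two_media
begin

definition ballistic_factor :: real where
  "ballistic_factor = 1 / (\<tau>\<^sub>0 * C_tau C \<tau>) + 1 / (\<tau>\<^sub>0 * C_tau C \<tau>\<^sub>s)"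

lemma ballistic_factor_pos: "ballistic_factor > 0"
  using tau0_pos C_tau_both_pos by (auto simp: ballistic_factor_def intro!: add_pos_pos)

text \<open>
  The bounds of \<open>mass_bound\<close> and \<open>sup_bound\<close> at the final time. As they do not involve the
  reflection coefficient or the solution, they serve both runs at once.
\<close>

definition field_mass :: "real \<Rightarrow> real \<Rightarrow> real \<Rightarrow> real" where
  "field_mass H \<theta> T = 2 * (ballistic_factor * (48 * v\<^sub>1 / \<epsilon> * H * \<theta> ^ 3)) * exp (4 * \<kappa> * (2 + v\<^sub>1 / v\<^sub>0) / \<epsilon> * T)"

definition field_sup :: "real \<Rightarrow> real \<Rightarrow> real \<Rightarrow> real" where
  "field_sup H \<theta> T = 2 * (ballistic_factor * (24 * H * \<theta>\<^sup>2)) * exp (12 * \<kappa> / \<epsilon> * T)"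

lemma field_mass_nonneg: "H \<ge> 0 \<Longrightarrow> \<theta> \<ge> 0 \<Longrightarrow> field_mass H \<theta> T \<ge> 0"
  and field_sup_nonneg: "H \<ge> 0 \<Longrightarrow> field_sup H \<theta> T \<ge> 0"
  using ballistic_factor_pos eps_pos v0_pos v_le by (auto simp: field_mass_def field_sup_def)

end

context coupled_run
begin

text \<open>
  Both signs of \<open>\<mu>\<close> occur because of the reflection. The grazing direction \<open>\<mu> = 0\<close> is left out: it does
  not move, so it carries nothing of the source, and the travel times below would divide by \<open>0\<close>.
\<close>

definition beam :: "real \<Rightarrow> real \<Rightarrow> ennreal" where
  "beam \<mu> \<omega> = indicator {\<omega>\<^sub>0 - \<theta>..\<omega>\<^sub>0 + \<theta>} \<omega> * indicator ({\<mu>\<^sub>0 - \<theta>..\<mu>\<^sub>0 + \<theta>} - {0}) \<bar>\<mu>\<bar>"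

text \<open>
  A majorant of the ballistic parts. At time \<open>t\<close> the source is present where the travel time along the
  direct, the reflected, or the transmitted path from \<open>x = 0\<close> differs from \<open>t / \<epsilon>\<close> by at most
  \<open>\<theta> / \<epsilon>\<close>.
\<close>

definition front :: "real \<Rightarrow> real \<Rightarrow> real \<Rightarrow> real \<Rightarrow> ennreal" where
  "front t x \<mu> \<omega> = ennreal H * beam \<mu> \<omega> *
    (indicator {-\<theta>..\<theta>} (t - \<epsilon> * (x / (\<bar>\<mu>\<bar> * vel \<nu> \<omega>))) +
     indicator {-\<theta>..\<theta>} (t - \<epsilon> * ((2 - x) / (\<bar>\<mu>\<bar> * vel \<nu> \<omega>))) +
     indicator {-\<theta>..\<theta>} (t - \<epsilon> * ((x - 1) / (\<bar>\<mu>\<bar> * vel \<nu>\<^sub>s \<omega>) + 1 / (\<bar>\<mu>\<bar> * vel \<nu> \<omega>))))"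

lemma beam_meas [measurable]: "case_prod beam \<in> borel_measurable (borel \<Otimes>\<^sub>M borel)"
  unfolding beam_def by measurable

lemma front_meas [measurable]:
  "(\<lambda>(x, \<mu>, \<omega>). front t x \<mu> \<omega>) \<in> borel_measurable (borel \<Otimes>\<^sub>M borel \<Otimes>\<^sub>M borel)"
  unfolding front_def beam_def by measurable

lemma front_meas' [measurable]: "case_prod (front t x) \<in> borel_measurable (borel \<Otimes>\<^sub>M borel)"
  unfolding front_def by measurable

lemma front_avg_meas [measurable]:
  "(\<lambda>x. phase_avg (indicator {0<..}) (front t x)) \<in> borel_measurable borel"
proof -
  have [measurable (raw)]: "(\<lambda>z. front t (a z) (b z) (c z)) \<in> borel_measurable N"
    if [measurable]: "a \<in> borel_measurable N" "b \<in> borel_measurable N" "c \<in> borel_measurable N"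
    for N :: "'n measure" and a b c
    using measurable_compose[of "\<lambda>z. (a z, b z, c z)" N _ _ borel, OF _ front_meas] by simp
  show ?thesis unfolding phase_avg_def by measurable
qed

lemma src_ennreal:
  assumes "\<mu> \<noteq> 0"
  shows "ennreal \<bar>\<phi> t \<bar>\<mu>\<bar> \<omega>\<bar> \<le> ennreal H * beam \<mu> \<omega> * indicator {-\<theta>..\<theta>} t"
proof -
  have "ennreal \<bar>\<phi> t \<bar>\<mu>\<bar> \<omega>\<bar> \<le> ennreal (H * indicator {-\<theta>..\<theta>} t * indicator {\<mu>\<^sub>0 - \<theta>..\<mu>\<^sub>0 + \<theta>} \<bar>\<mu>\<bar> * indicator {\<omega>\<^sub>0 - \<theta>..\<omega>\<^sub>0 + \<theta>} \<omega>)"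
    by (intro ennreal_leI src)
  also have "\<dots> = ennreal H * beam \<mu> \<omega> * indicator {-\<theta>..\<theta>} t"
    using assms by (auto simp: beam_def indicator_def)
  finally show ?thesis .
qed

lemma unit_exp: "0 \<le> s \<Longrightarrow> \<omega> > 0 \<Longrightarrow> exp (- s / (\<epsilon> * \<tau> \<omega>)) \<le> 1"
  using eps_pos tau_pos(1)[of \<omega>] by simp

lemma incoming_le_front:
  assumes "0 < \<mu>" "\<omega> > 0" "0 \<le> x"
  shows "ennreal \<bar>incoming t x \<mu> \<omega>\<bar> \<le> front t x \<mu> \<omega>"
proof -
  define s where "s = x / (\<mu> * \<nu> \<omega>)"
  have "s \<ge> 0" using assms nu_pos[of \<omega>] by (simp add: s_def)
  then have "\<bar>incoming t x \<mu> \<omega>\<bar> \<le> \<bar>\<phi> (t - \<epsilon> * s) \<bar>\<mu>\<bar> \<omega>\<bar>"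
    using abs_mult_le_unit[of "exp (- s / (\<epsilon> * \<tau> \<omega>))" "\<phi> (t - \<epsilon> * s) \<mu> \<omega>"] unit_exp[of s \<omega>] assms
    by (auto simp: incoming_def s_def[symmetric] Let_def)
  then have "ennreal \<bar>incoming t x \<mu> \<omega>\<bar> \<le> ennreal \<bar>\<phi> (t - \<epsilon> * s) \<bar>\<mu>\<bar> \<omega>\<bar>"
    by (rule ennreal_leI)
  also have "\<dots> \<le> ennreal H * beam \<mu> \<omega> * indicator {-\<theta>..\<theta>} (t - \<epsilon> * s)"
    using assms by (intro src_ennreal) auto
  also have "\<dots> \<le> front t x \<mu> \<omega>"
    unfolding front_def using assms by (intro mult_left_mono) (auto simp: s_def add.assoc)
  finally show ?thesis .
qed

lemma reflected_le_front:
  assumes "\<mu> < 0" "\<omega> > 0" "x \<le> 2"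
  shows "ennreal \<bar>reflected t x \<mu> \<omega>\<bar> \<le> front t x \<mu> \<omega>"
proof -
  define s where "s = (2 - x) / (- \<mu> * \<nu> \<omega>)"
  have "- \<mu> * \<nu> \<omega> > 0" using assms nu_pos[of \<omega>] by (simp add: mult_neg_pos)
  then have "s \<ge> 0" using assms unfolding s_def by (intro divide_nonneg_pos) auto
  then have "\<bar>\<eta> \<omega> * exp (- s / (\<epsilon> * \<tau> \<omega>))\<bar> \<le> 1"
    using unit_exp[of s \<omega>] unit_coeffs[of \<omega>] assms by (auto simp: abs_mult intro: mult_le_one)
  then have "\<bar>reflected t x \<mu> \<omega>\<bar> \<le> \<bar>\<phi> (t - \<epsilon> * s) \<bar>\<mu>\<bar> \<omega>\<bar>"
    using abs_mult_le_unit[of "\<eta> \<omega> * exp (- s / (\<epsilon> * \<tau> \<omega>))" "\<phi> (t - \<epsilon> * s) (- \<mu>) \<omega>"] assms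
    unfolding reflected_def s_def[symmetric] Let_def by auto
  then have "ennreal \<bar>reflected t x \<mu> \<omega>\<bar> \<le> ennreal \<bar>\<phi> (t - \<epsilon> * s) \<bar>\<mu>\<bar> \<omega>\<bar>"
    by (rule ennreal_leI)
  also have "\<dots> \<le> ennreal H * beam \<mu> \<omega> * indicator {-\<theta>..\<theta>} (t - \<epsilon> * s)"
    using assms by (intro src_ennreal) auto
  also have "\<dots> \<le> front t x \<mu> \<omega>"
    unfolding front_def using assms by (intro mult_left_mono) (auto simp: s_def add.assoc add_increasing)
  finally show ?thesis .
qed

lemma transmitted_le_front:
  assumes "\<mu> > 0" "\<omega> > 0"
  shows "ennreal \<bar>transmitted t x \<mu> \<omega>\<bar> \<le> front t x \<mu> \<omega>"
proof -
  define s where "s = (x - 1) / (\<mu> * \<nu>\<^sub>s \<omega>) + 1 / (\<mu> * \<nu> \<omega>)"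
  have "\<bar>transmitted t x \<mu> \<omega>\<bar> \<le> \<bar>\<phi> (t - \<epsilon> * s) \<bar>\<mu>\<bar> \<omega>\<bar>"
    unfolding transmitted_def s_def[symmetric] Let_def using assms by auto
  then have "ennreal \<bar>transmitted t x \<mu> \<omega>\<bar> \<le> ennreal \<bar>\<phi> (t - \<epsilon> * s) \<bar>\<mu>\<bar> \<omega>\<bar>"
    by (rule ennreal_leI)
  also have "\<dots> \<le> ennreal H * beam \<mu> \<omega> * indicator {-\<theta>..\<theta>} (t - \<epsilon> * s)"
    using assms by (intro src_ennreal) auto
  also have "\<dots> \<le> front t x \<mu> \<omega>"
    unfolding front_def using assms by (intro mult_left_mono) (auto simp: s_def add_increasing)
  finally show ?thesis .
qed

lemma f_bound:
  assumes "0 \<le> t" "t \<le> T" "0 \<le> x" "x \<le> 1" "-1 \<le> \<mu>" "\<mu> \<le> 1" "\<omega> > 0"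
  shows "ennreal \<bar>f t x \<mu> \<omega>\<bar> \<le> front t x \<mu> \<omega> + ennreal (\<kappa> * C \<omega>) * ray_sum \<epsilon> (vel \<nu>) (vel \<nu>\<^sub>s) field t x \<mu> \<omega>"
  unfolding ray_sum_vel[OF \<open>\<omega> > 0\<close>]
proof (cases \<mu> "0 :: real" rule: linorder_cases)
  case less
  show "ennreal \<bar>f t x \<mu> \<omega>\<bar> \<le> front t x \<mu> \<omega> + ennreal (\<kappa> * C \<omega>) * ray_sum \<epsilon> \<nu> \<nu>\<^sub>s field t x \<mu> \<omega>"
    by (rule abs_le_add_ennreal[OF f_reflected reflected_le_front]) (use assms less in auto)
next
  case greater
  have "ennreal \<bar>f t x \<mu> \<omega> - incoming t x \<mu> \<omega>\<bar> \<le> ennreal (\<kappa> * C \<omega>) * P t x (\<mu> * (- \<nu> \<omega>))"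
    using assms greater by (intro f_incoming)
  also have "\<dots> \<le> ennreal (\<kappa> * C \<omega>) * ray_sum \<epsilon> \<nu> \<nu>\<^sub>s field t x \<mu> \<omega>"
    by (intro mult_left_mono path_le_ray_sum) auto
  finally show "ennreal \<bar>f t x \<mu> \<omega>\<bar> \<le> front t x \<mu> \<omega> + ennreal (\<kappa> * C \<omega>) * ray_sum \<epsilon> \<nu> \<nu>\<^sub>s field t x \<mu> \<omega>"
    by (rule abs_le_add_ennreal[OF _ incoming_le_front]) (use assms greater in auto)
next
  case equal
  have "ennreal \<bar>f t x \<mu> \<omega>\<bar> \<le> ennreal (\<kappa> * C \<omega>) * P t x (\<mu> * (- \<nu> \<omega>))"
    unfolding equal using assms by (intro f_grazing)
  also have "\<dots> \<le> ennreal (\<kappa> * C \<omega>) * ray_sum \<epsilon> \<nu> \<nu>\<^sub>s field t x \<mu> \<omega>"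
    by (intro mult_left_mono path_le_ray_sum) auto
  finally show "ennreal \<bar>f t x \<mu> \<omega>\<bar> \<le> front t x \<mu> \<omega> + ennreal (\<kappa> * C \<omega>) * ray_sum \<epsilon> \<nu> \<nu>\<^sub>s field t x \<mu> \<omega>"
    by (rule add_increasing[OF zero_le])
qed

lemma g_bound:
  assumes "0 \<le> t" "t \<le> T" "1 \<le> x" "x \<le> 1 + L" "-1 \<le> \<mu>" "\<mu> \<le> 1" "\<omega> > 0"
  shows "ennreal \<bar>g t x \<mu> \<omega>\<bar> \<le> front t x \<mu> \<omega> + ennreal (\<kappa> * C \<omega>) * ray_sum \<epsilon> (vel \<nu>\<^sub>s) (vel \<nu>) field t x \<mu> \<omega>"
  unfolding ray_sum_vel[OF \<open>\<omega> > 0\<close>]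
proof (cases "\<mu> > 0")
  case True
  have "ennreal \<bar>g t x \<mu> \<omega>\<bar> \<le> ennreal \<bar>transmitted t x \<mu> \<omega>\<bar> +
    ennreal (\<kappa> * C \<omega>) * ray_sum \<epsilon> \<nu>\<^sub>s \<nu> field t x \<mu> \<omega>"
    using assms True by (intro g_transmitted)
  also have "\<dots> \<le> front t x \<mu> \<omega> + ennreal (\<kappa> * C \<omega>) * ray_sum \<epsilon> \<nu>\<^sub>s \<nu> field t x \<mu> \<omega>"
    using assms True by (intro add_right_mono transmitted_le_front)
  finally show "ennreal \<bar>g t x \<mu> \<omega>\<bar> \<le> front t x \<mu> \<omega> + ennreal (\<kappa> * C \<omega>) * ray_sum \<epsilon> \<nu>\<^sub>s \<nu> field t x \<mu> \<omega>" .
next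
  case False
  have "ennreal \<bar>g t x \<mu> \<omega>\<bar> \<le> ennreal (\<kappa> * C \<omega>) * P t x (\<mu> * (- \<nu>\<^sub>s \<omega>))"
    using g_grazing[of t x \<omega>] g_incoming[of t x \<mu> \<omega>] assms False by (cases "\<mu> = 0") auto
  also have "\<dots> \<le> ennreal (\<kappa> * C \<omega>) * ray_sum \<epsilon> \<nu>\<^sub>s \<nu> field t x \<mu> \<omega>"
    by (intro mult_left_mono path_le_ray_sum) auto
  finally show "ennreal \<bar>g t x \<mu> \<omega>\<bar> \<le> front t x \<mu> \<omega> + ennreal (\<kappa> * C \<omega>) * ray_sum \<epsilon> \<nu>\<^sub>s \<nu> field t x \<mu> \<omega>"
    by (rule add_increasing[OF zero_le])
qed

text \<open>
  The bounds for \<open>f\<close> and \<open>g\<close> contain the temperatures of both layers, hence the inequality closes only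
  for their sum.
\<close>

lemma field_le:
  assumes t: "0 \<le> t" "t \<le> T"
  shows "field t x \<le> ennreal ballistic_factor * phase_avg (indicator {0<..}) (front t x) + ennreal \<kappa> * scatter_both field t x"
proof -
  let ?Z = "phase_avg (indicator {0<..}) (front t x)"
  let ?a = "1 / (\<tau>\<^sub>0 * C_tau C \<tau>)" and ?b = "1 / (\<tau>\<^sub>0 * C_tau C \<tau>\<^sub>s)"
  have 1: "indicator {0..T} t * indicator {0..1} x * ennreal \<bar>Delta_T C \<tau> f t x\<bar> \<le>
      ennreal ?a * ?Z + ennreal \<kappa> * upper.scatter field t x"
  proof (cases "x \<in> {0..1}")
    case True
    then have "ennreal \<bar>Delta_T C \<tau> f t x\<bar> \<le> ennreal ?a * ?Z + ennreal \<kappa> * upper.scatter field t x"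
      unfolding upper.scatter_def using t by (intro Delta_T_abs_le f_bound) auto
    then show ?thesis using True t by simp
  qed simp
  have 2: "indicator {0..T} t * indicator {1..1 + L} x * ennreal \<bar>Delta_T C \<tau>\<^sub>s g t x\<bar> \<le>
      ennreal ?b * ?Z + ennreal \<kappa> * lower.scatter field t x"
  proof (cases "x \<in> {1..1 + L}")
    case True
    then have "ennreal \<bar>Delta_T C \<tau>\<^sub>s g t x\<bar> \<le> ennreal ?b * ?Z + ennreal \<kappa> * lower.scatter field t x"
      unfolding lower.scatter_def using t by (intro Delta_T_abs_le g_bound) auto
    then show ?thesis using True t by simp
  qed simp
  have "field t x \<le> (ennreal ?a * ?Z + ennreal \<kappa> * upper.scatter field t x) + (ennreal ?b * ?Z + ennreal \<kappa> * lower.scatter field t x)"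
    unfolding field_def[of t x] by (intro add_mono 1 2)
  also have "\<dots> = (ennreal ?a + ennreal ?b) * ?Z + ennreal \<kappa> * scatter_both field t x"
    by (simp only: scatter_both_def distrib_left distrib_right ac_simps)
  also have "ennreal ?a + ennreal ?b = ennreal ballistic_factor"
    using tau0_pos C_tau_both_pos by (simp add: ballistic_factor_def)
  finally show ?thesis .
qed

lemma phase_avg_beam:
  "phase_avg (indicator {0<..}) (\<lambda>\<mu> \<omega>. c * beam \<mu> \<omega>) \<le> c * ennreal (8 * \<theta>\<^sup>2)"
proof -
  let ?I = "\<lambda>a. indicator {a - \<theta>..a + \<theta>} :: real \<Rightarrow> ennreal"
  have "phase_avg (indicator {0<..}) (\<lambda>\<mu> \<omega>. c * beam \<mu> \<omega>) \<le>
      (\<integral>\<^sup>+\<mu>. (\<integral>\<^sup>+\<omega>. c * (?I \<mu>\<^sub>0 \<mu> + ?I (-\<mu>\<^sub>0) \<mu>) * ?I \<omega>\<^sub>0 \<omega> \<partial>lborel) \<partial>lborel)"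
    unfolding phase_avg_def beam_def
  proof (intro nn_integral_mono)
    fix \<mu> :: real
    have "(\<integral>\<^sup>+\<omega>. indicator {0<..} \<omega> * (c * (?I \<omega>\<^sub>0 \<omega> * indicator ({\<mu>\<^sub>0 - \<theta>..\<mu>\<^sub>0 + \<theta>} - {0}) \<bar>\<mu>\<bar>)) \<partial>lborel) * indicator {-1..1} \<mu>
      \<le> (\<integral>\<^sup>+\<omega>. indicator {0<..} \<omega> * (c * (?I \<omega>\<^sub>0 \<omega> * indicator ({\<mu>\<^sub>0 - \<theta>..\<mu>\<^sub>0 + \<theta>} - {0}) \<bar>\<mu>\<bar>)) \<partial>lborel)"
      by (auto simp: indicator_def)
    also have "\<dots> \<le> (\<integral>\<^sup>+\<omega>. c * (?I \<mu>\<^sub>0 \<mu> + ?I (-\<mu>\<^sub>0) \<mu>) * ?I \<omega>\<^sub>0 \<omega> \<partial>lborel)"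
    proof (intro nn_integral_mono)
      fix \<omega> :: real
      have "indicator ({\<mu>\<^sub>0 - \<theta>..\<mu>\<^sub>0 + \<theta>} - {0}) \<bar>\<mu>\<bar> \<le> ?I \<mu>\<^sub>0 \<mu> + ?I (-\<mu>\<^sub>0) \<mu>"
        by (auto simp: indicator_def abs_if split: if_splits)
      then have "1 * (c * (?I \<omega>\<^sub>0 \<omega> * indicator ({\<mu>\<^sub>0 - \<theta>..\<mu>\<^sub>0 + \<theta>} - {0}) \<bar>\<mu>\<bar>)) \<le> 1 * (c * (?I \<omega>\<^sub>0 \<omega> * (?I \<mu>\<^sub>0 \<mu> + ?I (-\<mu>\<^sub>0) \<mu>)))"
        by (intro mult_left_mono) auto
      then show "indicator {0<..} \<omega> * (c * (?I \<omega>\<^sub>0 \<omega> * indicator ({\<mu>\<^sub>0 - \<theta>..\<mu>\<^sub>0 + \<theta>} - {0}) \<bar>\<mu>\<bar>)) \<le>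
          c * (?I \<mu>\<^sub>0 \<mu> + ?I (-\<mu>\<^sub>0) \<mu>) * ?I \<omega>\<^sub>0 \<omega>"
        by (auto simp: indicator_def ac_simps)
    qed
    finally show "(\<integral>\<^sup>+\<omega>. indicator {0<..} \<omega> * (c * (?I \<omega>\<^sub>0 \<omega> * indicator ({\<mu>\<^sub>0 - \<theta>..\<mu>\<^sub>0 + \<theta>} - {0}) \<bar>\<mu>\<bar>)) \<partial>lborel) * indicator {-1..1} \<mu>
      \<le> (\<integral>\<^sup>+\<omega>. c * (?I \<mu>\<^sub>0 \<mu> + ?I (-\<mu>\<^sub>0) \<mu>) * ?I \<omega>\<^sub>0 \<omega> \<partial>lborel)" .
  qed
  also have "\<dots> = (\<integral>\<^sup>+\<mu>. c * (?I \<mu>\<^sub>0 \<mu> + ?I (-\<mu>\<^sub>0) \<mu>) * ennreal (2 * \<theta>) \<partial>lborel)"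
    using theta_pos by (intro nn_integral_cong) (subst nn_integral_cmult_indicator, auto)
  also have "\<dots> = c * (ennreal (2 * \<theta>) + ennreal (2 * \<theta>)) * ennreal (2 * \<theta>)"
    using theta_pos by (subst nn_integral_multc) (auto simp: nn_integral_cmult nn_integral_add)
  also have "\<dots> = c * ((ennreal (2 * \<theta>) + ennreal (2 * \<theta>)) * ennreal (2 * \<theta>))"
    by (rule mult.assoc)
  also have "(ennreal (2 * \<theta>) + ennreal (2 * \<theta>)) * ennreal (2 * \<theta>) = ennreal (8 * \<theta>\<^sup>2)"
    using theta_pos by (subst ennreal_plus[symmetric], simp, simp, subst ennreal_mult[symmetric]) (auto simp: power2_eq_square)
  finally show ?thesis .
qed

lemma front_sup: "phase_avg (indicator {0<..}) (front t x) \<le> ennreal (24 * H * \<theta>\<^sup>2)"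
proof -
  have "phase_avg (indicator {0<..}) (front t x) \<le> phase_avg (indicator {0<..}) (\<lambda>\<mu> \<omega>. ennreal (3 * H) * beam \<mu> \<omega>)"
  proof (intro phase_avg_mono mult_left_mono)
    fix \<mu> \<omega>
    have "front t x \<mu> \<omega> \<le> ennreal H * beam \<mu> \<omega> * (1 + 1 + 1)"
      unfolding front_def by (intro mult_left_mono add_mono) (auto simp: indicator_def)
    also have "\<dots> = ennreal (3 * H) * beam \<mu> \<omega>"
      using ennreal_mult'[of 3 H] by (simp add: ac_simps)
    finally show "front t x \<mu> \<omega> \<le> ennreal (3 * H) * beam \<mu> \<omega>" .
  qed auto
  also have "\<dots> \<le> ennreal (3 * H) * ennreal (8 * \<theta>\<^sup>2)"
    by (rule phase_avg_beam)
  also have "\<dots> = ennreal (24 * H * \<theta>\<^sup>2)"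
    using H_nonneg by (subst ennreal_mult[symmetric]) auto
  finally show ?thesis .
qed

text \<open>
  For fixed direction and frequency the front is a pulse of duration \<open>2 \<theta>\<close> moving with speed at most
  \<open>v\<^sub>1 / \<epsilon>\<close>; so it occupies at most a length \<open>2 \<theta> v\<^sub>1 / \<epsilon>\<close> on each of the three paths.
\<close>

lemma front_line_mass:
  assumes "\<omega> > 0" "-1 \<le> \<mu>" "\<mu> \<le> 1"
  shows "(\<integral>\<^sup>+x. front t x \<mu> \<omega> \<partial>lborel) \<le> ennreal (6 * \<theta> * v\<^sub>1 / \<epsilon> * H) * beam \<mu> \<omega>"
proof (cases "\<mu> = 0")
  case True
  then show ?thesis by (simp add: front_def beam_def)
next
  case False
  have len: "(\<integral>\<^sup>+x. indicator {-\<theta>..\<theta>} (p + \<sigma> * (\<epsilon> / (\<bar>\<mu>\<bar> * u)) * x) \<partial>lborel) \<le> ennreal (2 * \<theta> * v\<^sub>1 / \<epsilon>)"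
    if u: "0 < u" "u \<le> v\<^sub>1" and \<sigma>: "\<bar>\<sigma>\<bar> = 1" for p \<sigma> u
  proof -
    have "(\<integral>\<^sup>+x. indicator {-\<theta>..\<theta>} (p + \<sigma> * (\<epsilon> / (\<bar>\<mu>\<bar> * u)) * x) \<partial>lborel) = ennreal (2 * \<theta> / \<bar>\<sigma> * (\<epsilon> / (\<bar>\<mu>\<bar> * u))\<bar>)"
      using u \<sigma> False eps_pos theta_pos by (intro nn_integral_indicator_affine) auto
    also have "2 * \<theta> / \<bar>\<sigma> * (\<epsilon> / (\<bar>\<mu>\<bar> * u))\<bar> = 2 * \<theta> * (\<bar>\<mu>\<bar> * u) / \<epsilon>"
      using u \<sigma> False eps_pos by (simp add: abs_mult)
    also have "\<dots> \<le> 2 * \<theta> * v\<^sub>1 / \<epsilon>"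
    proof -
      have "\<bar>\<mu>\<bar> * u \<le> 1 * v\<^sub>1" using u assms by (intro mult_mono) auto
      then show ?thesis using eps_pos theta_pos by (intro divide_right_mono mult_left_mono) auto
    qed
    finally show ?thesis by (simp add: ennreal_leI)
  qed
  have n: "0 < \<nu> \<omega>" "\<nu> \<omega> \<le> v\<^sub>1" "0 < \<nu>\<^sub>s \<omega>" "\<nu>\<^sub>s \<omega> \<le> v\<^sub>1"
    using nu_pos nu_le assms by auto
  let ?i = "\<lambda>p \<sigma> u x. indicator {-\<theta>..\<theta>} (p + \<sigma> * (\<epsilon> / (\<bar>\<mu>\<bar> * u)) * x) :: ennreal"
  have "front t x \<mu> \<omega> = ennreal H * beam \<mu> \<omega> *
      (?i t (-1) (\<nu> \<omega>) x + ?i (t - \<epsilon> * (2 / (\<bar>\<mu>\<bar> * \<nu> \<omega>))) 1 (\<nu> \<omega>) x +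
       ?i (t + \<epsilon> / (\<bar>\<mu>\<bar> * \<nu>\<^sub>s \<omega>) - \<epsilon> / (\<bar>\<mu>\<bar> * \<nu> \<omega>)) (-1) (\<nu>\<^sub>s \<omega>) x)" for x
  proof -
    have "t - \<epsilon> * (x / (\<bar>\<mu>\<bar> * \<nu> \<omega>)) = t + (-1) * (\<epsilon> / (\<bar>\<mu>\<bar> * \<nu> \<omega>)) * x"
      "t - \<epsilon> * ((2 - x) / (\<bar>\<mu>\<bar> * \<nu> \<omega>)) = t - \<epsilon> * (2 / (\<bar>\<mu>\<bar> * \<nu> \<omega>)) + 1 * (\<epsilon> / (\<bar>\<mu>\<bar> * \<nu> \<omega>)) * x"
      "t - \<epsilon> * ((x - 1) / (\<bar>\<mu>\<bar> * \<nu>\<^sub>s \<omega>) + 1 / (\<bar>\<mu>\<bar> * \<nu> \<omega>)) =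
        t + \<epsilon> / (\<bar>\<mu>\<bar> * \<nu>\<^sub>s \<omega>) - \<epsilon> / (\<bar>\<mu>\<bar> * \<nu> \<omega>) + (-1) * (\<epsilon> / (\<bar>\<mu>\<bar> * \<nu>\<^sub>s \<omega>)) * x"
      by (simp_all add: diff_divide_distrib distrib_left right_diff_distrib)
    then show ?thesis
      unfolding front_def vel_pos[OF \<open>\<omega> > 0\<close>] by (simp only:)
  qed
  then have "(\<integral>\<^sup>+x. front t x \<mu> \<omega> \<partial>lborel) = ennreal H * beam \<mu> \<omega> *
      ((\<integral>\<^sup>+x. ?i t (-1) (\<nu> \<omega>) x \<partial>lborel) + (\<integral>\<^sup>+x. ?i (t - \<epsilon> * (2 / (\<bar>\<mu>\<bar> * \<nu> \<omega>))) 1 (\<nu> \<omega>) x \<partial>lborel) +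
       (\<integral>\<^sup>+x. ?i (t + \<epsilon> / (\<bar>\<mu>\<bar> * \<nu>\<^sub>s \<omega>) - \<epsilon> / (\<bar>\<mu>\<bar> * \<nu> \<omega>)) (-1) (\<nu>\<^sub>s \<omega>) x \<partial>lborel))"
    by (simp only: nn_integral_cmult nn_integral_add measurable) (subst nn_integral_cmult, measurable, subst nn_integral_add, measurable, subst nn_integral_add, measurable)
  also have "\<dots> \<le> ennreal H * beam \<mu> \<omega> * (ennreal (2 * \<theta> * v\<^sub>1 / \<epsilon>) + ennreal (2 * \<theta> * v\<^sub>1 / \<epsilon>) + ennreal (2 * \<theta> * v\<^sub>1 / \<epsilon>))"
    by (intro mult_left_mono add_mono len n) auto
  also have "ennreal (2 * \<theta> * v\<^sub>1 / \<epsilon>) + ennreal (2 * \<theta> * v\<^sub>1 / \<epsilon>) + ennreal (2 * \<theta> * v\<^sub>1 / \<epsilon>) = ennreal (6 * \<theta> * v\<^sub>1 / \<epsilon>)"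
    using theta_pos eps_pos n by (subst ennreal_plus[symmetric], simp, simp)+ (simp add: field_simps)
  also have "ennreal H * beam \<mu> \<omega> * ennreal (6 * \<theta> * v\<^sub>1 / \<epsilon>) = ennreal (6 * \<theta> * v\<^sub>1 / \<epsilon> * H) * beam \<mu> \<omega>"
    using ennreal_mult''[of H "6 * \<theta> * v\<^sub>1 / \<epsilon>"] H_nonneg by (simp add: ac_simps)
  finally show ?thesis .
qed

text \<open>
  In contrast to the supremum of order \<open>H \<theta>\<^sup>2\<close>, the mass gains one more factor \<open>\<theta>\<close>. For \<open>H\<close> of order
  \<open>\<theta>\<^sup>-\<^sup>3\<close> it is bounded as \<open>\<theta> \<rightarrow> 0\<close>.
\<close>

lemma front_mass: "(\<integral>\<^sup>+x. phase_avg (indicator {0<..}) (front t x) \<partial>lborel) \<le> ennreal (48 * v\<^sub>1 / \<epsilon> * H * \<theta> ^ 3)"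
proof -
  have "(\<integral>\<^sup>+x. phase_avg (indicator {0<..}) (front t x) \<partial>lborel) =
      phase_avg (indicator {0<..}) (\<lambda>\<mu> \<omega>. \<integral>\<^sup>+x. front t x \<mu> \<omega> \<partial>lborel)"
    by (intro nn_integral_phase_avg) measurable
  also have "\<dots> \<le> phase_avg (indicator {0<..}) (\<lambda>\<mu> \<omega>. ennreal (6 * \<theta> * v\<^sub>1 / \<epsilon> * H) * beam \<mu> \<omega>)"
    using front_line_mass by (intro phase_avg_mono) (auto simp: indicator_def)
  also have "\<dots> \<le> ennreal (6 * \<theta> * v\<^sub>1 / \<epsilon> * H) * ennreal (8 * \<theta>\<^sup>2)"
    by (rule phase_avg_beam)
  also have "\<dots> = ennreal (48 * v\<^sub>1 / \<epsilon> * H * \<theta> ^ 3)"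
    using theta_pos eps_pos H_nonneg v0_pos v_le
    by (subst ennreal_mult[symmetric]) (auto simp: power2_eq_square power3_eq_cube)
  finally show ?thesis .
qed

lemma field_le_mass:
  assumes t: "0 \<le> t" "t \<le> T"
  shows "(\<integral>\<^sup>+x. field t x \<partial>lborel) \<le> ennreal (field_mass H \<theta> T)"
proof -
  have "(\<integral>\<^sup>+x. field t x \<partial>lborel) \<le>
      ennreal (2 * (ballistic_factor * (48 * v\<^sub>1 / \<epsilon> * H * \<theta> ^ 3)) * exp (4 * \<kappa> * (2 + v\<^sub>1 / v\<^sub>0) / \<epsilon> * t))"
  proof (rule mass_bound[where F\<^sub>0 = "\<lambda>t x. ennreal ballistic_factor * phase_avg (indicator {0<..}) (front t x)" and T = T])
    show "(\<lambda>x. ennreal ballistic_factor * phase_avg (indicator {0<..}) (front t x)) \<in> borel_measurable borel" for t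
      by measurable
    show "(\<integral>\<^sup>+x. ennreal ballistic_factor * phase_avg (indicator {0<..}) (front t x) \<partial>lborel) \<le> ennreal (ballistic_factor * (48 * v\<^sub>1 / \<epsilon> * H * \<theta> ^ 3))" for t
    proof -
      have "(\<integral>\<^sup>+x. ennreal ballistic_factor * phase_avg (indicator {0<..}) (front t x) \<partial>lborel) =
          ennreal ballistic_factor * (\<integral>\<^sup>+x. phase_avg (indicator {0<..}) (front t x) \<partial>lborel)"
        by (rule nn_integral_cmult) measurable
      also have "\<dots> \<le> ennreal ballistic_factor * ennreal (48 * v\<^sub>1 / \<epsilon> * H * \<theta> ^ 3)"
        by (intro mult_left_mono front_mass) auto
      also have "\<dots> = ennreal (ballistic_factor * (48 * v\<^sub>1 / \<epsilon> * H * \<theta> ^ 3))"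
        using ballistic_factor_pos by (intro ennreal_mult'[symmetric]) auto
      finally show ?thesis .
    qed
  qed (use t field_le field_finite ballistic_factor_pos H_nonneg theta_pos eps_pos v0_pos v_le in auto)
  also have "\<dots> \<le> ennreal (field_mass H \<theta> T)"
    unfolding field_mass_def using t ballistic_factor_pos H_nonneg theta_pos eps_pos v0_pos v_le tau0_pos
    by (intro ennreal_leI mult_left_mono) (auto intro!: mult_left_mono divide_right_mono divide_nonneg_pos add_nonneg_nonneg)
  finally show ?thesis .
qed

lemma field_le_sup:
  assumes t: "0 \<le> t" "t \<le> T"
  shows "field t x \<le> ennreal (field_sup H \<theta> T)"
proof -
  have "field t x \<le> ennreal (2 * (ballistic_factor * (24 * H * \<theta>\<^sup>2)) * exp (12 * \<kappa> / \<epsilon> * t))"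
  proof (rule sup_bound)
    fix t x assume t: "0 \<le> t" "t \<le> T"
    have "field t x \<le> ennreal ballistic_factor * phase_avg (indicator {0<..}) (front t x) + ennreal \<kappa> * scatter_both field t x"
      using t by (rule field_le)
    also have "\<dots> \<le> ennreal ballistic_factor * ennreal (24 * H * \<theta>\<^sup>2) + ennreal \<kappa> * scatter_both field t x"
      by (intro add_right_mono mult_left_mono front_sup) auto
    also have "ennreal ballistic_factor * ennreal (24 * H * \<theta>\<^sup>2) = ennreal (ballistic_factor * (24 * H * \<theta>\<^sup>2))"
      using ballistic_factor_pos by (simp add: ennreal_mult')
    finally show "field t x \<le> ennreal (ballistic_factor * (24 * H * \<theta>\<^sup>2)) + ennreal \<kappa> * scatter_both field t x" .
  qed (use t field_finite ballistic_factor_pos H_nonneg in auto)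
  also have "\<dots> \<le> ennreal (field_sup H \<theta> T)"
    unfolding field_sup_def using t ballistic_factor_pos H_nonneg theta_pos eps_pos tau0_pos
    by (intro ennreal_leI mult_left_mono) (auto intro!: mult_left_mono divide_right_mono)
  finally show ?thesis .
qed

lemma trace_scatter_le:
  assumes t: "0 \<le> t" "t \<le> T" and "\<delta> > 0"
  shows "upper.scatter field t x \<le> ennreal (3 * (2 * field_sup H \<theta> T * \<delta> + field_mass H \<theta> T * T / (\<epsilon> * v\<^sub>0 * \<delta>)))"
proof -
  have "upper.scatter field t x \<le> ennreal (3 * (2 * field_sup H \<theta> T * \<delta> + field_mass H \<theta> T * t / (\<epsilon> * v\<^sub>0 * \<delta>)))"
    using t \<open>\<delta> > 0\<close> field_mass_nonneg[OF H_nonneg less_imp_le[OF theta_pos]] field_sup_nonneg[OF H_nonneg] field_le_mass field_le_sup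
    by (intro upper.scatter_le_interpolated) auto
  also have "\<dots> \<le> ennreal (3 * (2 * field_sup H \<theta> T * \<delta> + field_mass H \<theta> T * T / (\<epsilon> * v\<^sub>0 * \<delta>)))"
    using t \<open>\<delta> > 0\<close> field_mass_nonneg[OF H_nonneg less_imp_le[OF theta_pos]] eps_pos v0_pos
    by (intro ennreal_leI mult_left_mono add_left_mono divide_right_mono) auto
  finally show ?thesis .
qed

lemma trace_abs_le:
  assumes "0 \<le> t" "t \<le> T"
  shows "\<bar>Delta_T C \<tau> f t 0\<bar> \<le> field_sup H \<theta> T"
proof -
  have "ennreal \<bar>Delta_T C \<tau> f t 0\<bar> = field t 0"
    using assms by (simp add: field_def)
  also have "\<dots> \<le> ennreal (field_sup H \<theta> T)"
    using assms by (rule field_le_sup)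
  finally show ?thesis using field_sup_nonneg[OF H_nonneg] by simp
qed

lemma trace_phase_avg_finite:
  assumes "0 \<le> t" "t \<le> T"
  shows "phase_avg (indicator {0<..}) (\<lambda>\<mu> \<omega>. ennreal \<bar>f t 0 \<mu> \<omega> / \<tau> \<omega>\<bar>) < \<infinity>"
proof -
  have "phase_avg (indicator {0<..}) (\<lambda>\<mu> \<omega>. ennreal \<bar>f t 0 \<mu> \<omega> / \<tau> \<omega>\<bar>) \<le>
    ennreal (C_tau C \<tau>) * (ennreal (1 / (\<tau>\<^sub>0 * C_tau C \<tau>)) * phase_avg (indicator {0<..}) (front t 0) +
      ennreal \<kappa> * phase_avg (weight C \<tau>) (ray_sum \<epsilon> (vel \<nu>) (vel \<nu>\<^sub>s) field t 0))"
    using assms by (intro phase_avg_over_tau_le f_bound) auto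
  also have "\<dots> < \<infinity>"
  proof -
    have "phase_avg (indicator {0<..}) (front t 0) < \<infinity>"
      using front_sup[of t 0] by (rule le_less_trans) simp
    moreover have "phase_avg (weight C \<tau>) (ray_sum \<epsilon> (vel \<nu>) (vel \<nu>\<^sub>s) field t 0) < \<infinity>"
      using trace_scatter_le[OF assms zero_less_one, of 0, unfolded upper.scatter_def] by (rule le_less_trans) simp
    ultimately show ?thesis by (simp add: ennreal_mult_less_top)
  qed
  finally show ?thesis .
qed

text \<open>
  For \<open>\<mu> > 0\<close> the trace at \<open>x = 0\<close> is the source itself, so it will cancel in the difference of two
  solutions.
\<close>

lemma trace_remainder:
  assumes "0 < t" "t \<le> T" "-1 \<le> \<mu>" "\<mu> \<le> 1" "\<omega> > 0"
  shows "ennreal \<bar>f t 0 \<mu> \<omega> - (if \<mu> > 0 then \<phi> t \<mu> \<omega> else if \<mu> < 0 then reflected t 0 \<mu> \<omega> else 0)\<bar>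
    \<le> ennreal (\<kappa> * C \<omega>) * ray_sum \<epsilon> (vel \<nu>) (vel \<nu>\<^sub>s) field t 0 \<mu> \<omega>"
  unfolding ray_sum_vel[OF \<open>\<omega> > 0\<close>]
proof (cases \<mu> "0 :: real" rule: linorder_cases)
  case less
  then show "ennreal \<bar>f t 0 \<mu> \<omega> - (if \<mu> > 0 then \<phi> t \<mu> \<omega> else if \<mu> < 0 then reflected t 0 \<mu> \<omega> else 0)\<bar>
    \<le> ennreal (\<kappa> * C \<omega>) * ray_sum \<epsilon> \<nu> \<nu>\<^sub>s field t 0 \<mu> \<omega>"
    using f_reflected[of t 0 \<mu> \<omega>] assms by simp
next
  case greater
  then show "ennreal \<bar>f t 0 \<mu> \<omega> - (if \<mu> > 0 then \<phi> t \<mu> \<omega> else if \<mu> < 0 then reflected t 0 \<mu> \<omega> else 0)\<bar>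
    \<le> ennreal (\<kappa> * C \<omega>) * ray_sum \<epsilon> \<nu> \<nu>\<^sub>s field t 0 \<mu> \<omega>"
    using boundary(1)[of t \<mu> \<omega>] assms by simp
next
  case equal
  have "ennreal \<bar>f t 0 0 \<omega>\<bar> \<le> ennreal (\<kappa> * C \<omega>) * P t 0 (0 * (- \<nu> \<omega>))"
    using assms by (intro f_grazing) auto
  also have "\<dots> \<le> ennreal (\<kappa> * C \<omega>) * ray_sum \<epsilon> \<nu> \<nu>\<^sub>s field t 0 0 \<omega>"
    by (intro mult_left_mono path_le_ray_sum) auto
  finally show "ennreal \<bar>f t 0 \<mu> \<omega> - (if \<mu> > 0 then \<phi> t \<mu> \<omega> else if \<mu> < 0 then reflected t 0 \<mu> \<omega> else 0)\<bar>
    \<le> ennreal (\<kappa> * C \<omega>) * ray_sum \<epsilon> \<nu> \<nu>\<^sub>s field t 0 \<mu> \<omega>"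
    using equal by simp
qed

lemma trace_meas: "(\<lambda>t. indicator {0..T} t * Delta_T C \<tau> f t 0) \<in> borel_measurable borel"
proof -
  have "(\<lambda>t. (\<lambda>(t, x). indicator {0..T} t * indicator {0..1} x * Delta_T C \<tau> f t x) (t, 0)) \<in> borel_measurable borel"
    by (rule measurable_compose[OF _ borel_measurable_Delta_T[OF flux_integrable(1), of C]]) measurable
  then show ?thesis by simp
qed

lemma trace_section_meas:
  assumes "0 \<le> t" "t \<le> T"
  shows "phase_cut (\<lambda>\<mu> \<omega>. f t 0 \<mu> \<omega> / \<tau> \<omega>) \<in> borel_measurable (lborel \<Otimes>\<^sub>M lborel)"
  using assms by (intro borel_measurable_phase_cut_section[OF flux_integrable(1)]) auto

end

context two_media
begin

section \<open>Comparison of two reflection coefficients\<close>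

text \<open>
  The two ballistic parts at \<open>x = 0\<close> are the same damped source, multiplied by the respective
  reflection coefficient.
\<close>

lemma reflected_difference_le:
  assumes r1: "coupled_run C \<tau> \<tau>\<^sub>s \<nu> \<nu>\<^sub>s \<epsilon> \<tau>\<^sub>0 v\<^sub>0 v\<^sub>1 L T \<theta> H \<mu>\<^sub>0 \<omega>\<^sub>0 \<eta>\<^sub>1 \<phi> f\<^sub>1 g\<^sub>1"
    and r2: "coupled_run C \<tau> \<tau>\<^sub>s \<nu> \<nu>\<^sub>s \<epsilon> \<tau>\<^sub>0 v\<^sub>0 v\<^sub>1 L T \<theta> H \<mu>\<^sub>0 \<omega>\<^sub>0 \<eta>\<^sub>2 \<phi> f\<^sub>2 g\<^sub>2"
    and D: "\<And>\<omega>. \<omega> > 0 \<Longrightarrow> \<bar>\<omega> - \<omega>\<^sub>0\<bar> \<le> \<theta> \<Longrightarrow> \<bar>\<eta>\<^sub>1 \<omega> - \<eta>\<^sub>2 \<omega>\<bar> \<le> D"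
    and e: "\<And>\<mu> \<omega>. \<omega> > 0 \<Longrightarrow> \<bar>\<omega> - \<omega>\<^sub>0\<bar> \<le> \<theta> \<Longrightarrow> 0 < \<mu> \<Longrightarrow> \<bar>\<mu> - \<mu>\<^sub>0\<bar> \<le> \<theta> \<Longrightarrow>
      exp (- (2 / (\<mu> * \<nu> \<omega>)) / (\<epsilon> * \<tau> \<omega>)) \<le> e"
    and De: "D \<ge> 0" "e \<ge> 0" and \<mu>: "\<mu> < 0" and \<omega>: "\<omega> > 0"
  shows "\<bar>coupled_run.reflected \<tau> \<nu> \<epsilon> \<eta>\<^sub>1 \<phi> t 0 \<mu> \<omega> - coupled_run.reflected \<tau> \<nu> \<epsilon> \<eta>\<^sub>2 \<phi> t 0 \<mu> \<omega>\<bar> \<le>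
    D * e * H * (indicator {\<omega>\<^sub>0 - \<theta>..\<omega>\<^sub>0 + \<theta>} \<omega> * indicator {\<mu>\<^sub>0 - \<theta>..\<mu>\<^sub>0 + \<theta>} (- \<mu>))"
proof -
  interpret r1: coupled_run C \<tau> \<tau>\<^sub>s \<nu> \<nu>\<^sub>s \<epsilon> \<tau>\<^sub>0 v\<^sub>0 v\<^sub>1 L T \<theta> H \<mu>\<^sub>0 \<omega>\<^sub>0 \<eta>\<^sub>1 \<phi> f\<^sub>1 g\<^sub>1 by fact
  interpret r2: coupled_run C \<tau> \<tau>\<^sub>s \<nu> \<nu>\<^sub>s \<epsilon> \<tau>\<^sub>0 v\<^sub>0 v\<^sub>1 L T \<theta> H \<mu>\<^sub>0 \<omega>\<^sub>0 \<eta>\<^sub>2 \<phi> f\<^sub>2 g\<^sub>2 by fact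
  define s where "s = 2 / (- \<mu> * \<nu> \<omega>)"
  define y where "y = \<phi> (t - \<epsilon> * s) (- \<mu>) \<omega>"
  let ?b = "indicator {\<omega>\<^sub>0 - \<theta>..\<omega>\<^sub>0 + \<theta>} \<omega> * indicator {\<mu>\<^sub>0 - \<theta>..\<mu>\<^sub>0 + \<theta>} (- \<mu>) :: real"
  have y: "\<bar>y\<bar> \<le> H * ?b"
  proof -
    have "\<bar>y\<bar> \<le> H * indicator {-\<theta>..\<theta>} (t - \<epsilon> * s) * indicator {\<mu>\<^sub>0 - \<theta>..\<mu>\<^sub>0 + \<theta>} (- \<mu>) * indicator {\<omega>\<^sub>0 - \<theta>..\<omega>\<^sub>0 + \<theta>} \<omega>"
      unfolding y_def by (rule r1.src)
    also have "\<dots> \<le> H * ?b"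
      using r1.H_nonneg by (auto simp: indicator_def)
    finally show ?thesis .
  qed
  have diff: "r1.reflected t 0 \<mu> \<omega> - r2.reflected t 0 \<mu> \<omega> =
      (if \<epsilon> * s < t then (\<eta>\<^sub>1 \<omega> - \<eta>\<^sub>2 \<omega>) * exp (- s / (\<epsilon> * \<tau> \<omega>)) * y else 0)"
    unfolding r1.reflected_def r2.reflected_def y_def Let_def diff_0_right s_def[symmetric]
    by (simp add: left_diff_distrib)
  have "\<bar>r1.reflected t 0 \<mu> \<omega> - r2.reflected t 0 \<mu> \<omega>\<bar> \<le> \<bar>\<eta>\<^sub>1 \<omega> - \<eta>\<^sub>2 \<omega>\<bar> * exp (- s / (\<epsilon> * \<tau> \<omega>)) * \<bar>y\<bar>"
    unfolding diff by (simp add: abs_mult)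
  also have "\<dots> \<le> D * e * (H * ?b)"
  proof (cases "?b = 0")
    case True
    from y have "y = 0" unfolding True by simp
    then show ?thesis unfolding True by simp
  next
    case False
    then have b: "\<bar>\<omega> - \<omega>\<^sub>0\<bar> \<le> \<theta>" "\<bar>- \<mu> - \<mu>\<^sub>0\<bar> \<le> \<theta>"
      by (auto simp: indicator_def split: if_splits)
    have "exp (- s / (\<epsilon> * \<tau> \<omega>)) \<le> e"
      using e[OF \<omega> b(1) _ b(2)] \<mu> by (simp add: s_def)
    then show ?thesis
      using D[OF \<omega> b(1)] De y by (intro mult_mono) auto
  qed
  finally show ?thesis by (simp add: mult.assoc)
qed

lemma phase_avg_backward_beam:
  assumes "\<theta> \<ge> 0"
  shows "phase_avg (indicator {0<..}) (\<lambda>\<mu> \<omega>. ennreal c * (indicator {\<omega>\<^sub>0 - \<theta>..\<omega>\<^sub>0 + \<theta>} \<omega> * indicator {\<mu>\<^sub>0 - \<theta>..\<mu>\<^sub>0 + \<theta>} (- \<mu>)))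
    \<le> ennreal c * ennreal (4 * \<theta>\<^sup>2)"
proof -
  let ?I = "\<lambda>a. indicator {a - \<theta>..a + \<theta>} :: real \<Rightarrow> ennreal"
  have "phase_avg (indicator {0<..}) (\<lambda>\<mu> \<omega>. ennreal c * (?I \<omega>\<^sub>0 \<omega> * ?I \<mu>\<^sub>0 (- \<mu>))) \<le>
      (\<integral>\<^sup>+\<mu>. (\<integral>\<^sup>+\<omega>. ennreal c * ?I (-\<mu>\<^sub>0) \<mu> * ?I \<omega>\<^sub>0 \<omega> \<partial>lborel) \<partial>lborel)"
    unfolding phase_avg_def
  proof (intro nn_integral_mono)
    fix \<mu> :: real
    have "(\<integral>\<^sup>+\<omega>. indicator {0<..} \<omega> * (ennreal c * (?I \<omega>\<^sub>0 \<omega> * ?I \<mu>\<^sub>0 (- \<mu>))) \<partial>lborel) * indicator {-1..1} \<mu>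
      \<le> (\<integral>\<^sup>+\<omega>. indicator {0<..} \<omega> * (ennreal c * (?I \<omega>\<^sub>0 \<omega> * ?I \<mu>\<^sub>0 (- \<mu>))) \<partial>lborel)"
      by (auto simp: indicator_def)
    also have "\<dots> \<le> (\<integral>\<^sup>+\<omega>. ennreal c * ?I (-\<mu>\<^sub>0) \<mu> * ?I \<omega>\<^sub>0 \<omega> \<partial>lborel)"
      by (intro nn_integral_mono) (auto simp: indicator_def)
    finally show "(\<integral>\<^sup>+\<omega>. indicator {0<..} \<omega> * (ennreal c * (?I \<omega>\<^sub>0 \<omega> * ?I \<mu>\<^sub>0 (- \<mu>))) \<partial>lborel) * indicator {-1..1} \<mu>
      \<le> (\<integral>\<^sup>+\<omega>. ennreal c * ?I (-\<mu>\<^sub>0) \<mu> * ?I \<omega>\<^sub>0 \<omega> \<partial>lborel)" .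
  qed
  also have "\<dots> = (\<integral>\<^sup>+\<mu>. ennreal c * ?I (-\<mu>\<^sub>0) \<mu> * ennreal (2 * \<theta>) \<partial>lborel)"
    using assms by (intro nn_integral_cong) (subst nn_integral_cmult_indicator, auto)
  also have "\<dots> = ennreal c * ennreal (2 * \<theta>) * ennreal (2 * \<theta>)"
    using assms by (subst nn_integral_multc) (auto simp: nn_integral_cmult)
  also have "\<dots> = ennreal c * ennreal (4 * \<theta>\<^sup>2)"
    using assms by (subst mult.assoc, subst ennreal_mult[symmetric]) (auto simp: power2_eq_square)
  finally show ?thesis .
qed

text \<open>
  Both solutions are replaced by their ballistic parts at the cost of the scattered remainders.
  The ballistic difference lives on the reflected beam, a box of area \<open>4 \<theta>\<^sup>2\<close> in \<open>(\<mu>, \<omega>)\<close>.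
\<close>

lemma trace_difference_le:
  assumes r1: "coupled_run C \<tau> \<tau>\<^sub>s \<nu> \<nu>\<^sub>s \<epsilon> \<tau>\<^sub>0 v\<^sub>0 v\<^sub>1 L T \<theta> H \<mu>\<^sub>0 \<omega>\<^sub>0 \<eta>\<^sub>1 \<phi> f\<^sub>1 g\<^sub>1"
    and r2: "coupled_run C \<tau> \<tau>\<^sub>s \<nu> \<nu>\<^sub>s \<epsilon> \<tau>\<^sub>0 v\<^sub>0 v\<^sub>1 L T \<theta> H \<mu>\<^sub>0 \<omega>\<^sub>0 \<eta>\<^sub>2 \<phi> f\<^sub>2 g\<^sub>2"
    and D: "\<And>\<omega>. \<omega> > 0 \<Longrightarrow> \<bar>\<omega> - \<omega>\<^sub>0\<bar> \<le> \<theta> \<Longrightarrow> \<bar>\<eta>\<^sub>1 \<omega> - \<eta>\<^sub>2 \<omega>\<bar> \<le> D"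
    and e: "\<And>\<mu> \<omega>. \<omega> > 0 \<Longrightarrow> \<bar>\<omega> - \<omega>\<^sub>0\<bar> \<le> \<theta> \<Longrightarrow> 0 < \<mu> \<Longrightarrow> \<bar>\<mu> - \<mu>\<^sub>0\<bar> \<le> \<theta> \<Longrightarrow>
      exp (- (2 / (\<mu> * \<nu> \<omega>)) / (\<epsilon> * \<tau> \<omega>)) \<le> e"
    and De: "D \<ge> 0" "e \<ge> 0" and t: "0 < t" "t \<le> T" and \<delta>: "\<delta> > 0"
  shows "\<bar>Delta_T C \<tau> f\<^sub>1 t 0 - Delta_T C \<tau> f\<^sub>2 t 0\<bar> \<le>
    4 * (H * \<theta>\<^sup>2) * D * e / (\<tau>\<^sub>0 * C_tau C \<tau>) +
    6 * \<kappa> * (2 * field_sup H \<theta> T * \<delta> + field_mass H \<theta> T * T / (\<epsilon> * v\<^sub>0 * \<delta>))"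
proof -
  interpret r1: coupled_run C \<tau> \<tau>\<^sub>s \<nu> \<nu>\<^sub>s \<epsilon> \<tau>\<^sub>0 v\<^sub>0 v\<^sub>1 L T \<theta> H \<mu>\<^sub>0 \<omega>\<^sub>0 \<eta>\<^sub>1 \<phi> f\<^sub>1 g\<^sub>1 by fact
  interpret r2: coupled_run C \<tau> \<tau>\<^sub>s \<nu> \<nu>\<^sub>s \<epsilon> \<tau>\<^sub>0 v\<^sub>0 v\<^sub>1 L T \<theta> H \<mu>\<^sub>0 \<omega>\<^sub>0 \<eta>\<^sub>2 \<phi> f\<^sub>2 g\<^sub>2 by fact
  let ?c = "C_tau C \<tau>"
  define S where "S = 2 * field_sup H \<theta> T * \<delta> + field_mass H \<theta> T * T / (\<epsilon> * v\<^sub>0 * \<delta>)"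
  have c: "?c > 0" by (rule C_tau_both_pos(1))
  have H: "H \<ge> 0" and \<theta>: "\<theta> > 0" and T: "T > 0"
    using r1.H_nonneg r1.theta_pos r1.T_pos by auto
  have S: "S \<ge> 0"
    unfolding S_def using field_sup_nonneg[of H \<theta> T] field_mass_nonneg[of H \<theta> T] H \<theta> T \<delta> eps_pos v0_pos by auto
  define Z :: "real \<Rightarrow> real \<Rightarrow> ennreal" where
    "Z \<mu> \<omega> = ennreal (D * e * H) * (indicator {\<omega>\<^sub>0 - \<theta>..\<omega>\<^sub>0 + \<theta>} \<omega> * indicator {\<mu>\<^sub>0 - \<theta>..\<mu>\<^sub>0 + \<theta>} (- \<mu>))" for \<mu> \<omega>
  define R1 where "R1 = ray_sum \<epsilon> (vel \<nu>) (vel \<nu>\<^sub>s) r1.field t 0"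
  define R2 where "R2 = ray_sum \<epsilon> (vel \<nu>) (vel \<nu>\<^sub>s) r2.field t 0"
  have [measurable]: "case_prod Z \<in> borel_measurable (borel \<Otimes>\<^sub>M borel)"
    unfolding Z_def by measurable
  have [measurable]: "case_prod R1 \<in> borel_measurable (borel \<Otimes>\<^sub>M borel)"
    unfolding R1_def by measurable
  have [measurable]: "case_prod R2 \<in> borel_measurable (borel \<Otimes>\<^sub>M borel)"
    unfolding R2_def by measurable
  have "ennreal \<bar>phonon_avg (\<lambda>\<mu> \<omega>. f\<^sub>1 t 0 \<mu> \<omega> / \<tau> \<omega>) - phonon_avg (\<lambda>\<mu> \<omega>. f\<^sub>2 t 0 \<mu> \<omega> / \<tau> \<omega>)\<bar> \<le>
      phase_avg (indicator {0<..}) (\<lambda>\<mu> \<omega>. ennreal \<bar>f\<^sub>1 t 0 \<mu> \<omega> / \<tau> \<omega> - f\<^sub>2 t 0 \<mu> \<omega> / \<tau> \<omega>\<bar>)"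
    using t by (intro phonon_avg_diff_abs_le r1.trace_section_meas r2.trace_section_meas
        r1.trace_phase_avg_finite r2.trace_phase_avg_finite) auto
  also have "\<dots> = phase_avg (indicator {0<..}) (\<lambda>\<mu> \<omega>. ennreal \<bar>(f\<^sub>1 t 0 \<mu> \<omega> - f\<^sub>2 t 0 \<mu> \<omega>) / \<tau> \<omega>\<bar>)"
    by (simp add: diff_divide_distrib)
  also have "\<dots> \<le> ennreal ?c * (ennreal (1 / (\<tau>\<^sub>0 * ?c)) * phase_avg (indicator {0<..}) Z +
      ennreal \<kappa> * phase_avg (weight C \<tau>) (\<lambda>\<mu> \<omega>. R1 \<mu> \<omega> + R2 \<mu> \<omega>))"
  proof (rule phase_avg_over_tau_le)
    fix \<mu> \<omega> :: real assume \<mu>: "-1 \<le> \<mu>" "\<mu> \<le> 1" and \<omega>: "\<omega> > 0"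
    let ?d1 = "if \<mu> > 0 then \<phi> t \<mu> \<omega> else if \<mu> < 0 then r1.reflected t 0 \<mu> \<omega> else 0"
    let ?d2 = "if \<mu> > 0 then \<phi> t \<mu> \<omega> else if \<mu> < 0 then r2.reflected t 0 \<mu> \<omega> else 0"
    have "ennreal \<bar>?d1 - ?d2\<bar> \<le> Z \<mu> \<omega>"
    proof (cases "\<mu> < 0")
      case True
      then have "ennreal \<bar>?d1 - ?d2\<bar> \<le> ennreal (D * e * H * (indicator {\<omega>\<^sub>0 - \<theta>..\<omega>\<^sub>0 + \<theta>} \<omega> * indicator {\<mu>\<^sub>0 - \<theta>..\<mu>\<^sub>0 + \<theta>} (- \<mu>)))"
        using reflected_difference_le[OF r1 r2 D e De True \<omega>] by (simp add: ennreal_leI)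
      also have "\<dots> = Z \<mu> \<omega>"
        unfolding Z_def by (auto simp: indicator_def)
      finally show ?thesis .
    qed auto
    moreover have "ennreal \<bar>f\<^sub>1 t 0 \<mu> \<omega> - ?d1\<bar> \<le> ennreal (\<kappa> * C \<omega>) * R1 \<mu> \<omega>"
      unfolding R1_def using t \<mu> \<omega> by (rule r1.trace_remainder)
    moreover have "ennreal \<bar>f\<^sub>2 t 0 \<mu> \<omega> - ?d2\<bar> \<le> ennreal (\<kappa> * C \<omega>) * R2 \<mu> \<omega>"
      unfolding R2_def using t \<mu> \<omega> by (rule r2.trace_remainder)
    moreover have "ennreal \<bar>f\<^sub>1 t 0 \<mu> \<omega> - f\<^sub>2 t 0 \<mu> \<omega>\<bar> \<le> ennreal \<bar>?d1 - ?d2\<bar> + (ennreal \<bar>f\<^sub>1 t 0 \<mu> \<omega> - ?d1\<bar> + ennreal \<bar>f\<^sub>2 t 0 \<mu> \<omega> - ?d2\<bar>)"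
    proof -
      have tri: "\<bar>a - b\<bar> \<le> \<bar>x - y\<bar> + (\<bar>a - x\<bar> + \<bar>b - y\<bar>)" for a b x y :: real by linarith
      show ?thesis
        using ennreal_leI[OF tri[of "f\<^sub>1 t 0 \<mu> \<omega>" "f\<^sub>2 t 0 \<mu> \<omega>" ?d1 ?d2]] by simp
    qed
    ultimately show "ennreal \<bar>f\<^sub>1 t 0 \<mu> \<omega> - f\<^sub>2 t 0 \<mu> \<omega>\<bar> \<le> Z \<mu> \<omega> + ennreal (\<kappa> * C \<omega>) * (R1 \<mu> \<omega> + R2 \<mu> \<omega>)"
      unfolding distrib_left by (meson add_mono order_trans)
  qed auto
  also have "phase_avg (weight C \<tau>) (\<lambda>\<mu> \<omega>. R1 \<mu> \<omega> + R2 \<mu> \<omega>) = upper.scatter r1.field t 0 + upper.scatter r2.field t 0"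
    unfolding upper.scatter_def R1_def[symmetric] R2_def[symmetric] by (rule phase_avg_add) measurable
  also have "ennreal ?c * (ennreal (1 / (\<tau>\<^sub>0 * ?c)) * phase_avg (indicator {0<..}) Z +
        ennreal \<kappa> * (upper.scatter r1.field t 0 + upper.scatter r2.field t 0)) \<le>
      ennreal ?c * (ennreal (1 / (\<tau>\<^sub>0 * ?c)) * (ennreal (D * e * H) * ennreal (4 * \<theta>\<^sup>2)) +
        ennreal \<kappa> * (ennreal (3 * S) + ennreal (3 * S)))"
    unfolding Z_def S_def using t \<delta> \<theta>
    by (intro mult_left_mono add_mono phase_avg_backward_beam r1.trace_scatter_le r2.trace_scatter_le) auto
  also have "\<dots> = ennreal (?c * (1 / (\<tau>\<^sub>0 * ?c) * (D * e * H * (4 * \<theta>\<^sup>2)) + \<kappa> * (3 * S + 3 * S)))"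
  proof -
    have arith: "ennreal c * (ennreal a * (ennreal p * ennreal q) + ennreal k * (ennreal r + ennreal r)) =
        ennreal (c * (a * (p * q) + k * (r + r)))"
      if "a \<ge> 0" "c \<ge> 0" "k \<ge> 0" "p \<ge> 0" "q \<ge> 0" "r \<ge> 0" for a c k p q r
      using that by (simp only: ennreal_mult ennreal_plus mult_nonneg_nonneg add_nonneg_nonneg)
    show ?thesis
      by (rule arith) (use De H c tau0_pos eps_pos S in auto)
  qed
  finally have main: "\<bar>phonon_avg (\<lambda>\<mu> \<omega>. f\<^sub>1 t 0 \<mu> \<omega> / \<tau> \<omega>) - phonon_avg (\<lambda>\<mu> \<omega>. f\<^sub>2 t 0 \<mu> \<omega> / \<tau> \<omega>)\<bar> \<le>
      ?c * (1 / (\<tau>\<^sub>0 * ?c) * (D * e * H * (4 * \<theta>\<^sup>2)) + \<kappa> * (3 * S + 3 * S))"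
    using De H c tau0_pos S eps_pos by (subst (asm) ennreal_le_iff) (auto intro!: mult_nonneg_nonneg add_nonneg_nonneg)
  have "\<bar>Delta_T C \<tau> f\<^sub>1 t 0 - Delta_T C \<tau> f\<^sub>2 t 0\<bar> =
      \<bar>phonon_avg (\<lambda>\<mu> \<omega>. f\<^sub>1 t 0 \<mu> \<omega> / \<tau> \<omega>) - phonon_avg (\<lambda>\<mu> \<omega>. f\<^sub>2 t 0 \<mu> \<omega> / \<tau> \<omega>)\<bar> / ?c"
    using c by (simp add: Delta_T_def abs_divide flip: diff_divide_distrib)
  also have "\<dots> \<le> ?c * (1 / (\<tau>\<^sub>0 * ?c) * (D * e * H * (4 * \<theta>\<^sup>2)) + \<kappa> * (3 * S + 3 * S)) / ?c"
    using main c by (intro divide_right_mono) auto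
  also have "\<dots> = 4 * (H * \<theta>\<^sup>2) * D * e / (\<tau>\<^sub>0 * ?c) + 6 * \<kappa> * S"
  proof -
    have "?c * X / ?c = X" for X using c by simp
    then show ?thesis by (simp add: mult_ac)
  qed
  finally show ?thesis unfolding S_def .
qed

text \<open>
  The supremum bound on the temperature is also what makes both integrands integrable; otherwise the
  two measurements could not be subtracted under the integral.
\<close>

lemma measurement_difference_le:
  assumes r1: "coupled_run C \<tau> \<tau>\<^sub>s \<nu> \<nu>\<^sub>s \<epsilon> \<tau>\<^sub>0 v\<^sub>0 v\<^sub>1 L T \<theta> H \<mu>\<^sub>0 \<omega>\<^sub>0 \<eta>\<^sub>1 \<phi> f\<^sub>1 g\<^sub>1"
    and r2: "coupled_run C \<tau> \<tau>\<^sub>s \<nu> \<nu>\<^sub>s \<epsilon> \<tau>\<^sub>0 v\<^sub>0 v\<^sub>1 L T \<theta> H \<mu>\<^sub>0 \<omega>\<^sub>0 \<eta>\<^sub>2 \<phi> f\<^sub>2 g\<^sub>2"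
    and X: "\<And>t. 0 < t \<Longrightarrow> t \<le> T \<Longrightarrow> \<bar>Delta_T C \<tau> f\<^sub>1 t 0 - Delta_T C \<tau> f\<^sub>2 t 0\<bar> \<le> X" "X \<ge> 0"
    and \<psi>: "integrable lborel \<psi>" "\<And>t. \<psi> t \<noteq> 0 \<Longrightarrow> 0 < t \<and> t \<le> T"
  shows "\<bar>measurement C \<tau> tmax \<psi> f\<^sub>1 - measurement C \<tau> tmax \<psi> f\<^sub>2\<bar> \<le> X * (LINT t|lborel. \<bar>\<psi> t\<bar>)"
proof -
  interpret r1: coupled_run C \<tau> \<tau>\<^sub>s \<nu> \<nu>\<^sub>s \<epsilon> \<tau>\<^sub>0 v\<^sub>0 v\<^sub>1 L T \<theta> H \<mu>\<^sub>0 \<omega>\<^sub>0 \<eta>\<^sub>1 \<phi> f\<^sub>1 g\<^sub>1 by fact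
  interpret r2: coupled_run C \<tau> \<tau>\<^sub>s \<nu> \<nu>\<^sub>s \<epsilon> \<tau>\<^sub>0 v\<^sub>0 v\<^sub>1 L T \<theta> H \<mu>\<^sub>0 \<omega>\<^sub>0 \<eta>\<^sub>2 \<phi> f\<^sub>2 g\<^sub>2 by fact
  let ?F = "\<lambda>f t. indicat_real {0..tmax} t *\<^sub>R (Delta_T C \<tau> f t 0 * \<psi> t)"
  have int: "integrable lborel (?F f)"
    if m: "(\<lambda>t. indicator {0..T} t * Delta_T C \<tau> f t 0) \<in> borel_measurable borel"
      and b: "\<And>t. 0 \<le> t \<Longrightarrow> t \<le> T \<Longrightarrow> \<bar>Delta_T C \<tau> f t 0\<bar> \<le> B" for f B
  proof (rule Bochner_Integration.integrable_bound)
    show "integrable lborel (\<lambda>t. B * \<bar>\<psi> t\<bar>)" using \<psi>(1) by simp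
    have "?F f = (\<lambda>t. indicator {0..tmax} t * ((indicator {0..T} t * Delta_T C \<tau> f t 0) * \<psi> t))"
      using \<psi>(2) by (fastforce simp: fun_eq_iff indicator_def)
    also have "\<dots> \<in> borel_measurable lborel"
    proof -
      have "(\<lambda>t. indicat_real {0..T} t * Delta_T C \<tau> f t 0) \<in> borel_measurable lborel"
        using m by simp
      from borel_measurable_times[OF _ borel_measurable_times[OF this borel_measurable_integrable[OF \<psi>(1)]]]
      show ?thesis by simp
    qed
    finally show "?F f \<in> borel_measurable lborel" .
    show "AE t in lborel. norm (?F f t) \<le> norm (B * \<bar>\<psi> t\<bar>)"
    proof (rule AE_I2)
      fix t
      show "norm (?F f t) \<le> norm (B * \<bar>\<psi> t\<bar>)"
      proof (cases "\<psi> t = 0")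
        case False
        then have "\<bar>Delta_T C \<tau> f t 0\<bar> \<le> \<bar>B\<bar>" using b[of t] \<psi>(2)[of t] by auto
        then show ?thesis by (auto simp: indicator_def abs_mult mult_right_mono)
      qed simp
    qed
  qed
  have i1: "integrable lborel (?F f\<^sub>1)" by (rule int[OF r1.trace_meas r1.trace_abs_le])
  have i2: "integrable lborel (?F f\<^sub>2)" by (rule int[OF r2.trace_meas r2.trace_abs_le])
  have diff: "measurement C \<tau> tmax \<psi> f\<^sub>1 - measurement C \<tau> tmax \<psi> f\<^sub>2 = (LINT t|lborel. ?F f\<^sub>1 t - ?F f\<^sub>2 t)"
    unfolding measurement_def set_lebesgue_integral_def using i1 i2 by (rule Bochner_Integration.integral_diff[symmetric])
  have "\<bar>measurement C \<tau> tmax \<psi> f\<^sub>1 - measurement C \<tau> tmax \<psi> f\<^sub>2\<bar> \<le> (LINT t|lborel. \<bar>?F f\<^sub>1 t - ?F f\<^sub>2 t\<bar>)"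
    unfolding diff by (rule integral_abs_bound)
  also have "\<dots> \<le> (LINT t|lborel. X * \<bar>\<psi> t\<bar>)"
  proof (rule integral_mono)
    show "integrable lborel (\<lambda>t. \<bar>?F f\<^sub>1 t - ?F f\<^sub>2 t\<bar>)" using i1 i2 by (intro integrable_abs Bochner_Integration.integrable_diff)
    show "integrable lborel (\<lambda>t. X * \<bar>\<psi> t\<bar>)" using \<psi>(1) by simp
    fix t
    have eq: "?F f\<^sub>1 t - ?F f\<^sub>2 t = indicat_real {0..tmax} t * ((Delta_T C \<tau> f\<^sub>1 t 0 - Delta_T C \<tau> f\<^sub>2 t 0) * \<psi> t)"
      by (simp add: algebra_simps)
    show "\<bar>?F f\<^sub>1 t - ?F f\<^sub>2 t\<bar> \<le> X * \<bar>\<psi> t\<bar>"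
    proof (cases "\<psi> t = 0")
      case False
      then have "\<bar>Delta_T C \<tau> f\<^sub>1 t 0 - Delta_T C \<tau> f\<^sub>2 t 0\<bar> * \<bar>\<psi> t\<bar> \<le> X * \<bar>\<psi> t\<bar>"
        using \<psi>(2)[of t] by (intro mult_right_mono X) auto
      then show ?thesis
        unfolding eq using \<open>X \<ge> 0\<close> by (auto simp: indicator_def abs_mult)
    qed simp
  qed
  also have "\<dots> = X * (LINT t|lborel. \<bar>\<psi> t\<bar>)" by simp
  finally show ?thesis .
qed

end

section \<open>Concentrated sources\<close>

lemma smooth_profile_bounded:
  assumes "smooth_fun u" and supp: "\<forall>s. s \<notin> {-1..1} \<longrightarrow> u s = 0"
  obtains B where "B > 0" "\<And>s. \<bar>u s\<bar> \<le> B"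
proof -
  have "(deriv ^^ 0) u differentiable_on UNIV"
    using assms(1) unfolding smooth_fun_def by blast
  then have "u differentiable_on UNIV"
    by (simp only: funpow_0)
  then have "continuous_on UNIV u"
    by (rule differentiable_imp_continuous_on)
  then have "continuous_on {-1..1} u"
    by (rule continuous_on_subset) simp
  then have "compact (u ` {-1..1})"
    by (rule compact_continuous_image) (rule compact_Icc)
  then obtain B where B: "B > 0" "\<forall>y\<in>u ` {-1..1}. norm y \<le> B"
    using compact_imp_bounded bounded_pos by blast
  have "\<bar>u s\<bar> \<le> B" for s
    using B supp by (cases "s \<in> {-1..1}") auto
  with B(1) show ?thesis by (rule that)
qed

text \<open>
  On a bounded set \<open>L\<^sup>q\<close> is contained in \<open>L\<^sup>1\<close>.
\<close>

lemma integrable_powr_support: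
  fixes u :: "real \<Rightarrow> real"
  assumes [measurable]: "u \<in> borel_measurable borel" and int: "integrable lborel (\<lambda>s. \<bar>u s\<bar> powr q)"
    and supp: "\<forall>s. s \<notin> {-1<..<1} \<longrightarrow> u s = 0" and "q \<ge> 1"
  shows "integrable lborel u"
proof (rule Bochner_Integration.integrable_bound)
  show "integrable lborel (\<lambda>s. indicat_real {-1..1} s + \<bar>u s\<bar> powr q)"
    using int by (intro Bochner_Integration.integrable_add) auto
  show "AE s in lborel. norm (u s) \<le> norm (indicat_real {-1..1} s + \<bar>u s\<bar> powr q)"
  proof (rule AE_I2)
    fix s
    have "\<bar>u s\<bar> \<le> indicat_real {-1..1} s + \<bar>u s\<bar> powr q"
    proof (cases "s \<in> {-1<..<1}")
      case True
      show ?thesis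
      proof (cases "\<bar>u s\<bar> \<le> 1")
        case False
        then have "\<bar>u s\<bar> powr 1 \<le> \<bar>u s\<bar> powr q" using \<open>q \<ge> 1\<close> by (intro powr_mono) auto
        then show ?thesis using False by (simp add: add_increasing)
      qed (use True in \<open>auto simp: add_increasing2\<close>)
    qed (use supp in auto)
    also have "\<dots> \<le> norm (indicat_real {-1..1} s + \<bar>u s\<bar> powr q)" by simp
    finally show "norm (u s) \<le> norm (indicat_real {-1..1} s + \<bar>u s\<bar> powr q)" by simp
  qed
qed simp

lemma C_omega_pos:
  assumes "hbar > 0" "kB > 0" "T0 > 0" "D \<omega> > 0" "\<omega> > 0"
  shows "C_omega hbar kB T0 D \<omega> > 0"
proof -
  have "exp (hbar * \<omega> / (kB * T0)) > 1" using assms by simp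
  then have "F0_star hbar kB T0 D \<omega> > 0"
    using assms by (simp add: F0_star_def)
  then show ?thesis using assms by (simp add: C_omega_def)
qed

lemma integrable_window_test:
  assumes "integrable lborel u" "\<theta> > 0"
  shows "integrable lborel (window_test u t\<^sub>1 \<theta>)"
    and "(LINT t|lborel. \<bar>window_test u t\<^sub>1 \<theta> t\<bar>) = \<theta> * (LINT s|lborel. \<bar>u s\<bar>)"
proof -
  have eq: "(t - t\<^sub>1) / \<theta> = - t\<^sub>1 / \<theta> + (1 / \<theta>) * t" for t
    by (simp add: diff_divide_distrib)
  have "window_test u t\<^sub>1 \<theta> = (\<lambda>t. u (- t\<^sub>1 / \<theta> + (1 / \<theta>) * t))"
    by (rule ext) (simp only: window_test_def eq)
  then show "integrable lborel (window_test u t\<^sub>1 \<theta>)"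
    using lborel_integrable_real_affine[OF assms(1), of "1 / \<theta>" "- t\<^sub>1 / \<theta>"] assms(2) by simp
  have "(LINT s|lborel. \<bar>u s\<bar>) = \<bar>1 / \<theta>\<bar> *\<^sub>R (LINT t|lborel. \<bar>u (- t\<^sub>1 / \<theta> + (1 / \<theta>) * t)\<bar>)"
    using assms(2) by (intro lborel_integral_real_affine) auto
  also have "(LINT t|lborel. \<bar>u (- t\<^sub>1 / \<theta> + (1 / \<theta>) * t)\<bar>) = (LINT t|lborel. \<bar>window_test u t\<^sub>1 \<theta> t\<bar>)"
    by (simp only: window_test_def eq)
  finally show "(LINT t|lborel. \<bar>window_test u t\<^sub>1 \<theta> t\<bar>) = \<theta> * (LINT s|lborel. \<bar>u s\<bar>)"
    using assms(2) by simp
qed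

lemma concentrated_source_abs_le:
  assumes u: "\<And>s. \<bar>\<phi>\<^sub>t s\<bar> \<le> B\<^sub>t" "\<And>s. \<bar>\<phi>\<^sub>\<mu> s\<bar> \<le> B\<^sub>\<mu>" "\<And>s. \<bar>\<phi>\<^sub>\<omega> s\<bar> \<le> B\<^sub>\<omega>"
    and supp: "\<forall>s. s \<notin> {-1..1} \<longrightarrow> \<phi>\<^sub>t s = 0" "\<forall>s. s \<notin> {-1..1} \<longrightarrow> \<phi>\<^sub>\<mu> s = 0" "\<forall>s. s \<notin> {-1..1} \<longrightarrow> \<phi>\<^sub>\<omega> s = 0"
    and \<theta>: "\<theta> > 0"
  shows "\<bar>concentrated_source \<phi>\<^sub>t \<phi>\<^sub>\<mu> \<phi>\<^sub>\<omega> \<mu>\<^sub>0 \<omega>\<^sub>0 \<theta> \<theta> \<theta> t \<mu> \<omega>\<bar> \<le>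
    (B\<^sub>t * B\<^sub>\<mu> * B\<^sub>\<omega>) / \<theta> ^ 3 * indicator {-\<theta>..\<theta>} t * indicator {\<mu>\<^sub>0 - \<theta>..\<mu>\<^sub>0 + \<theta>} \<mu> * indicator {\<omega>\<^sub>0 - \<theta>..\<omega>\<^sub>0 + \<theta>} \<omega>"
proof -
  have cut: "\<bar>u ((s - c) / \<theta>)\<bar> \<le> B * indicator {c - \<theta>..c + \<theta>} s"
    if "\<And>s. \<bar>u s\<bar> \<le> B" "\<forall>s. s \<notin> {-1..1} \<longrightarrow> u s = 0" for u s c and B :: real
  proof (cases "(s - c) / \<theta> \<in> {-1..1}")
    case True
    then have "s \<in> {c - \<theta>..c + \<theta>}" using \<theta> by (auto simp: field_simps)
    then show ?thesis using that(1) by simp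
  next
    case False
    then have "u ((s - c) / \<theta>) = 0" using that(2) by blast
    moreover have "B \<ge> 0" using that(1)[of 0] by linarith
    ultimately show ?thesis by simp
  qed
  have "\<bar>concentrated_source \<phi>\<^sub>t \<phi>\<^sub>\<mu> \<phi>\<^sub>\<omega> \<mu>\<^sub>0 \<omega>\<^sub>0 \<theta> \<theta> \<theta> t \<mu> \<omega>\<bar> =
      1 / \<theta> ^ 3 * (\<bar>\<phi>\<^sub>t ((t - 0) / \<theta>)\<bar> * \<bar>\<phi>\<^sub>\<mu> ((\<mu> - \<mu>\<^sub>0) / \<theta>)\<bar> * \<bar>\<phi>\<^sub>\<omega> ((\<omega> - \<omega>\<^sub>0) / \<theta>)\<bar>)"
    using \<theta> by (simp add: concentrated_source_def abs_mult power3_eq_cube)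
  also have "\<dots> \<le> 1 / \<theta> ^ 3 * ((B\<^sub>t * indicator {0 - \<theta>..0 + \<theta>} t) * (B\<^sub>\<mu> * indicator {\<mu>\<^sub>0 - \<theta>..\<mu>\<^sub>0 + \<theta>} \<mu>) *
      (B\<^sub>\<omega> * indicator {\<omega>\<^sub>0 - \<theta>..\<omega>\<^sub>0 + \<theta>} \<omega>))"
  proof -
    have "B\<^sub>t \<ge> 0" "B\<^sub>\<mu> \<ge> 0" "B\<^sub>\<omega> \<ge> 0" using u(1)[of 0] u(2)[of 0] u(3)[of 0] by linarith+
    then show ?thesis using \<theta> by (intro mult_left_mono mult_mono cut u supp) auto
  qed
  finally show ?thesis by (simp add: mult_ac)
qed

context two_media
begin

text \<open>
  With \<open>H = B / \<theta>\<^sup>3\<close> the supremum bound scales like \<open>1 / \<theta>\<close> and the mass bound not at all. The choice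
  \<open>\<delta> = sqrt \<theta>\<close> balances the two scattered contributions, and the factor \<open>\<theta>\<close> from the test function
  turns \<open>1 / sqrt \<theta>\<close> into \<open>sqrt \<theta>\<close>; in the ballistic term it compensates \<open>H \<theta>\<^sup>2 = B / \<theta>\<close>.
\<close>

lemma concentrated_measurement_le:
  assumes sol1: "coupled_solution C L \<epsilon> \<nu> \<tau> \<nu>\<^sub>s \<tau>\<^sub>s \<eta>\<^sub>1 \<phi> f\<^sub>1 g\<^sub>1" and unit1: "interface_coeffs_in_unit \<nu> \<nu>\<^sub>s \<eta>\<^sub>1"
    and sol2: "coupled_solution C L \<epsilon> \<nu> \<tau> \<nu>\<^sub>s \<tau>\<^sub>s \<eta>\<^sub>2 \<phi> f\<^sub>2 g\<^sub>2" and unit2: "interface_coeffs_in_unit \<nu> \<nu>\<^sub>s \<eta>\<^sub>2"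
    and L: "L > 0" and \<theta>: "0 < \<theta>" "\<theta> \<le> 1" "\<theta> \<le> t\<^sub>1" and B: "B \<ge> 0"
    and src: "\<And>t \<mu> \<omega>. \<bar>\<phi> t \<mu> \<omega>\<bar> \<le>
      B / \<theta> ^ 3 * indicator {-\<theta>..\<theta>} t * indicator {\<mu>\<^sub>0 - \<theta>..\<mu>\<^sub>0 + \<theta>} \<mu> * indicator {\<omega>\<^sub>0 - \<theta>..\<omega>\<^sub>0 + \<theta>} \<omega>"
    and \<psi>: "integrable lborel \<psi>\<^sub>t" "\<forall>s. s \<notin> {-1<..<1} \<longrightarrow> \<psi>\<^sub>t s = 0"
    and D: "\<And>\<omega>. \<omega> > 0 \<Longrightarrow> \<bar>\<omega> - \<omega>\<^sub>0\<bar> \<le> \<theta> \<Longrightarrow> \<bar>\<eta>\<^sub>1 \<omega> - \<eta>\<^sub>2 \<omega>\<bar> \<le> D"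
    and e: "\<And>\<mu> \<omega>. \<omega> > 0 \<Longrightarrow> \<bar>\<omega> - \<omega>\<^sub>0\<bar> \<le> \<theta> \<Longrightarrow> 0 < \<mu> \<Longrightarrow> \<bar>\<mu> - \<mu>\<^sub>0\<bar> \<le> \<theta> \<Longrightarrow>
      exp (- (2 / (\<mu> * \<nu> \<omega>)) / (\<epsilon> * \<tau> \<omega>)) \<le> e"
    and De: "D \<ge> 0" "e \<ge> 0"
  shows "\<bar>measurement C \<tau> tmax (window_test \<psi>\<^sub>t t\<^sub>1 \<theta>) f\<^sub>1 - measurement C \<tau> tmax (window_test \<psi>\<^sub>t t\<^sub>1 \<theta>) f\<^sub>2\<bar> \<le>
    4 * B * (LINT s|lborel. \<bar>\<psi>\<^sub>t s\<bar>) / (\<tau>\<^sub>0 * C_tau C \<tau>) * D * e +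
    6 * \<kappa> * (LINT s|lborel. \<bar>\<psi>\<^sub>t s\<bar>) *
      (2 * field_sup B 1 (t\<^sub>1 + 1) + field_mass B 1 (t\<^sub>1 + 1) * (t\<^sub>1 + 1) / (\<epsilon> * v\<^sub>0)) * sqrt \<theta>"
proof -
  define T where "T = t\<^sub>1 + 1"
  define H where "H = B / \<theta> ^ 3"
  define I where "I = (LINT s|lborel. \<bar>\<psi>\<^sub>t s\<bar>)"
  have T: "T > 0" using \<theta> by (simp add: T_def)
  have H: "H \<ge> 0" using B \<theta> by (simp add: H_def)
  have r1: "coupled_run C \<tau> \<tau>\<^sub>s \<nu> \<nu>\<^sub>s \<epsilon> \<tau>\<^sub>0 v\<^sub>0 v\<^sub>1 L T \<theta> H \<mu>\<^sub>0 \<omega>\<^sub>0 \<eta>\<^sub>1 \<phi> f\<^sub>1 g\<^sub>1"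
    by unfold_locales (use L T \<theta> H sol1 unit1 src in \<open>auto simp: H_def\<close>)
  have r2: "coupled_run C \<tau> \<tau>\<^sub>s \<nu> \<nu>\<^sub>s \<epsilon> \<tau>\<^sub>0 v\<^sub>0 v\<^sub>1 L T \<theta> H \<mu>\<^sub>0 \<omega>\<^sub>0 \<eta>\<^sub>2 \<phi> f\<^sub>2 g\<^sub>2"
    by unfold_locales (use L T \<theta> H sol2 unit2 src in \<open>auto simp: H_def\<close>)
  define X where "X = 4 * (H * \<theta>\<^sup>2) * D * e / (\<tau>\<^sub>0 * C_tau C \<tau>) +
    6 * \<kappa> * (2 * field_sup H \<theta> T * sqrt \<theta> + field_mass H \<theta> T * T / (\<epsilon> * v\<^sub>0 * sqrt \<theta>))"
  have "X \<ge> 0"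
    unfolding X_def using H De \<theta> T eps_pos tau0_pos v0_pos C_tau_both_pos field_sup_nonneg[OF H, of \<theta> T] field_mass_nonneg[OF H, of \<theta> T]
    by (intro add_nonneg_nonneg mult_nonneg_nonneg divide_nonneg_nonneg) auto
  have "\<bar>measurement C \<tau> tmax (window_test \<psi>\<^sub>t t\<^sub>1 \<theta>) f\<^sub>1 - measurement C \<tau> tmax (window_test \<psi>\<^sub>t t\<^sub>1 \<theta>) f\<^sub>2\<bar>
      \<le> X * (LINT t|lborel. \<bar>window_test \<psi>\<^sub>t t\<^sub>1 \<theta> t\<bar>)"
  proof (rule measurement_difference_le[OF r1 r2])
    show "\<bar>Delta_T C \<tau> f\<^sub>1 t 0 - Delta_T C \<tau> f\<^sub>2 t 0\<bar> \<le> X" if "0 < t" "t \<le> T" for t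
      unfolding X_def by (rule trace_difference_le[OF r1 r2 D e De that]) (use \<theta> in auto)
    show "integrable lborel (window_test \<psi>\<^sub>t t\<^sub>1 \<theta>)"
      by (rule integrable_window_test) fact+
    show "0 < t \<and> t \<le> T" if "window_test \<psi>\<^sub>t t\<^sub>1 \<theta> t \<noteq> 0" for t
    proof -
      have "(t - t\<^sub>1) / \<theta> \<in> {-1<..<1}"
        using that \<psi>(2) unfolding window_test_def by blast
      then show ?thesis using \<theta> by (auto simp: field_simps T_def)
    qed
  qed fact
  also have "(LINT t|lborel. \<bar>window_test \<psi>\<^sub>t t\<^sub>1 \<theta> t\<bar>) = \<theta> * I"
    unfolding I_def by (rule integrable_window_test) fact+
  also have "X * (\<theta> * I) = 4 * B * I / (\<tau>\<^sub>0 * C_tau C \<tau>) * D * e +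
      6 * \<kappa> * I * (2 * field_sup B 1 T + field_mass B 1 T * T / (\<epsilon> * v\<^sub>0)) * sqrt \<theta>"
  proof -
    define r where "r = sqrt \<theta>"
    have r: "r > 0" "\<theta> = r * r" using \<theta> by (auto simp: r_def)
    have H2: "H * \<theta>\<^sup>2 = B / \<theta>" and H3: "H * \<theta> ^ 3 = B"
      using \<theta> by (auto simp: H_def power2_eq_square power3_eq_cube)
    have fs: "field_sup H \<theta> T = field_sup B 1 T / \<theta>"
    proof -
      have "24 * H * \<theta>\<^sup>2 = 24 * B / \<theta>" using H2 by (simp add: mult.assoc)
      then show ?thesis unfolding field_sup_def by simp
    qed
    have fm: "field_mass H \<theta> T = field_mass B 1 T"
    proof -
      have "48 * v\<^sub>1 / \<epsilon> * H * \<theta> ^ 3 = 48 * v\<^sub>1 / \<epsilon> * B" using H3 by (simp add: mult.assoc)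
      then show ?thesis unfolding field_mass_def by (simp only: power_one mult_1_right)
    qed
    have "X * (\<theta> * I) = 4 * (B / \<theta>) * D * e / (\<tau>\<^sub>0 * C_tau C \<tau>) * (\<theta> * I) +
      6 * \<kappa> * (2 * (field_sup B 1 T / \<theta>) * r + field_mass B 1 T * T / (\<epsilon> * v\<^sub>0 * r)) * (\<theta> * I)"
      unfolding X_def H2 fs fm r_def by (rule distrib_right)
    also have "4 * (B / \<theta>) * D * e / (\<tau>\<^sub>0 * C_tau C \<tau>) * (\<theta> * I) = 4 * B * I / (\<tau>\<^sub>0 * C_tau C \<tau>) * D * e"
      using \<theta> by (simp add: mult_ac)
    also have "6 * \<kappa> * (2 * (field_sup B 1 T / \<theta>) * r + field_mass B 1 T * T / (\<epsilon> * v\<^sub>0 * r)) * (\<theta> * I) =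
        6 * \<kappa> * I * (2 * field_sup B 1 T + field_mass B 1 T * T / (\<epsilon> * v\<^sub>0)) * r"
    proof -
      have scale: "(2 * (field_sup B 1 T / \<theta>) * r + field_mass B 1 T * T / (\<epsilon> * v\<^sub>0 * r)) * \<theta> =
          (2 * field_sup B 1 T + field_mass B 1 T * T / (\<epsilon> * v\<^sub>0)) * r"
        using r eps_pos v0_pos by (simp add: field_simps)
      have reorder: "k * Y * (\<theta> * I) = k * I * (Y * \<theta>)" for k Y :: real
        by (simp only: mult_ac)
      show ?thesis unfolding reorder scale by (simp only: mult.assoc)
    qed
    finally show ?thesis by (simp only: r_def)
  qed
  finally show ?thesis by (simp only: I_def T_def)
qed

end

theorem theorem3p2:
  fixes hbar kB T0 L\<^sub>s p q \<alpha> \<mu>\<^sub>0 \<omega>\<^sub>0 :: real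
    and D C \<tau> \<nu> \<tau>\<^sub>s \<nu>\<^sub>s \<phi>\<^sub>t \<phi>\<^sub>\<mu> \<phi>\<^sub>\<omega> \<psi>\<^sub>t :: "real \<Rightarrow> real"
  assumes "hbar > 0" "kB > 0" "T0 > 0" "\<forall>\<omega>>0. D \<omega> > 0"
    and "C = C_omega hbar kB T0 D"
    and "set_integrable lborel {0<..} (\<lambda>\<omega>. C \<omega> / \<tau> \<omega>)"
    and "set_integrable lborel {0<..} (\<lambda>\<omega>. C \<omega> / \<tau>\<^sub>s \<omega>)"
    and "L\<^sub>s > 0"
    and "cond_A1 \<tau>" "cond_A1 \<tau>\<^sub>s"
    and "cond_A2 \<nu>" "cond_A2 \<nu>\<^sub>s"
    and "1 < p" "p < 3 / 2"
    and "cond_A4 C p \<tau> \<nu>" "cond_A4 C p \<tau>\<^sub>s \<nu>\<^sub>s"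
    and "1 / p + 1 / q = 1"
    and "\<alpha> > (q + 1) / (q - 3)"
    and "\<omega>\<^sub>0 > 0"
    and "0 < \<mu>\<^sub>0" "\<mu>\<^sub>0 \<le> 1"
    and "smooth_fun \<phi>\<^sub>t" "\<forall>s. s \<notin> {-1..1} \<longrightarrow> \<phi>\<^sub>t s = 0"
    and "smooth_fun \<phi>\<^sub>\<mu>" "\<forall>s. s \<notin> {-1..1} \<longrightarrow> \<phi>\<^sub>\<mu> s = 0"
    and "smooth_fun \<phi>\<^sub>\<omega>" "\<forall>s. s \<notin> {-1..1} \<longrightarrow> \<phi>\<^sub>\<omega> s = 0"
    and "\<psi>\<^sub>t \<in> borel_measurable borel" "integrable lborel (\<lambda>s. \<bar>\<psi>\<^sub>t s\<bar> powr q)"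
    and "\<forall>s. s \<notin> {-1<..<1} \<longrightarrow> \<psi>\<^sub>t s = 0"
  shows "\<exists>c\<^sub>0>0. \<exists>c\<^sub>1>0. \<forall>\<epsilon> tmax \<eta>\<^sub>1 \<eta>\<^sub>2 \<Theta> src. \<forall>f\<^sub>1 g\<^sub>1 f\<^sub>2 g\<^sub>2 :: real \<Rightarrow> phase_fun.
    0 < \<epsilon> \<and> \<epsilon> < 1 \<and>
    \<eta>\<^sub>1 \<in> Omega \<and> interface_coeffs_in_unit \<nu> \<nu>\<^sub>s \<eta>\<^sub>1 \<and>
    \<eta>\<^sub>2 \<in> Omega \<and> interface_coeffs_in_unit \<nu> \<nu>\<^sub>s \<eta>\<^sub>2 \<and>
    src = (\<lambda>\<theta>. concentrated_source \<phi>\<^sub>t \<phi>\<^sub>\<mu> \<phi>\<^sub>\<omega> \<mu>\<^sub>0 \<omega>\<^sub>0 \<theta> \<theta> \<theta>) \<and>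
    \<Theta> = {\<theta>. 0 < \<theta> \<and> \<theta> \<le> \<epsilon> powr \<alpha> \<and> tmax > 2 * \<epsilon> / \<nu> \<omega>\<^sub>0 + \<theta> \<and> cond_A5 C p (src \<theta>)} \<and>
    (\<forall>\<theta>\<in>\<Theta>. coupled_solution C L\<^sub>s \<epsilon> \<nu> \<tau> \<nu>\<^sub>s \<tau>\<^sub>s \<eta>\<^sub>1 (src \<theta>) (f\<^sub>1 \<theta>) (g\<^sub>1 \<theta>)) \<and>
    (\<forall>\<theta>\<in>\<Theta>. coupled_solution C L\<^sub>s \<epsilon> \<nu> \<tau> \<nu>\<^sub>s \<tau>\<^sub>s \<eta>\<^sub>2 (src \<theta>) (f\<^sub>2 \<theta>) (g\<^sub>2 \<theta>)) \<longrightarrow>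
    Limsup (at 0 within \<Theta>)
      (\<lambda>\<theta>. let \<psi> = window_test \<psi>\<^sub>t (2 * \<epsilon> / (\<mu>\<^sub>0 * \<nu> \<omega>\<^sub>0)) \<theta> in
        ereal \<bar>measurement C \<tau> tmax \<psi> (f\<^sub>1 \<theta>) - measurement C \<tau> tmax \<psi> (f\<^sub>2 \<theta>)\<bar>)
    \<le> ereal (c\<^sub>1 * \<bar>\<eta>\<^sub>1 \<omega>\<^sub>0 - \<eta>\<^sub>2 \<omega>\<^sub>0\<bar> * exp (- c\<^sub>0 / \<epsilon>))"
proof -
  have C_pos: "C \<omega> > 0" if "\<omega> > 0" for \<omega>
    using assms(1-5) that by (simp add: C_omega_pos)
  from \<open>cond_A1 \<tau>\<close> obtain \<tau>\<^sub>1 where \<tau>1: "\<tau>\<^sub>1 > 0" "\<forall>\<omega>>0. \<tau>\<^sub>1 \<le> \<tau> \<omega>"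
    unfolding cond_A1_def by blast
  from \<open>cond_A1 \<tau>\<^sub>s\<close> obtain \<tau>\<^sub>2 where \<tau>2: "\<tau>\<^sub>2 > 0" "\<forall>\<omega>>0. \<tau>\<^sub>2 \<le> \<tau>\<^sub>s \<omega>"
    unfolding cond_A1_def by blast
  have \<tau>12: "\<tau>\<^sub>1 > 0" "\<And>\<omega>. \<omega> > 0 \<Longrightarrow> \<tau>\<^sub>1 \<le> \<tau> \<omega>" "\<tau>\<^sub>2 > 0" "\<And>\<omega>. \<omega> > 0 \<Longrightarrow> \<tau>\<^sub>2 \<le> \<tau>\<^sub>s \<omega>"
    using \<tau>1 \<tau>2 by simp_all
  define \<tau>\<^sub>0 where "\<tau>\<^sub>0 = min \<tau>\<^sub>1 \<tau>\<^sub>2"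
  from \<open>cond_A2 \<nu>\<close> obtain a b where ab1: "0 < a" "\<forall>\<omega>>0. a \<le> \<nu> \<omega> \<and> \<nu> \<omega> \<le> b"
    unfolding cond_A2_def by blast
  from \<open>cond_A2 \<nu>\<^sub>s\<close> obtain a' b' where ab2: "0 < a'" "\<forall>\<omega>>0. a' \<le> \<nu>\<^sub>s \<omega> \<and> \<nu>\<^sub>s \<omega> \<le> b'"
    unfolding cond_A2_def by blast
  have ab: "a > 0" "\<And>\<omega>. \<omega> > 0 \<Longrightarrow> a \<le> \<nu> \<omega> \<and> \<nu> \<omega> \<le> b"
      "a' > 0" "\<And>\<omega>. \<omega> > 0 \<Longrightarrow> a' \<le> \<nu>\<^sub>s \<omega> \<and> \<nu>\<^sub>s \<omega> \<le> b'"
    using ab1 ab2 by simp_all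
  define v\<^sub>0 v\<^sub>1 where "v\<^sub>0 = min a a'" and "v\<^sub>1 = max b b'"
  have cont: "continuous_on {0<..} \<nu>" "continuous_on {0<..} \<nu>\<^sub>s" "continuous_on {0<..} \<tau>"
    using \<open>cond_A2 \<nu>\<close> \<open>cond_A2 \<nu>\<^sub>s\<close> \<open>cond_A1 \<tau>\<close> unfolding cond_A2_def cond_A1_def
    by (auto intro: differentiable_imp_continuous_on)
  have velm: "vel u \<in> borel_measurable borel" if "continuous_on {0<..} u" for u
    using borel_measurable_continuous_on_indicator[OF _ that] by (simp add: vel_def[abs_def])
  have media: "two_media C \<tau> \<tau>\<^sub>s \<nu> \<nu>\<^sub>s \<epsilon> \<tau>\<^sub>0 v\<^sub>0 v\<^sub>1" if "\<epsilon> > 0" for \<epsilon>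
  proof unfold_locales
    show "\<tau>\<^sub>0 \<le> \<tau> \<omega>" "\<tau>\<^sub>0 \<le> \<tau>\<^sub>s \<omega>" "v\<^sub>0 \<le> \<nu> \<omega>" "v\<^sub>0 \<le> \<nu>\<^sub>s \<omega>" "\<nu> \<omega> \<le> v\<^sub>1" "\<nu>\<^sub>s \<omega> \<le> v\<^sub>1" if "\<omega> > 0" for \<omega>
      using \<tau>12(2)[OF that] \<tau>12(4)[OF that] ab(2)[OF that] ab(4)[OF that]
      by (auto simp: \<tau>\<^sub>0_def v\<^sub>0_def v\<^sub>1_def)
  qed (use that \<tau>12 ab C_pos velm cont assms(6,7) in \<open>auto simp: \<tau>\<^sub>0_def v\<^sub>0_def\<close>)
  obtain B\<^sub>t where Bt: "B\<^sub>t > 0" "\<And>s. \<bar>\<phi>\<^sub>t s\<bar> \<le> B\<^sub>t" using smooth_profile_bounded[OF assms(22,23)] by metis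
  obtain B\<^sub>\<mu> where Bm: "B\<^sub>\<mu> > 0" "\<And>s. \<bar>\<phi>\<^sub>\<mu> s\<bar> \<le> B\<^sub>\<mu>" using smooth_profile_bounded[OF assms(24,25)] by metis
  obtain B\<^sub>\<omega> where Bo: "B\<^sub>\<omega> > 0" "\<And>s. \<bar>\<phi>\<^sub>\<omega> s\<bar> \<le> B\<^sub>\<omega>" using smooth_profile_bounded[OF assms(26,27)] by metis
  define B where "B = B\<^sub>t * B\<^sub>\<mu> * B\<^sub>\<omega>"
  have B: "B \<ge> 0" using Bt Bm Bo by (simp add: B_def)
  have "q > 1"
  proof -
    have "0 < 1 / p" "1 / p < 1" using \<open>1 < p\<close> by simp_all
    then have q: "0 < 1 / q" "1 / q < 1" using \<open>1 / p + 1 / q = 1\<close> by linarith+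
    then have "q > 0" by (simp add: zero_less_divide_iff)
    with q(2) show ?thesis by simp
  qed
  then have psi_int: "integrable lborel \<psi>\<^sub>t"
    using assms(28-30) by (intro integrable_powr_support[of \<psi>\<^sub>t q]) auto
  define I where "I = (LINT s|lborel. \<bar>\<psi>\<^sub>t s\<bar>)"
  have I: "I \<ge> 0" by (simp add: I_def)
  have tau0: "\<tau>\<^sub>0 > 0" using \<tau>12 by (simp add: \<tau>\<^sub>0_def)
  have Ct: "C_tau C \<tau> > 0"
    using two_media.C_tau_both_pos(1)[OF media[OF zero_less_one]] .
  have nu0: "\<nu> \<omega>\<^sub>0 > 0" "\<tau> \<omega>\<^sub>0 > 0"
    using ab(1,2) \<tau>12(1,2) \<open>\<omega>\<^sub>0 > 0\<close> by (meson less_le_trans)+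
  define A where "A = 4 * B * I / (\<tau>\<^sub>0 * C_tau C \<tau>)"
  have A: "A \<ge> 0" using B I tau0 Ct by (simp add: A_def)
  define c\<^sub>0 where "c\<^sub>0 = 1 / (\<mu>\<^sub>0 * \<nu> \<omega>\<^sub>0 * \<tau> \<omega>\<^sub>0)"
  have c0: "c\<^sub>0 > 0" using nu0 \<open>0 < \<mu>\<^sub>0\<close> by (simp add: c\<^sub>0_def)
  have A1: "A + 1 > 0" using A by simp
  show ?thesis
  proof (rule exI[of _ c\<^sub>0], rule conjI[OF c0], rule exI[of _ "A + 1"], rule conjI[OF A1], intro allI impI)
    fix \<epsilon> tmax :: real and \<eta>\<^sub>1 \<eta>\<^sub>2 :: "real \<Rightarrow> real" and \<Theta> src and f\<^sub>1 g\<^sub>1 f\<^sub>2 g\<^sub>2 :: "real \<Rightarrow> phase_fun"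
    assume H: "0 < \<epsilon> \<and> \<epsilon> < 1 \<and>
      \<eta>\<^sub>1 \<in> Omega \<and> interface_coeffs_in_unit \<nu> \<nu>\<^sub>s \<eta>\<^sub>1 \<and>
      \<eta>\<^sub>2 \<in> Omega \<and> interface_coeffs_in_unit \<nu> \<nu>\<^sub>s \<eta>\<^sub>2 \<and>
      src = (\<lambda>\<theta>. concentrated_source \<phi>\<^sub>t \<phi>\<^sub>\<mu> \<phi>\<^sub>\<omega> \<mu>\<^sub>0 \<omega>\<^sub>0 \<theta> \<theta> \<theta>) \<and>
      \<Theta> = {\<theta>. 0 < \<theta> \<and> \<theta> \<le> \<epsilon> powr \<alpha> \<and> tmax > 2 * \<epsilon> / \<nu> \<omega>\<^sub>0 + \<theta> \<and> cond_A5 C p (src \<theta>)} \<and>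
      (\<forall>\<theta>\<in>\<Theta>. coupled_solution C L\<^sub>s \<epsilon> \<nu> \<tau> \<nu>\<^sub>s \<tau>\<^sub>s \<eta>\<^sub>1 (src \<theta>) (f\<^sub>1 \<theta>) (g\<^sub>1 \<theta>)) \<and>
      (\<forall>\<theta>\<in>\<Theta>. coupled_solution C L\<^sub>s \<epsilon> \<nu> \<tau> \<nu>\<^sub>s \<tau>\<^sub>s \<eta>\<^sub>2 (src \<theta>) (f\<^sub>2 \<theta>) (g\<^sub>2 \<theta>))"
    then have \<epsilon>: "\<epsilon> > 0" by blast
    interpret two_media C \<tau> \<tau>\<^sub>s \<nu> \<nu>\<^sub>s \<epsilon> \<tau>\<^sub>0 v\<^sub>0 v\<^sub>1 by (rule media[OF \<epsilon>])
    define t\<^sub>1 where "t\<^sub>1 = 2 * \<epsilon> / (\<mu>\<^sub>0 * \<nu> \<omega>\<^sub>0)"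
    have t1: "t\<^sub>1 > 0" using \<epsilon> nu0 \<open>0 < \<mu>\<^sub>0\<close> by (simp add: t\<^sub>1_def)
    define d\<^sub>0 where "d\<^sub>0 = \<bar>\<eta>\<^sub>1 \<omega>\<^sub>0 - \<eta>\<^sub>2 \<omega>\<^sub>0\<bar>"
    define E where "E = exp (- c\<^sub>0 / \<epsilon>)"
    have E: "0 \<le> E" "E \<le> 1" using c0 \<epsilon> by (auto simp: E_def)
    define K where "K = 6 * (2 / (\<epsilon> * \<tau>\<^sub>0)) * I *
      (2 * field_sup B 1 (t\<^sub>1 + 1) + field_mass B 1 (t\<^sub>1 + 1) * (t\<^sub>1 + 1) / (\<epsilon> * v\<^sub>0))"
    have K: "K \<ge> 0"
      unfolding K_def using I tau0 \<epsilon> t1 v0_pos B field_sup_nonneg[of B 1] field_mass_nonneg[of B 1]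
      by (intro mult_nonneg_nonneg add_nonneg_nonneg divide_nonneg_nonneg) auto
    let ?m = "\<lambda>\<theta>. \<bar>measurement C \<tau> tmax (window_test \<psi>\<^sub>t t\<^sub>1 \<theta>) (f\<^sub>1 \<theta>) - measurement C \<tau> tmax (window_test \<psi>\<^sub>t t\<^sub>1 \<theta>) (f\<^sub>2 \<theta>)\<bar>"
    have "Limsup (at 0 within \<Theta>) (\<lambda>\<theta>. ereal (?m \<theta>)) \<le> ereal ((A + 1) * d\<^sub>0 * E) + ereal r" if r: "r > 0" for r
    proof -
      have half: "x * (r / (2 * x)) = r / 2" if "x > 0" for x :: real
        using that by simp
      \<comment> \<open>Half of the error \<open>r\<close> is spent on the continuity of \<open>\<eta>\<^sub>1 - \<eta>\<^sub>2\<close>, half on the scattered part.\<close>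
      define \<rho> where "\<rho> = r / (2 * (A + 1))"
      have \<rho>: "\<rho> > 0" using r A by (simp add: \<rho>_def)
      have near: "\<exists>\<delta>>0. \<forall>\<omega>. \<bar>\<omega> - \<omega>\<^sub>0\<bar> \<le> \<delta> \<and> \<omega> > 0 \<longrightarrow> \<bar>u \<omega> - u \<omega>\<^sub>0\<bar> \<le> x"
        if u: "continuous_on {0<..} u" and "x > 0" for u :: "real \<Rightarrow> real" and x
      proof -
        obtain \<delta> where \<delta>: "\<delta> > 0" "\<forall>\<omega>\<in>{0<..}. dist \<omega> \<omega>\<^sub>0 < \<delta> \<longrightarrow> dist (u \<omega>) (u \<omega>\<^sub>0) < x"
          using u \<open>x > 0\<close> \<open>\<omega>\<^sub>0 > 0\<close> unfolding continuous_on_iff by (meson greaterThan_iff)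
        have "\<forall>\<omega>. \<bar>\<omega> - \<omega>\<^sub>0\<bar> \<le> \<delta> / 2 \<and> \<omega> > 0 \<longrightarrow> \<bar>u \<omega> - u \<omega>\<^sub>0\<bar> \<le> x"
          using \<delta> by (force simp: dist_real_def)
        then show ?thesis using \<delta>(1) by (intro exI[of _ "\<delta> / 2"]) auto
      qed
      have "continuous_on {0<..} (\<lambda>\<omega>. \<eta>\<^sub>1 \<omega> - \<eta>\<^sub>2 \<omega>)"
        using H by (intro continuous_on_diff) (auto simp: Omega_def)
      from near[OF this \<rho>] obtain \<delta>\<^sub>1 where \<delta>1: "\<delta>\<^sub>1 > 0"
        "\<And>\<omega>. \<bar>\<omega> - \<omega>\<^sub>0\<bar> \<le> \<delta>\<^sub>1 \<Longrightarrow> \<omega> > 0 \<Longrightarrow> \<bar>(\<eta>\<^sub>1 \<omega> - \<eta>\<^sub>2 \<omega>) - (\<eta>\<^sub>1 \<omega>\<^sub>0 - \<eta>\<^sub>2 \<omega>\<^sub>0)\<bar> \<le> \<rho>"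
        by blast
      define k where "k = \<nu> \<omega>\<^sub>0 * \<tau> \<omega>\<^sub>0"
      have k: "k > 0" using nu0 by (simp add: k_def)
      have "continuous_on {0<..} (\<lambda>\<omega>. \<nu> \<omega> * \<tau> \<omega>)"
        using cont by (intro continuous_on_mult)
      from near[OF this, of "k / 4"] k obtain \<delta>\<^sub>2 where \<delta>2: "\<delta>\<^sub>2 > 0"
        "\<And>\<omega>. \<bar>\<omega> - \<omega>\<^sub>0\<bar> \<le> \<delta>\<^sub>2 \<Longrightarrow> \<omega> > 0 \<Longrightarrow> \<bar>\<nu> \<omega> * \<tau> \<omega> - k\<bar> \<le> k / 4"
        unfolding k_def by (auto simp: divide_pos_pos)
      define s where "s = r / (2 * (K + 1))"
      have s: "s > 0" using r K by (simp add: s_def)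
      define d where "d = Min {\<delta>\<^sub>1, \<delta>\<^sub>2, \<mu>\<^sub>0 / 4, 1, t\<^sub>1, s\<^sup>2}"
      have d: "d > 0" "d \<le> \<delta>\<^sub>1" "d \<le> \<delta>\<^sub>2" "d \<le> \<mu>\<^sub>0 / 4" "d \<le> 1" "d \<le> t\<^sub>1" "d \<le> s\<^sup>2"
        using \<delta>1(1) \<delta>2(1) \<open>0 < \<mu>\<^sub>0\<close> t1 s by (auto simp: d_def)
      have bound: "?m \<theta> \<le> (A + 1) * d\<^sub>0 * E + r" if "\<theta> \<in> \<Theta>" "\<theta> < d" for \<theta>
      proof -
        have \<theta>: "0 < \<theta>" "\<theta> \<le> 1" "\<theta> \<le> t\<^sub>1" using that H d by auto
        have sol: "coupled_solution C L\<^sub>s \<epsilon> \<nu> \<tau> \<nu>\<^sub>s \<tau>\<^sub>s \<eta>\<^sub>1 (src \<theta>) (f\<^sub>1 \<theta>) (g\<^sub>1 \<theta>)"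
          "coupled_solution C L\<^sub>s \<epsilon> \<nu> \<tau> \<nu>\<^sub>s \<tau>\<^sub>s \<eta>\<^sub>2 (src \<theta>) (f\<^sub>2 \<theta>) (g\<^sub>2 \<theta>)"
          using H that by blast+
        have unit: "interface_coeffs_in_unit \<nu> \<nu>\<^sub>s \<eta>\<^sub>1" "interface_coeffs_in_unit \<nu> \<nu>\<^sub>s \<eta>\<^sub>2"
          using H by blast+
        have srcle: "\<bar>src \<theta> t \<mu> \<omega>\<bar> \<le>
          B / \<theta> ^ 3 * indicator {-\<theta>..\<theta>} t * indicator {\<mu>\<^sub>0 - \<theta>..\<mu>\<^sub>0 + \<theta>} \<mu> * indicator {\<omega>\<^sub>0 - \<theta>..\<omega>\<^sub>0 + \<theta>} \<omega>" for t \<mu> \<omega>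
        proof -
          have "src \<theta> = concentrated_source \<phi>\<^sub>t \<phi>\<^sub>\<mu> \<phi>\<^sub>\<omega> \<mu>\<^sub>0 \<omega>\<^sub>0 \<theta> \<theta> \<theta>" using H by simp
          then show ?thesis
            unfolding B_def using concentrated_source_abs_le[OF Bt(2) Bm(2) Bo(2) assms(23,25,27) \<theta>(1)] by simp
        qed
        have "?m \<theta> \<le> 4 * B * I / (\<tau>\<^sub>0 * C_tau C \<tau>) * (d\<^sub>0 + \<rho>) * E + K * sqrt \<theta>"
          unfolding K_def I_def
        proof (rule concentrated_measurement_le[OF sol(1) unit(1) sol(2) unit(2) \<open>L\<^sub>s > 0\<close> \<theta> B srcle psi_int assms(30)])
          show "\<bar>\<eta>\<^sub>1 \<omega> - \<eta>\<^sub>2 \<omega>\<bar> \<le> d\<^sub>0 + \<rho>" if "\<omega> > 0" "\<bar>\<omega> - \<omega>\<^sub>0\<bar> \<le> \<theta>" for \<omega>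
            using \<delta>1(2)[of \<omega>] that \<open>\<theta> < d\<close> d unfolding d\<^sub>0_def by linarith
          show "exp (- (2 / (\<mu> * \<nu> \<omega>)) / (\<epsilon> * \<tau> \<omega>)) \<le> E"
            if "\<omega> > 0" "\<bar>\<omega> - \<omega>\<^sub>0\<bar> \<le> \<theta>" "0 < \<mu>" "\<bar>\<mu> - \<mu>\<^sub>0\<bar> \<le> \<theta>" for \<mu> \<omega>
          proof -
            have nt: "\<nu> \<omega> * \<tau> \<omega> > 0" using nu_pos(1) tau_pos(1) that by simp
            \<comment> \<open>\<open>(5 / 4)\<^sup>2 \<le> 2\<close> is the room left by halving the rate in \<open>c\<^sub>0\<close>.\<close>
            have "\<mu> \<le> 5 / 4 * \<mu>\<^sub>0" using that \<open>\<theta> < d\<close> d by linarith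
            moreover have "\<nu> \<omega> * \<tau> \<omega> \<le> 5 / 4 * k"
              using \<delta>2(2)[of \<omega>] that \<open>\<theta> < d\<close> d by linarith
            ultimately have "\<mu> * (\<nu> \<omega> * \<tau> \<omega>) \<le> (5 / 4 * \<mu>\<^sub>0) * (5 / 4 * k)"
              by (rule mult_mono) (use that nt \<open>0 < \<mu>\<^sub>0\<close> in auto)
            also have "\<dots> \<le> 2 * (\<mu>\<^sub>0 * k)" using k \<open>0 < \<mu>\<^sub>0\<close> by simp
            finally have le: "\<mu> * (\<nu> \<omega> * \<tau> \<omega>) \<le> 2 * (\<mu>\<^sub>0 * k)" .
            have "c\<^sub>0 = 2 / (2 * (\<mu>\<^sub>0 * k))" by (simp add: c\<^sub>0_def k_def mult.assoc)
            also have "\<dots> \<le> 2 / (\<mu> * (\<nu> \<omega> * \<tau> \<omega>))"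
              using le nt that k \<open>0 < \<mu>\<^sub>0\<close> by (intro divide_left_mono) auto
            finally have "c\<^sub>0 / \<epsilon> \<le> 2 / (\<mu> * (\<nu> \<omega> * \<tau> \<omega>)) / \<epsilon>"
              using \<epsilon> by (intro divide_right_mono) auto
            also have "\<dots> = (2 / (\<mu> * \<nu> \<omega>)) / (\<epsilon> * \<tau> \<omega>)" by (simp add: mult_ac)
            finally show ?thesis by (simp add: E_def)
          qed
        qed (use \<rho> E d\<^sub>0_def in auto)
        also have "4 * B * I / (\<tau>\<^sub>0 * C_tau C \<tau>) = A" by (simp add: A_def)
        also have "A * (d\<^sub>0 + \<rho>) * E + K * sqrt \<theta> \<le> (A + 1) * d\<^sub>0 * E + r"
        proof -
          have "A * d\<^sub>0 * E \<le> (A + 1) * d\<^sub>0 * E"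
            using E by (intro mult_right_mono) (auto simp: d\<^sub>0_def)
          moreover have "A * \<rho> * E \<le> r / 2"
          proof -
            have "A * \<rho> * E \<le> (A + 1) * \<rho> * 1" using A \<rho> E by (intro mult_mono) auto
            moreover have "(A + 1) * \<rho> = r / 2" unfolding \<rho>_def by (rule half[OF A1])
            ultimately show ?thesis by linarith
          qed
          moreover have "K * sqrt \<theta> \<le> r / 2"
          proof -
            have "sqrt \<theta> \<le> s" using \<open>\<theta> < d\<close> d s by (intro real_le_lsqrt) auto
            then have "K * sqrt \<theta> \<le> (K + 1) * s" using K \<theta> by (intro mult_mono) auto
            moreover have "(K + 1) * s = r / 2" unfolding s_def by (rule half) (use K in simp)
            ultimately show ?thesis by linarith
          qed
          ultimately show ?thesis by (simp add: distrib_left distrib_right)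
        qed
        finally show ?thesis .
      qed
      have "eventually (\<lambda>\<theta>. ereal (?m \<theta>) \<le> ereal ((A + 1) * d\<^sub>0 * E + r)) (at 0 within \<Theta>)"
        unfolding eventually_at using d(1) bound by (intro exI[of _ d]) (auto simp: dist_real_def)
      then have "Limsup (at 0 within \<Theta>) (\<lambda>\<theta>. ereal (?m \<theta>)) \<le> ereal ((A + 1) * d\<^sub>0 * E + r)"
        by (rule Limsup_bounded)
      then show ?thesis by simp
    qed
    then have "Limsup (at 0 within \<Theta>) (\<lambda>\<theta>. ereal (?m \<theta>)) \<le> ereal ((A + 1) * d\<^sub>0 * E)"
      by (rule ereal_le_epsilon2)
    then show "Limsup (at 0 within \<Theta>)
      (\<lambda>\<theta>. let \<psi> = window_test \<psi>\<^sub>t (2 * \<epsilon> / (\<mu>\<^sub>0 * \<nu> \<omega>\<^sub>0)) \<theta> in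
        ereal \<bar>measurement C \<tau> tmax \<psi> (f\<^sub>1 \<theta>) - measurement C \<tau> tmax \<psi> (f\<^sub>2 \<theta>)\<bar>)
      \<le> ereal ((A + 1) * \<bar>\<eta>\<^sub>1 \<omega>\<^sub>0 - \<eta>\<^sub>2 \<omega>\<^sub>0\<bar> * exp (- c\<^sub>0 / \<epsilon>))"
      unfolding Let_def d\<^sub>0_def E_def t\<^sub>1_def .
  qed
qed

end
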